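(* Let $\varepsilon>0$. Suppose that $\mu=\mathcal N(0,I_{d_y})$ on $\mathbb{R}^{d_y}$ and that $\nu=\mathcal N\big((0^\top,m_Y^\top)^\top,\Sigma\big)$ on $\mathbb{R}^{d_x+d_y}$ is the law of $(X,Y)$, where $m_Y:=\mathbb{E}[Y]\in\mathbb{R}^{d_y}$ and $$\Sigma=\begin{pmatrix}\Sigma_{XX}&\Sigma_{XY}\\ \Sigma_{YX}&\Sigma_{YY}\end{pmatrix}$$ is nonsingular. Then the following hold. (i) The optimal coupling $\pi^\varepsilon$ for the entropic vector quantile regression problem is the nondegenerate multivariate Gaussian distribution $\mathcal N(m,\Gamma_\varepsilon)$ with $$m:=\begin{pmatrix}0\\ 0\\ m_Y\end{pmatrix},\qquad \Gamma_\varepsilon:=\begin{pmatrix}I_{d_y}&O&\Lambda_\varepsilon\\ O&\Sigma_{XX}&\Sigma_{XY}\\ \Lambda_\varepsilon&\Sigma_{YX}&\Sigma_{YY}\end{pmatrix},$$ where $\Lambda_\varepsilon$ is the $d_y\times d_y$ symmetric positive definite matrix $$\Lambda_\varepsilon:=\Big(\Sigma_{YY}-\Sigma_{YX}\Sigma_{XX}^{-1}\Sigma_{XY}+\frac{\varepsilon^2}{4}I_{d_y}\Big)^{1/2}-\frac{\varepsilon}{2}I_{d_y}.$$ (ii) One can choose versions of dual potentials as $$f^\varepsilon(u)=-\tfrac12u^\top(\Lambda_\varepsilon-I_{d_y})u-m_Y^\top u-\tfrac{\varepsilon}{2}\log\det(\varepsilon\Lambda_\varepsilon\Omega_{YY}),$$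 $$g^\varepsilon(u)=Gu,$$ $$h^\varepsilon(x,y)=-\tfrac12(G^\top x+y-m_Y)^\top\Psi_\varepsilon(G^\top x+y-m_Y)+\tfrac12\|y\|^2,$$ where $G:=-\Sigma_{XX}^{-1}\Sigma_{XY}$, $\Psi_\varepsilon:=\Lambda_\varepsilon\Omega_{YY}$ and $\Omega_{YY}:=(\Sigma_{YY}-\Sigma_{YX}\Sigma_{XX}^{-1}\Sigma_{XY})^{-1}$.
   Context: Points of $\mathbb{R}^{d_y}\times\mathbb{R}^{d_x+d_y}$ are written $(u,x,y)$; $c(u,y):=\frac12\|u-y\|^2$; $R:=\mu\otimes\nu$. $\Pi(\mu,\nu)$ is the set of couplings of $\mu$ and $\nu$; for $\pi\in\Pi(\mu,\nu)$, $\pi_u$ is the conditional law of $(\tilde X,\tilde Y)$ given $U=u$ when $(U,\tilde X,\tilde Y)\sim\pi$. $\mathsf{KL}(P\|Q)=\int\log\frac{dP}{dQ}\,dP$ if $P\ll Q$ and $\infty$ otherwise. Entropic vector quantile regression problem: minimize $\int c\,d\pi+\varepsilon\,\mathsf{KL}(\pi\|\mu\otimes\nu)$ over $\pi\in\Pi(\mu,\nu)$ with $\int x\,d\pi_u(x,y)=0$ for $\mu$-a.e. $u$. It has a unique optimal solution, the optimal coupling $\pi^\varepsilon$. Dual potentials are triples $(f,g,h)\in L^1(\mu)\times L^1(\mu;\mathbb{R}^{d_x})\times L^1(\nu)$ attaining the supremum, over all such triples, of $$D^\varepsilon(f,g,h):=\int f\,d\mu+\int h\,d\nu-\varepsilon\int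 e^{\frac1\varepsilon(f(u)+\langle g(u),x\rangle+h(x,y)-c(u,y))}\,dR(u,x,y)+\varepsilon.$$ $O$ denotes a zero matrix; $A^{1/2}$ is the symmetric positive semidefinite square root. *)

theory Defs
  imports "HOL-Probability.Probability"
begin

section \<open>Matrices\<close>

definition pos_semidef :: "real^'n^'n \<Rightarrow> bool" where
  "pos_semidef A \<longleftrightarrow> transpose A = A \<and> (\<forall>v. 0 \<le> v \<bullet> (A *v v))"

definition pos_def :: "real^'n^'n \<Rightarrow> bool" where
  "pos_def A \<longleftrightarrow> transpose A = A \<and> (\<forall>v. v \<noteq> 0 \<longrightarrow> 0 < v \<bullet> (A *v v))"

definition psd_sqrt :: "real^'n^'n \<Rightarrow> real^'n^'n" where
  "psd_sqrt A = (THE B. pos_semidef B \<and> B ** B = A)"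

text \<open>Block vectors and block matrices are indexed by sum types, \<open>Inl\<close> being the first block.\<close>

definition vjoin :: "real^'a \<Rightarrow> real^'b \<Rightarrow> real^('a + 'b)" where
  "vjoin v w = (\<chi> k. case k of Inl i \<Rightarrow> v $ i | Inr j \<Rightarrow> w $ j)"

definition vsplit :: "real^('a + 'b) \<Rightarrow> (real^'a) \<times> (real^'b)" where
  "vsplit z = ((\<chi> i. z $ Inl i), (\<chi> j. z $ Inr j))"

definition vsplit3 :: "real^('a + ('b + 'c)) \<Rightarrow> (real^'a) \<times> (real^'b) \<times> (real^'c)" where
  "vsplit3 z = (fst (vsplit z), vsplit (snd (vsplit z)))"

definition block2 ::
    "real^'c^'a \<Rightarrow> real^'d^'a \<Rightarrow> real^'c^'b \<Rightarrow> real^'d^'b \<Rightarrow> real^('c + 'd)^('a + 'b)" where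
  "block2 A B C D = (\<chi> k. case k of Inl i \<Rightarrow> vjoin (A $ i) (B $ i)
                                   | Inr i \<Rightarrow> vjoin (C $ i) (D $ i))"

definition block3 ::
    "real^'d^'a \<Rightarrow> real^'e^'a \<Rightarrow> real^'f^'a \<Rightarrow>
     real^'d^'b \<Rightarrow> real^'e^'b \<Rightarrow> real^'f^'b \<Rightarrow>
     real^'d^'c \<Rightarrow> real^'e^'c \<Rightarrow> real^'f^'c \<Rightarrow>
     real^('d + ('e + 'f))^('a + ('b + 'c))" where
  "block3 A11 A12 A13 A21 A22 A23 A31 A32 A33 =
     (\<chi> k. case k of
        Inl i \<Rightarrow> vjoin (A11 $ i) (vjoin (A12 $ i) (A13 $ i))
      | Inr (Inl i) \<Rightarrow> vjoin (A21 $ i) (vjoin (A22 $ i) (A23 $ i))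
      | Inr (Inr i) \<Rightarrow> vjoin (A31 $ i) (vjoin (A32 $ i) (A33 $ i)))"

section \<open>Nondegenerate Gaussian measures\<close>

text \<open>Only meaningful for positive definite \<open>S\<close>.\<close>

definition mvn_density :: "real^'n \<Rightarrow> real^'n^'n \<Rightarrow> real^'n \<Rightarrow> real" where
  "mvn_density m S z =
     exp (- ((z - m) \<bullet> (matrix_inv S *v (z - m))) / 2) / sqrt ((2 * pi) ^ CARD('n) * det S)"

definition mvn :: "real^'n \<Rightarrow> real^'n^'n \<Rightarrow> (real^'n) measure" where
  "mvn m S = density lborel (\<lambda>z. ennreal (mvn_density m S z))"

section \<open>Kullback--Leibler divergence\<close>

text \<open>The negative part of \<open>ln (dP/dQ)\<close> is always \<open>P\<close>-integrable for probability measures, so a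
  failure of integrability means that the integral is \<open>\<infinity>\<close>. The library's \<open>KL_divergence\<close> takes the
  reference measure first and is real-valued.\<close>

definition KL :: "'a measure \<Rightarrow> 'a measure \<Rightarrow> ereal" where
  "KL P Q = (if absolutely_continuous Q P \<and> integrable P (entropy_density (exp 1) Q P)
             then ereal (KL_divergence (exp 1) Q P) else \<infinity>)"

section \<open>Entropic vector quantile regression\<close>

definition cost :: "real^'y \<Rightarrow> real^'y \<Rightarrow> real" where
  "cost u y = (norm (u - y))\<^sup>2 / 2"

definition couplings ::
    "'a::topological_space measure \<Rightarrow> 'b::topological_space measure \<Rightarrow> ('a \<times> 'b) measure set" where
  "couplings \<mu> \<nu> = {\<pi>. sets \<pi> = sets borel \<and> distr \<pi> borel fst = \<mu> \<and> distr \<pi> borel snd = \<nu>}"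

text \<open>\<open>\<kappa>\<close> is a version of the conditional law of the second component given the first one.\<close>

definition is_conditional_law ::
    "('a::topological_space \<times> 'b::topological_space) measure \<Rightarrow> ('a \<Rightarrow> 'b measure) \<Rightarrow> bool" where
  "is_conditional_law \<pi> \<kappa> \<longleftrightarrow>
     \<kappa> \<in> borel \<rightarrow>\<^sub>M prob_algebra borel \<and>
     (\<forall>A\<in>sets borel. \<forall>B\<in>sets borel.
        emeasure \<pi> (A \<times> B) = (\<integral>\<^sup>+u\<in>A. emeasure (\<kappa> u) B \<partial>(distr \<pi> borel fst)))"

text \<open>On Euclidean spaces a conditional law exists and is unique up to null sets, so it does not
  matter which version is used in the constraint.\<close>

definition evqr_feasible ::
    "(real^'y) measure \<Rightarrow> ((real^'x) \<times> (real^'y)) measure \<Rightarrow> ((real^'y) \<times> (real^'x) \<times> (real^'y)) measure set" where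
  "evqr_feasible \<mu> \<nu> = {\<pi> \<in> couplings \<mu> \<nu>. \<exists>\<kappa>. is_conditional_law \<pi> \<kappa> \<and>
     (AE u in \<mu>. integrable (\<kappa> u) fst \<and> (\<integral>z. fst z \<partial>\<kappa> u) = 0)}"

definition evqr_objective ::
    "real \<Rightarrow> (real^'y) measure \<Rightarrow> ((real^'x) \<times> (real^'y)) measure \<Rightarrow>
     ((real^'y) \<times> (real^'x) \<times> (real^'y)) measure \<Rightarrow> ereal" where
  "evqr_objective \<epsilon> \<mu> \<nu> \<pi> =
     enn2ereal (\<integral>\<^sup>+(u, x, y). ennreal (cost u y) \<partial>\<pi>) + ereal \<epsilon> * KL \<pi> (\<mu> \<Otimes>\<^sub>M \<nu>)"

definition is_optimal_coupling ::
    "real \<Rightarrow> (real^'y) measure \<Rightarrow> ((real^'x) \<times> (real^'y)) measure \<Rightarrow>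
     ((real^'y) \<times> (real^'x) \<times> (real^'y)) measure \<Rightarrow> bool" where
  "is_optimal_coupling \<epsilon> \<mu> \<nu> \<pi> \<longleftrightarrow>
     \<pi> \<in> evqr_feasible \<mu> \<nu> \<and>
     (\<forall>\<pi>'\<in>evqr_feasible \<mu> \<nu>. evqr_objective \<epsilon> \<mu> \<nu> \<pi> \<le> evqr_objective \<epsilon> \<mu> \<nu> \<pi>')"

text \<open>The exponential integral may be infinite, in which case the dual objective is \<open>-\<infinity>\<close>.\<close>

definition dual_objective ::
    "real \<Rightarrow> (real^'y) measure \<Rightarrow> ((real^'x) \<times> (real^'y)) measure \<Rightarrow>
     (real^'y \<Rightarrow> real) \<Rightarrow> (real^'y \<Rightarrow> real^'x) \<Rightarrow> ((real^'x) \<times> (real^'y) \<Rightarrow> real) \<Rightarrow> ereal" where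
  "dual_objective \<epsilon> \<mu> \<nu> f g h =
     ereal (\<integral>u. f u \<partial>\<mu>) + ereal (\<integral>z. h z \<partial>\<nu>)
     - ereal \<epsilon> * enn2ereal (\<integral>\<^sup>+(u, x, y).
         ennreal (exp ((1 / \<epsilon>) * (f u + g u \<bullet> x + h (x, y) - cost u y))) \<partial>(\<mu> \<Otimes>\<^sub>M \<nu>))
     + ereal \<epsilon>"

definition dual_admissible ::
    "(real^'y) measure \<Rightarrow> ((real^'x) \<times> (real^'y)) measure \<Rightarrow>
     ((real^'y \<Rightarrow> real) \<times> (real^'y \<Rightarrow> real^'x) \<times> ((real^'x) \<times> (real^'y) \<Rightarrow> real)) set" where
  "dual_admissible \<mu> \<nu> = {(f, g, h). integrable \<mu> f \<and> integrable \<mu> g \<and> integrable \<nu> h}"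

definition are_dual_potentials ::
    "real \<Rightarrow> (real^'y) measure \<Rightarrow> ((real^'x) \<times> (real^'y)) measure \<Rightarrow>
     (real^'y \<Rightarrow> real) \<Rightarrow> (real^'y \<Rightarrow> real^'x) \<Rightarrow> ((real^'x) \<times> (real^'y) \<Rightarrow> real) \<Rightarrow> bool" where
  "are_dual_potentials \<epsilon> \<mu> \<nu> f g h \<longleftrightarrow>
     (f, g, h) \<in> dual_admissible \<mu> \<nu> \<and>
     dual_objective \<epsilon> \<mu> \<nu> f g h =
       (SUP (f', g', h')\<in>dual_admissible \<mu> \<nu>. dual_objective \<epsilon> \<mu> \<nu> f' g' h')"

end

theory Submission
  imports Defs
begin

text \<open>
  Write \<open>S = \<Sigma>YY - \<Sigma>YX \<Sigma>XX\<inverse> \<Sigma>XY\<close> for the Schur complement, so that \<open>X\<close> and the regression residual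
  \<open>W = G\<^sup>T X + Y - m\<^sub>Y \<sim> N(0, S)\<close> are independent under \<open>\<nu>\<close>. The matrix \<open>\<Lambda>\<close> is the positive definite
  solution of \<open>\<Lambda>\<^sup>2 + \<epsilon> \<Lambda> = S\<close> (lemma \<open>shifted_psd_sqrt_quadratic\<close>). Under \<open>\<pi> = N(m, \<Gamma>)\<close> one can therefore
  write \<open>W = \<Lambda> U + noise\<close>, where the noise is \<open>N(0, \<epsilon> \<Lambda>)\<close> and independent of \<open>(U, X)\<close>: given
  \<open>U = u\<close> the law of \<open>X\<close> is still the centred \<open>N(0, \<Sigma>XX)\<close>, which is the mean constraint, while \<open>W\<close>
  changes from \<open>N(0, S)\<close> to \<open>N(\<Lambda> u, \<epsilon> \<Lambda>)\<close>. The quadratic equation for \<open>\<Lambda>\<close> is exactly what makes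
  the second law an exponential tilt of the first one, with log-density
  \<open>\<epsilon>\<inverse> (- u\<^sup>T \<Lambda> u / 2 + u\<^sup>T W - W\<^sup>T \<Psi> W / 2 - const)\<close> (lemma \<open>mvn_tilt\<close>). Expanding \<open>W\<close> and completing
  \<open>u\<^sup>T y\<close> to the cost, the density of \<open>\<pi>\<close> with respect to \<open>\<mu> \<otimes> \<nu>\<close> is
  \<open>exp ((f(u) + \<langle>g(u), x\<rangle> + h(x, y) - c(u, y)) / \<epsilon>)\<close> with the potentials of the theorem.

  A feasible coupling whose density has this form is the unique minimiser, and its \<open>(f, g, h)\<close> are
  dual potentials (lemma \<open>evqr_verification\<close>). For the primal problem, the Gibbs variational
  principle \<open>KL(\<pi>'|R) \<ge> \<integral> ln (d\<pi>/dR) d\<pi>'\<close>, with equality only for \<open>\<pi>' = \<pi>\<close>, bounds the objective of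
  every feasible \<open>\<pi>'\<close> by \<open>\<integral> f d\<mu> + \<integral> h d\<nu>\<close>, because the term with \<open>g\<close> integrates to zero under the mean
  constraint. For the dual problem, \<open>e\<^sup>a \<ge> e\<^sup>b (1 + a - b)\<close> is integrated with \<open>b\<close> the log-density of
  \<open>\<pi>\<close>; the competing \<open>g'\<close> is only integrable, but \<open>\<langle>g'(U), X\<rangle>\<close> is integrable under \<open>\<pi>\<close> because the
  conditional laws of \<open>X\<close> have uniformly bounded first moments.

  The Gaussian facts all come from one change of variables: \<open>N(a, C C\<^sup>T)\<close> is the image of the standard
  Gaussian under \<open>x \<mapsto> a + C x\<close> for every invertible \<open>C\<close> (lemma \<open>mvn_eq_affine_image\<close>). Block triangular
  choices of \<open>C\<close> give the regression decompositions above, and hence the marginals and conditional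
  laws, without computing the inverse or the determinant of a block matrix.
\<close>

section \<open>Symmetric matrices and positive square roots\<close>

lemma quadratic_nonneg_imp_linear_zero:
  fixes a b :: real
  assumes "\<And>t. 0 \<le> 2 * t * a + t\<^sup>2 * b"
  shows "a = 0"
proof (rule ccontr)
  assume a: "a \<noteq> 0"
  define c where "c = 1 + \<bar>b\<bar>"
  have c: "c > 0" "b < c" unfolding c_def by auto
  have "2 * (- a / c) * a + (- a / c)\<^sup>2 * b = a\<^sup>2 / c\<^sup>2 * (b - 2 * c)"
    using c by (simp add: field_simps power2_eq_square)
  moreover have "a\<^sup>2 / c\<^sup>2 * (b - 2 * c) < 0"
    using a c by (intro mult_pos_neg) auto
  ultimately show False using assms[of "- a / c"] by linarith
qed

text \<open>A maximiser of the Rayleigh quotient over the unit sphere of an invariant subspace is an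
  eigenvector.\<close>

lemma selfadjoint_eigenvector_exists:
  fixes f :: "'a::euclidean_space \<Rightarrow> 'a"
  assumes lin: "linear f" and sym: "\<And>x y. x \<bullet> f y = f x \<bullet> y"
    and V: "subspace V" "f ` V \<subseteq> V" "V \<noteq> {0}"
  obtains v l where "v \<in> V" "norm v = 1" "f v = l *\<^sub>R v"
proof -
  interpret f: linear f by fact
  have ne: "V \<inter> sphere 0 1 \<noteq> {}"
  proof -
    obtain w where w: "w \<in> V" "w \<noteq> 0" using V subspace_0 by blast
    then have "w /\<^sub>R norm w \<in> V \<inter> sphere 0 1"
      using V(1) by (auto simp: subspace_scale)
    then show ?thesis by blast
  qed
  have cpt: "compact (V \<inter> sphere 0 1)"
    using closed_subspace[OF V(1)] by (simp add: closed_Int_compact)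
  have "continuous_on (V \<inter> sphere 0 1) (\<lambda>x. x \<bullet> f x)"
    by (intro continuous_intros linear_continuous_on) (use lin linear_conv_bounded_linear in auto)
  then obtain v where v: "v \<in> V" "norm v = 1"
    and max: "\<And>y. y \<in> V \<Longrightarrow> norm y = 1 \<Longrightarrow> y \<bullet> f y \<le> v \<bullet> f v"
    using continuous_attains_sup[OF cpt ne, of "\<lambda>x. x \<bullet> f x"] by auto
  define l where "l = v \<bullet> f v"
  have le: "w \<bullet> f w \<le> l * (w \<bullet> w)" if "w \<in> V" for w
  proof (cases "w = 0")
    case False
    have "(w /\<^sub>R norm w) \<bullet> f (w /\<^sub>R norm w) \<le> l"
      unfolding l_def by (rule max) (use that False V(1) in \<open>auto simp: subspace_scale\<close>)
    then show ?thesis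
      using False by (simp add: f.scaleR dot_square_norm field_simps power2_eq_square)
  qed (simp add: f.zero)
  \<comment> \<open>The form \<open>l |w|\<^sup>2 - w \<bullet> f w\<close> is nonnegative on \<open>V\<close> and vanishes at \<open>v\<close>, so its derivative at \<open>v\<close>
    vanishes.\<close>
  have orth: "w \<bullet> (l *\<^sub>R v - f v) = 0" if w: "w \<in> V" for w
  proof (rule quadratic_nonneg_imp_linear_zero)
    fix t :: real
    have vv: "v \<bullet> v = 1" using v by (simp add: dot_square_norm)
    have "v + t *\<^sub>R w \<in> V" using v w V(1) by (simp add: subspace_add subspace_scale)
    from le[OF this] show "0 \<le> 2 * t * (w \<bullet> (l *\<^sub>R v - f v)) + t\<^sup>2 * (l * (w \<bullet> w) - w \<bullet> f w)"
      using sym[of v w] vv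
      by (simp add: f.add f.scaleR inner_simps inner_commute algebra_simps power2_eq_square l_def)
  qed
  have "l *\<^sub>R v - f v \<in> V"
    using v V by (auto intro!: subspace_diff subspace_scale)
  from orth[OF this] have "f v = l *\<^sub>R v" by simp
  with v show ?thesis using that by blast
qed

lemma selfadjoint_eigenbasis:
  fixes f :: "'a::euclidean_space \<Rightarrow> 'a"
  assumes lin: "linear f" and sym: "\<And>x y. x \<bullet> f y = f x \<bullet> y"
    and V: "subspace V" "f ` V \<subseteq> V"
  shows "\<exists>B. B \<subseteq> V \<and> pairwise orthogonal B \<and> (\<forall>b\<in>B. norm b = 1 \<and> (\<exists>l. f b = l *\<^sub>R b)) \<and> span B = V"
  using V
proof (induction "dim V" arbitrary: V rule: less_induct)
  case less
  interpret f: linear f by fact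
  show ?case
  proof (cases "V = {0}")
    case True
    then show ?thesis by (intro exI[of _ "{}"]) auto
  next
    case False
    obtain v l where v: "v \<in> V" "norm v = 1" "f v = l *\<^sub>R v"
      using selfadjoint_eigenvector_exists[OF lin sym less.prems False] by metis
    have vv: "v \<bullet> v = 1" using v by (simp add: dot_square_norm)
    define W where "W = {w \<in> V. v \<bullet> w = 0}"
    have W: "subspace W" "W \<subseteq> V"
      using less.prems(1) by (auto simp: W_def subspace_def inner_simps)
    have fW: "f ` W \<subseteq> W"
      using less.prems(2) v(3) by (auto simp: W_def sym)
    have "v \<notin> W" using vv by (simp add: W_def)
    then have "dim W < dim V"
      using W v less.prems(1) by (intro dim_psubset) (metis psubsetI span_eq_iff)
    from less.hyps[OF this W(1) fW] obtain B where
      B: "B \<subseteq> W" "pairwise orthogonal B" "\<forall>b\<in>B. norm b = 1 \<and> (\<exists>l. f b = l *\<^sub>R b)" "span B = W"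
      by auto
    show ?thesis
    proof (intro exI[of _ "insert v B"] conjI)
      show "insert v B \<subseteq> V" using v B W by auto
      show "pairwise orthogonal (insert v B)"
        using B(1,2) by (auto simp: pairwise_insert W_def orthogonal_def inner_commute)
      show "\<forall>b\<in>insert v B. norm b = 1 \<and> (\<exists>l. f b = l *\<^sub>R b)" using v B by auto
      show "span (insert v B) = V"
      proof
        show "span (insert v B) \<subseteq> V"
          using v B W less.prems(1) by (intro span_minimal) auto
        show "V \<subseteq> span (insert v B)"
        proof
          fix x assume x: "x \<in> V"
          have "x - (v \<bullet> x) *\<^sub>R v \<in> W"
            using x v less.prems(1) vv by (auto simp: W_def inner_simps subspace_diff subspace_scale)
          then show "x \<in> span (insert v B)"
            unfolding span_insert B(4) by blast
        qed
      qed
    qed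
  qed
qed

lemma symmetric_matrix_inner:
  fixes A :: "real^'n^'n"
  assumes "transpose A = A"
  shows "x \<bullet> (A *v y) = (A *v x) \<bullet> y"
  using assms by (metis dot_lmul_matrix transpose_matrix_vector)

lemma symmetric_matrix_eigenbasis:
  fixes A :: "real^'n^'n"
  assumes "transpose A = A"
  obtains B l where "finite B" "pairwise orthogonal B" "\<And>b. b \<in> B \<Longrightarrow> norm b = 1"
    "\<And>b. b \<in> B \<Longrightarrow> A *v b = l b *\<^sub>R b" "span B = UNIV"
proof -
  obtain B where B: "pairwise orthogonal B" "\<forall>b\<in>B. norm b = 1 \<and> (\<exists>l. A *v b = l *\<^sub>R b)" "span B = UNIV"
    using selfadjoint_eigenbasis[OF matrix_vector_mul_linear symmetric_matrix_inner[OF assms], of UNIV] by auto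
  have "0 \<notin> B" using B(2) by force
  then have "finite B"
    using B(1) pairwise_orthogonal_independent independent_imp_finite by blast
  moreover obtain l where "\<And>b. b \<in> B \<Longrightarrow> A *v b = l b *\<^sub>R b" using B(2) by metis
  ultimately show ?thesis using B that by blast
qed

lemma inner_orthonormal:
  assumes "pairwise orthogonal B" "\<And>b. b \<in> B \<Longrightarrow> norm b = 1" "b \<in> B" "c \<in> B"
  shows "b \<bullet> c = (if b = c then 1 else 0)"
  using assms by (auto simp: pairwise_def orthogonal_def dot_square_norm)

lemma matrix_eq_on_spanning:
  fixes A C :: "real^'n^'n"
  assumes "span B = UNIV" "\<And>b. b \<in> B \<Longrightarrow> A *v b = C *v b"
  shows "A = C"
proof -
  have "A *v x = C *v x" for x
    using linear_eq_on[OF matrix_vector_mul_linear matrix_vector_mul_linear, of x B A C] assms by auto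
  then show ?thesis by (simp add: matrix_eq)
qed

lemma orthonormal_expansion:
  fixes B :: "'a::euclidean_space set"
  assumes B: "finite B" "pairwise orthogonal B" "\<And>b. b \<in> B \<Longrightarrow> norm b = 1" "span B = UNIV"
  shows "(\<Sum>b\<in>B. (b \<bullet> x) *\<^sub>R b) = x"
proof -
  have "(\<lambda>x. \<Sum>b\<in>B. (b \<bullet> x) *\<^sub>R b) x = (\<lambda>x. x) x"
  proof (rule linear_eq_on[where B = B])
    show "linear (\<lambda>x. \<Sum>b\<in>B. (b \<bullet> x) *\<^sub>R b)"
      by (intro linear_compose_sum ballI linearI) (auto simp: inner_simps algebra_simps)
    show "linear (\<lambda>x::'a. x)" by (rule linear_ident)
    show "x \<in> span B" using B by simp
    fix c assume c: "c \<in> B"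
    have "(\<Sum>b\<in>B. (b \<bullet> c) *\<^sub>R b) = (\<Sum>b\<in>B. if b = c then b else 0)"
      using c B by (intro sum.cong) (auto simp: inner_orthonormal[OF B(2,3)])
    also have "\<dots> = c" using c B(1) by simp
    finally show "(\<Sum>b\<in>B. (b \<bullet> c) *\<^sub>R b) = c" .
  qed
  then show ?thesis .
qed

lemma quadratic_form_eigenbasis:
  fixes A :: "real^'n^'n"
  assumes B: "finite B" "pairwise orthogonal B" "\<And>b. b \<in> B \<Longrightarrow> norm b = 1" "span B = UNIV"
    and A: "\<And>b. b \<in> B \<Longrightarrow> A *v b = l b *\<^sub>R b" 
  shows "x \<bullet> (A *v x) = (\<Sum>b\<in>B. l b * (b \<bullet> x)\<^sup>2)"
proof -
  have "A *v x = A *v (\<Sum>b\<in>B. (b \<bullet> x) *\<^sub>R b)"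
    by (simp add: orthonormal_expansion[OF B])
  also have "\<dots> = (\<Sum>b\<in>B. (b \<bullet> x) *\<^sub>R l b *\<^sub>R b)"
    by (simp add: linear_sum[OF matrix_vector_mul_linear] matrix_vector_mult_scaleR A)
  finally show ?thesis
    by (simp add: inner_sum_right power2_eq_square inner_commute algebra_simps)
qed

lemma pos_def_if_eigenvalues_pos:
  fixes A :: "real^'n^'n"
  assumes sym: "transpose A = A"
    and ev: "\<And>v l. A *v v = l *\<^sub>R v \<Longrightarrow> v \<noteq> 0 \<Longrightarrow> 0 < l"
  shows "pos_def A"
proof -
  obtain B l where B: "finite B" "pairwise orthogonal B" "\<And>b. b \<in> B \<Longrightarrow> norm b = 1"
    and l: "\<And>b. b \<in> B \<Longrightarrow> A *v b = l b *\<^sub>R b" and span: "span B = UNIV"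
    using symmetric_matrix_eigenbasis[OF sym] by metis
  have lpos: "0 < l b" if "b \<in> B" for b
    using ev[OF l[OF that]] B(3)[OF that] by force
  have "0 < v \<bullet> (A *v v)" if "v \<noteq> 0" for v
  proof -
    obtain b where b: "b \<in> B" "b \<bullet> v \<noteq> 0"
    proof (rule ccontr)
      assume "\<not> thesis"
      then have "\<forall>b\<in>B. b \<bullet> v = 0" using that by blast
      then show False using orthonormal_expansion[OF B span, of v] \<open>v \<noteq> 0\<close> by simp
    qed
    have "0 < (\<Sum>b\<in>B. l b * (b \<bullet> v)\<^sup>2)"
      using B(1) b lpos by (intro sum_pos2[of B b]) (auto intro!: mult_nonneg_nonneg less_imp_le[OF lpos])
    then show ?thesis using quadratic_form_eigenbasis[OF B span l] by simp
  qed
  then show ?thesis using sym by (simp add: pos_def_def)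
qed

lemma psd_sqrt_exists:
  fixes A :: "real^'n^'n"
  assumes "pos_semidef A"
  shows "\<exists>R. pos_semidef R \<and> R ** R = A"
proof -
  have sym: "transpose A = A" using assms by (simp add: pos_semidef_def)
  obtain B l where B: "finite B" "pairwise orthogonal B" "\<And>b. b \<in> B \<Longrightarrow> norm b = 1"
    and l: "\<And>b. b \<in> B \<Longrightarrow> A *v b = l b *\<^sub>R b" and span: "span B = UNIV"
    using symmetric_matrix_eigenbasis[OF sym] by metis
  have l0: "0 \<le> l b" if "b \<in> B" for b
  proof -
    have "0 \<le> b \<bullet> (A *v b)" using assms by (simp add: pos_semidef_def)
    then show ?thesis using that B by (simp add: l dot_square_norm)
  qed
  define g where "g x = (\<Sum>b\<in>B. (sqrt (l b) * (b \<bullet> x)) *\<^sub>R b)" for x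
  have lin: "linear g"
    unfolding g_def by (intro linear_compose_sum ballI linearI) (auto simp: inner_simps algebra_simps)
  define R where "R = matrix g"
  have Rv: "R *v x = g x" for x unfolding R_def using lin by (simp add: matrix_vector_mul)
  have Rb: "R *v b = sqrt (l b) *\<^sub>R b" if b: "b \<in> B" for b
  proof -
    have "g b = (\<Sum>c\<in>B. if c = b then sqrt (l b) *\<^sub>R b else 0)"
      unfolding g_def using b B by (intro sum.cong) (auto simp: inner_orthonormal[OF B(2,3)])
    then show ?thesis using b B(1) by (simp add: Rv)
  qed
  have "R ** R = A"
    by (rule matrix_eq_on_spanning[OF span])
      (auto simp: matrix_vector_mul_assoc[symmetric] Rb matrix_vector_mult_scaleR l l0)
  moreover have "transpose R = R"
  proof -
    have gs: "x \<bullet> g y = g x \<bullet> y" for x y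
      unfolding g_def by (simp add: inner_sum_right inner_sum_left inner_commute mult_ac)
    have "y \<bullet> (transpose R *v x) = y \<bullet> (R *v x)" for x y
      by (metis gs Rv dot_lmul_matrix inner_commute transpose_matrix_vector)
    then have "transpose R *v x = R *v x" for x
      by (metis vector_eq_ldot)
    then show ?thesis by (simp add: matrix_eq)
  qed
  moreover have "0 \<le> x \<bullet> (R *v x)" for x
    using quadratic_form_eigenbasis[OF B span Rb] l0 by (auto intro!: sum_nonneg)
  ultimately show ?thesis by (auto simp: pos_semidef_def)
qed

lemma psd_sqrt_unique:
  fixes R C :: "real^'n^'n"
  assumes R: "pos_semidef R" and C: "pos_semidef C" and eq: "R ** R = C ** C"
  shows "R = C"
proof -
  have sym: "transpose R = R" "transpose C = C" using R C by (auto simp: pos_semidef_def)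
  obtain B l where B: "finite B" "pairwise orthogonal B" "\<And>b. b \<in> B \<Longrightarrow> norm b = 1"
    and l: "\<And>b. b \<in> B \<Longrightarrow> R *v b = l b *\<^sub>R b" and span: "span B = UNIV"
    using symmetric_matrix_eigenbasis[OF sym(1)] by metis
  have "C *v b = l b *\<^sub>R b" if b: "b \<in> B" for b
  proof -
    have "0 \<le> b \<bullet> (R *v b)" using R by (simp add: pos_semidef_def)
    then have l0: "0 \<le> l b" using b B by (simp add: l dot_square_norm)
    have CC: "C *v (C *v b) = (l b * l b) *\<^sub>R b"
      using b by (metis eq l matrix_vector_mul_assoc matrix_vector_mult_scaleR scaleR_scaleR)
    \<comment> \<open>\<open>b\<close> is killed by \<open>(C + l b) (C - l b)\<close>, and \<open>C + l b\<close> is injective unless \<open>l b = 0\<close>.\<close>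
    show ?thesis
    proof (cases "l b = 0")
      case True
      then have "(C *v b) \<bullet> (C *v b) = 0"
        using CC by (simp flip: symmetric_matrix_inner[OF sym(2)])
      then show ?thesis using True by simp
    next
      case False
      define w where "w = C *v b - l b *\<^sub>R b"
      have "C *v w + l b *\<^sub>R w = 0"
        by (simp add: w_def matrix_vector_mult_diff_distrib matrix_vector_mult_scaleR CC algebra_simps)
      then have "w \<bullet> (C *v w) + l b * (w \<bullet> w) = 0"
        by (metis inner_add_right inner_scaleR_right inner_zero_right)
      moreover have "0 \<le> w \<bullet> (C *v w)" using C by (simp add: pos_semidef_def)
      moreover have "0 \<le> l b * (w \<bullet> w)" using l0 by simp
      ultimately have "l b * (w \<bullet> w) = 0" by linarith
      then have "w = 0" using False by simp
      then show ?thesis by (simp add: w_def)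
    qed
  qed
  then show ?thesis by (intro matrix_eq_on_spanning[OF span]) (simp add: l)
qed

lemma psd_sqrt:
  assumes "pos_semidef A"
  shows "pos_semidef (psd_sqrt A)" "psd_sqrt A ** psd_sqrt A = A"
proof -
  have "\<exists>!R. pos_semidef R \<and> R ** R = A"
    using psd_sqrt_exists[OF assms] psd_sqrt_unique by metis
  from theI'[OF this] show "pos_semidef (psd_sqrt A)" "psd_sqrt A ** psd_sqrt A = A"
    by (auto simp: psd_sqrt_def)
qed

lemma pos_def_imp_pos_semidef: "pos_def A \<Longrightarrow> pos_semidef A"
  unfolding pos_def_def pos_semidef_def by (metis inner_zero_left less_eq_real_def)

lemma pos_def_invertible:
  assumes "pos_def A" shows "invertible A"
proof -
  have "A *v x = 0 \<Longrightarrow> x = 0" for x using assms unfolding pos_def_def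
    by (metis inner_zero_right less_irrefl)
  then show ?thesis using invertible_left_inverse matrix_left_invertible_ker by blast
qed

lemma matrix_inv_mult:
  fixes A :: "real^'n^'n"
  assumes "invertible A"
  shows "A ** matrix_inv A = mat 1" "matrix_inv A ** A = mat 1"
proof -
  have "A ** matrix_inv A = mat 1 \<and> matrix_inv A ** A = mat 1"
    using assms unfolding matrix_inv_def invertible_def by (rule someI_ex)
  then show "A ** matrix_inv A = mat 1" "matrix_inv A ** A = mat 1" by auto
qed

lemma matrix_inv_mult_vector:
  fixes A :: "real^'n^'n"
  assumes "invertible A"
  shows "A *v (matrix_inv A *v x) = x" "matrix_inv A *v (A *v x) = x"
  using assms by (simp_all add: matrix_vector_mul_assoc matrix_inv_mult)

lemma pos_def_matrix_inv:
  assumes "pos_def A" shows "pos_def (matrix_inv A)"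
proof -
  have inv: "invertible A" using assms by (rule pos_def_invertible)
  have "transpose (matrix_inv A) = matrix_inv A"
  proof -
    have "transpose (matrix_inv A) ** A = mat 1"
      using assms by (metis inv matrix_inv_mult(1) matrix_transpose_mul pos_def_def transpose_mat)
    then have "transpose (matrix_inv A) ** (A ** matrix_inv A) = matrix_inv A"
      by (simp add: matrix_mul_assoc)
    then show ?thesis using inv by (simp add: matrix_inv_mult)
  qed
  moreover have "0 < v \<bullet> (matrix_inv A *v v)" if "v \<noteq> 0" for v
  proof -
    define w where "w = matrix_inv A *v v"
    have "v = A *v w" unfolding w_def by (simp add: matrix_inv_mult_vector inv)
    moreover have "w \<noteq> 0" using that calculation by auto
    ultimately show ?thesis using assms unfolding pos_def_def w_def[symmetric]
      by (simp add: inner_commute)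
  qed
  ultimately show ?thesis by (simp add: pos_def_def)
qed

lemma transpose_diff: "transpose (A - B) = transpose A - transpose (B :: real^'n^'m)"
  by (simp add: transpose_def vec_eq_iff)

lemma transpose_inner:
  fixes A :: "real^'n^'m"
  shows "(A *v x) \<bullet> y = x \<bullet> (transpose A *v y)"
  by (metis dot_lmul_matrix inner_commute transpose_matrix_vector)

lemma pos_def_mult_transpose:
  fixes C :: "real^'n^'n"
  assumes "invertible C" shows "pos_def (C ** transpose C)"
proof -
  have "invertible (transpose C)" using assms by (rule transpose_invertible)
  then have "transpose C *v v \<noteq> 0" if "v \<noteq> 0" for v
    using that by (metis matrix_inv_mult_vector(2) matrix_vector_mult_0_right)
  moreover have "v \<bullet> ((C ** transpose C) *v v) = (transpose C *v v) \<bullet> (transpose C *v v)" for v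
    by (metis matrix_vector_mul_assoc transpose_inner inner_commute)
  ultimately show ?thesis by (simp add: pos_def_def matrix_transpose_mul)
qed

lemma pos_def_factor:
  fixes S :: "real^'n^'n"
  assumes "pos_def S"
  obtains C :: "real^'n^'n" where "invertible C" "S = C ** transpose C"
proof -
  note r = psd_sqrt[OF pos_def_imp_pos_semidef[OF assms]]
  have "det (psd_sqrt S) \<noteq> 0"
    using pos_def_invertible[OF assms] r(2) by (metis det_mul invertible_det_nz mult_zero_left)
  then show ?thesis using that[of "psd_sqrt S"] r by (simp add: invertible_det_nz pos_semidef_def)
qed

lemma pos_def_det_pos: "pos_def S \<Longrightarrow> 0 < det S"
  by (metis pos_def_factor det_mul det_transpose invertible_det_nz not_real_square_gt_zero)

lemma pos_semidef_invertible_imp_pos_def: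
  fixes S :: "real^'n^'n"
  assumes "pos_semidef S" "invertible S" shows "pos_def S"
proof -
  note r = psd_sqrt[OF assms(1)]
  have "det (psd_sqrt S) \<noteq> 0"
    using assms(2) r(2) by (metis det_mul invertible_det_nz mult_zero_left)
  then show ?thesis
    using pos_def_mult_transpose[of "psd_sqrt S"] r by (simp add: invertible_det_nz pos_semidef_def)
qed

lemma pos_def_scaleR:
  assumes "pos_def A" "0 < c" shows "pos_def (c *\<^sub>R A)"
proof -
  have "transpose (c *\<^sub>R A) = c *\<^sub>R transpose A" by (simp add: transpose_def vec_eq_iff)
  then show ?thesis using assms by (auto simp: pos_def_def simp flip: scaleR_matrix_vector_assoc)
qed

lemma pos_def_mat_1: "pos_def (mat 1)"
  by (simp add: pos_def_def transpose_mat)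

section \<open>Block vectors and block matrices\<close>

lemma vsplit_vjoin [simp]: "vsplit (vjoin x y) = (x, y)"
  by (simp add: vsplit_def vjoin_def)

lemma vjoin_vsplit [simp]: "vjoin (fst (vsplit z)) (snd (vsplit z)) = z"
  by (simp add: vsplit_def vjoin_def vec_eq_iff split: sum.split)

lemma vjoin_cases: obtains x y where "z = vjoin x y"
  by (metis vjoin_vsplit)

lemma vjoin_inject [simp]: "vjoin x y = vjoin x' y' \<longleftrightarrow> x = x' \<and> y = y'"
  by (metis vsplit_vjoin prod.inject)

lemma vjoin_add: "vjoin x y + vjoin x' y' = vjoin (x + x') (y + y')"
  and vjoin_diff: "vjoin x y - vjoin x' y' = vjoin (x - x') (y - y')"
  and vjoin_scaleR: "c *\<^sub>R vjoin x y = vjoin (c *\<^sub>R x) (c *\<^sub>R y)"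
  and vjoin_0: "vjoin 0 0 = 0"
  by (simp_all add: vjoin_def vec_eq_iff split: sum.split)

lemma inner_vjoin: "vjoin x y \<bullet> vjoin x' y' = x \<bullet> x' + y \<bullet> y'"
  by (simp add: inner_vec_def vjoin_def UNIV_Plus_UNIV[symmetric] sum.Plus del: UNIV_Plus_UNIV)

lemma block2_mult_vjoin:
  "block2 A B C D *v vjoin x y = vjoin (A *v x + B *v y) (C *v x + D *v y)"
  by (simp add: vec_eq_iff matrix_vector_mult_def block2_def vjoin_def UNIV_Plus_UNIV[symmetric] sum.Plus
      del: UNIV_Plus_UNIV split: sum.split)

lemma transpose_block2:
  "transpose (block2 A B C D) = block2 (transpose A) (transpose C) (transpose B) (transpose D)"
  by (simp add: vec_eq_iff transpose_def block2_def vjoin_def split: sum.split)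

lemma block2_inject:
  "block2 A B C D = block2 A' B' C' D' \<longleftrightarrow> A = A' \<and> B = B' \<and> C = C' \<and> D = D'"
proof -
  have "A = A' \<and> B = B' \<and> C = C' \<and> D = D'" if eq: "block2 A B C D = block2 A' B' C' D'"
  proof -
    have "block2 A B C D *v vjoin x y = block2 A' B' C' D' *v vjoin x y" for x y
      by (simp add: eq)
    then have "A *v x + B *v y = A' *v x + B' *v y" "C *v x + D *v y = C' *v x + D' *v y" for x y
      by (simp_all add: block2_mult_vjoin)
    from this[of _ 0] this[of 0] show ?thesis by (simp add: matrix_eq)
  qed
  then show ?thesis by auto
qed

lemma matrix_eq_block2I:
  assumes "\<And>x y. X *v vjoin x y = vjoin (A *v x + B *v y) (C *v x + D *v y)"
  shows "X = block2 A B C D"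
  unfolding matrix_eq
proof
  fix z show "X *v z = block2 A B C D *v z"
    by (rule vjoin_cases[of z]) (simp add: assms block2_mult_vjoin)
qed

lemma block2_mult:
  "block2 A B C D ** block2 A' B' C' D' =
     block2 (A ** A' + B ** C') (A ** B' + B ** D') (C ** A' + D ** C') (C ** B' + D ** D')"
  by (rule matrix_eq_block2I)
    (simp add: matrix_vector_mul_assoc[symmetric] block2_mult_vjoin matrix_vector_right_distrib
      matrix_vector_mult_add_rdistrib)

lemma pos_def_block2D:
  assumes "pos_def (block2 A B C D)"
  shows "C = transpose B" "pos_def A" "pos_def D"
proof -
  have tr: "transpose A = A" "transpose D = D" "transpose C = B" "transpose B = C"
    using assms by (auto simp: pos_def_def transpose_block2 block2_inject)
  have pos: "0 < vjoin x y \<bullet> (block2 A B C D *v vjoin x y)" if "x \<noteq> 0 \<or> y \<noteq> 0" for x y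
    using assms that by (metis pos_def_def vjoin_0 vjoin_inject)
  show "C = transpose B" using tr by simp
  show "pos_def A" using tr pos[of _ 0] by (simp add: pos_def_def block2_mult_vjoin inner_vjoin)
  show "pos_def D" using tr pos[of 0] by (simp add: pos_def_def block2_mult_vjoin inner_vjoin)
qed

lemma pos_def_schur_complement_snd:
  fixes A :: "real^'a^'a" and B :: "real^'b^'a" and D :: "real^'b^'b"
  assumes pd: "pos_def (block2 A B (transpose B) D)"
  shows "pos_def (D - transpose B ** matrix_inv A ** B)"
proof -
  note ad = pos_def_block2D[OF pd]
  have inv: "invertible A" and Ai: "transpose (matrix_inv A) = matrix_inv A"
    using pos_def_invertible pos_def_matrix_inv ad by (auto simp: pos_def_def)
  have D: "transpose D = D" using ad by (simp add: pos_def_def)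
  show ?thesis unfolding pos_def_def
  proof (intro conjI allI impI)
    show "transpose (D - transpose B ** matrix_inv A ** B) = D - transpose B ** matrix_inv A ** B"
      by (simp add: transpose_diff matrix_transpose_mul Ai D matrix_mul_assoc)
    fix v :: "real^'b" assume v: "v \<noteq> 0"
    define x where "x = - (matrix_inv A *v (B *v v))"
    have "block2 A B (transpose B) D *v vjoin x v =
        vjoin 0 ((D - transpose B ** matrix_inv A ** B) *v v)"
      by (simp add: block2_mult_vjoin x_def linear_neg[OF matrix_vector_mul_linear] matrix_inv_mult_vector[OF inv]
          matrix_vector_mult_diff_rdistrib matrix_vector_mul_assoc[symmetric])
    moreover have "0 < vjoin x v \<bullet> (block2 A B (transpose B) D *v vjoin x v)"
      using pd v by (metis pos_def_def vjoin_0 vjoin_inject)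
    ultimately show "0 < v \<bullet> ((D - transpose B ** matrix_inv A ** B) *v v)"
      by (simp add: inner_vjoin)
  qed
qed

lemma pos_def_schur_complement_fst:
  fixes A :: "real^'a^'a" and B :: "real^'b^'a" and D :: "real^'b^'b"
  assumes pd: "pos_def (block2 A B (transpose B) D)"
  shows "pos_def (A - B ** matrix_inv D ** transpose B)"
proof -
  have swap: "vjoin y x \<bullet> (block2 D (transpose B) B A *v vjoin y x) =
      vjoin x y \<bullet> (block2 A B (transpose B) D *v vjoin x y)" for x y
    by (simp add: block2_mult_vjoin inner_vjoin inner_add_right add_ac)
  have "pos_def (block2 D (transpose B) (transpose (transpose B)) A)"
    unfolding pos_def_def
  proof (intro conjI allI impI)
    show "transpose (block2 D (transpose B) (transpose (transpose B)) A) =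
        block2 D (transpose B) (transpose (transpose B)) A"
      using pos_def_block2D[OF pd] by (simp add: transpose_block2 pos_def_def)
    fix z :: "real^('b + 'a)" assume z: "z \<noteq> 0"
    obtain y x where yx: "z = vjoin y x" by (rule vjoin_cases)
    with z have "vjoin x y \<noteq> 0" by (metis vjoin_0 vjoin_inject)
    then show "0 < z \<bullet> (block2 D (transpose B) (transpose (transpose B)) A *v z)"
      using pd by (simp add: yx swap pos_def_def)
  qed
  from pos_def_schur_complement_snd[OF this] show ?thesis by simp
qed

text \<open>Block triangular factors of the covariance of a pair in which the second vector is \<open>M\<close> times
  the first one plus independent noise, where \<open>P P\<^sup>T\<close> is the covariance of the first vector and
  \<open>Q Q\<^sup>T\<close> that of the noise; the second lemma has the roles of the two vectors exchanged.\<close>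

lemma block2_lower_factor:
  fixes M :: "real^'a^'b" and P :: "real^'a^'a" and Q :: "real^'b^'b"
  assumes "invertible P" "invertible Q"
  shows "invertible (block2 P 0 (M ** P) Q)"
    and "block2 P 0 (M ** P) Q ** transpose (block2 P 0 (M ** P) Q) =
      block2 (P ** transpose P) (P ** transpose P ** transpose M) (M ** (P ** transpose P))
        (M ** (P ** transpose P) ** transpose M + Q ** transpose Q)"
proof -
  have "z = 0" if "block2 P 0 (M ** P) Q *v z = 0" for z
  proof -
    obtain x y where z: "z = vjoin x y" by (rule vjoin_cases)
    have *: "P *v x = 0" "(M ** P) *v x + Q *v y = 0"
      using that unfolding z block2_mult_vjoin vjoin_0[symmetric] by auto
    then have "x = 0" by (metis assms(1) matrix_inv_mult_vector(2) matrix_vector_mult_0_right)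
    with * have "Q *v y = 0" by simp
    then have "y = 0" by (metis assms(2) matrix_inv_mult_vector(2) matrix_vector_mult_0_right)
    with \<open>x = 0\<close> show ?thesis by (simp add: z vjoin_0)
  qed
  then show "invertible (block2 P 0 (M ** P) Q)"
    by (simp add: invertible_left_inverse matrix_left_invertible_ker)
  have t0: "transpose (0::real^'b^'a) = 0" by (simp add: transpose_def vec_eq_iff)
  show "block2 P 0 (M ** P) Q ** transpose (block2 P 0 (M ** P) Q) =
      block2 (P ** transpose P) (P ** transpose P ** transpose M) (M ** (P ** transpose P))
        (M ** (P ** transpose P) ** transpose M + Q ** transpose Q)"
    by (simp add: transpose_block2 block2_mult matrix_transpose_mul matrix_mul_assoc t0)
qed

lemma block2_upper_factor:
  fixes M :: "real^'b^'a" and P :: "real^'b^'b" and Q :: "real^'a^'a"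
  assumes "invertible P" "invertible Q"
  shows "invertible (block2 Q (M ** P) 0 P)"
    and "block2 Q (M ** P) 0 P ** transpose (block2 Q (M ** P) 0 P) =
      block2 (M ** (P ** transpose P) ** transpose M + Q ** transpose Q) (M ** (P ** transpose P))
        (P ** transpose P ** transpose M) (P ** transpose P)"
proof -
  have "z = 0" if "block2 Q (M ** P) 0 P *v z = 0" for z
  proof -
    obtain x y where z: "z = vjoin x y" by (rule vjoin_cases)
    have *: "P *v y = 0" "Q *v x + (M ** P) *v y = 0"
      using that unfolding z block2_mult_vjoin vjoin_0[symmetric] by auto
    then have "y = 0" by (metis assms(1) matrix_inv_mult_vector(2) matrix_vector_mult_0_right)
    with * have "Q *v x = 0" by simp
    then have "x = 0" by (metis assms(2) matrix_inv_mult_vector(2) matrix_vector_mult_0_right)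
    with \<open>y = 0\<close> show ?thesis by (simp add: z vjoin_0)
  qed
  then show "invertible (block2 Q (M ** P) 0 P)"
    by (simp add: invertible_left_inverse matrix_left_invertible_ker)
  have t0: "transpose (0::real^'a^'b) = 0" by (simp add: transpose_def vec_eq_iff)
  show "block2 Q (M ** P) 0 P ** transpose (block2 Q (M ** P) 0 P) =
      block2 (M ** (P ** transpose P) ** transpose M + Q ** transpose Q) (M ** (P ** transpose P))
        (P ** transpose P ** transpose M) (P ** transpose P)"
    by (simp add: transpose_block2 block2_mult matrix_transpose_mul matrix_mul_assoc t0 add.commute)
qed

lemma pos_def_block2I:
  fixes A :: "real^'a^'a" and K :: "real^'b^'b"
  assumes "pos_def A" "pos_def K"
  shows "pos_def (block2 A (A ** transpose M) (M ** A) (M ** A ** transpose M + K))"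
proof -
  obtain P :: "real^'a^'a" where "invertible P" "A = P ** transpose P" by (rule pos_def_factor[OF assms(1)])
  moreover obtain Q :: "real^'b^'b" where "invertible Q" "K = Q ** transpose Q" by (rule pos_def_factor[OF assms(2)])
  ultimately show ?thesis
    using pos_def_mult_transpose[OF block2_lower_factor(1)[of P Q M]]
    unfolding block2_lower_factor(2)[OF \<open>invertible P\<close> \<open>invertible Q\<close>] by simp
qed

text \<open>The block matrix with a single row of blocks, \<open>A\<close> to the left of \<open>B\<close>.\<close>

definition beside :: "real^'c^'a \<Rightarrow> real^'d^'a \<Rightarrow> real^('c + 'd)^'a" where
  "beside A B = (\<chi> i. vjoin (A $ i) (B $ i))"

lemma beside_mult_vjoin: "beside A B *v vjoin x y = A *v x + B *v y"
  by (simp add: vec_eq_iff matrix_vector_mult_def beside_def vjoin_def UNIV_Plus_UNIV[symmetric] sum.Plus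
      del: UNIV_Plus_UNIV)

lemma transpose_beside_mult: "transpose (beside A B) *v x = vjoin (transpose A *v x) (transpose B *v x)"
  unfolding matrix_vector_mult_def transpose_def
  by (simp add: vec_eq_iff beside_def vjoin_def split: sum.split)

lemma block3_eq_block2:
  assumes "A21 = transpose A12" "A31 = transpose A13"
  shows "block3 A11 A12 A13 A21 A22 A23 A31 A32 A33 =
    block2 A11 (beside A12 A13) (transpose (beside A12 A13)) (block2 A22 A23 A32 A33)"
  unfolding assms
  by (simp add: vec_eq_iff block3_def block2_def beside_def vjoin_def transpose_def split: sum.split)

section \<open>The quadratic matrix equation\<close>

text \<open>The equation is the square of \<open>L + \<epsilon>/2 = (S + \<epsilon>\<^sup>2/4)\<^bsup>1/2\<^esup>\<close>. An eigenvalue \<open>l\<close> of \<open>L\<close> satisfies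
  \<open>l \<ge> -\<epsilon>/2\<close>, because the root is positive semidefinite, and \<open>l (l + \<epsilon>) > 0\<close>, because \<open>S\<close> is positive
  definite; hence \<open>l > 0\<close>.\<close>

lemma shifted_psd_sqrt_quadratic:
  fixes S :: "real^'n^'n"
  assumes S: "pos_def S" and e: "0 < \<epsilon>"
  defines "L \<equiv> psd_sqrt (S + (\<epsilon>\<^sup>2 / 4) *\<^sub>R mat 1) - (\<epsilon> / 2) *\<^sub>R mat 1"
  shows "pos_def L" "L ** L + \<epsilon> *\<^sub>R L = S"
proof -
  define M where "M = S + (\<epsilon>\<^sup>2 / 4) *\<^sub>R mat 1"
  define R where "R = psd_sqrt M"
  have Mv: "M *v v = S *v v + (\<epsilon>\<^sup>2 / 4) *\<^sub>R v" for v
    by (simp add: M_def matrix_vector_mult_add_rdistrib scaleR_matrix_vector_assoc[symmetric])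
  have tr_mat: "transpose (c *\<^sub>R mat 1 :: real^'n^'n) = c *\<^sub>R mat 1" for c
    by (auto simp: transpose_def mat_def vec_eq_iff)
  have "transpose M = M"
    using S tr_mat[of "\<epsilon>\<^sup>2/4"] by (simp add: M_def pos_def_def transpose_def vec_eq_iff)
  moreover have "0 \<le> v \<bullet> (M *v v)" for v
    using pos_def_imp_pos_semidef[OF S] by (simp add: Mv inner_add_right pos_semidef_def)
  ultimately have "pos_semidef M" by (simp add: pos_semidef_def)
  from psd_sqrt[OF this] have R: "pos_semidef R" "R ** R = M" by (simp_all add: R_def)
  have Lv: "L *v v = R *v v - (\<epsilon> / 2) *\<^sub>R v" for v
    by (simp add: L_def R_def M_def matrix_vector_mult_diff_rdistrib scaleR_matrix_vector_assoc[symmetric])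
  have RRv: "R *v (R *v v) = S *v v + (\<epsilon>\<^sup>2 / 4) *\<^sub>R v" for v
    by (simp add: matrix_vector_mul_assoc R(2) Mv)
  have "(L ** L + \<epsilon> *\<^sub>R L) *v v = S *v v" for v
  proof -
    have "(L ** L + \<epsilon> *\<^sub>R L) *v v = L *v (L *v v) + \<epsilon> *\<^sub>R (L *v v)"
      by (simp add: matrix_vector_mult_add_rdistrib scaleR_matrix_vector_assoc[symmetric] matrix_vector_mul_assoc)
    also have "\<dots> = R *v (R *v v) - (\<epsilon>\<^sup>2 / 4) *\<^sub>R v"
      by (simp add: Lv matrix_vector_mult_diff_distrib matrix_vector_mult_scaleR vec_eq_iff field_simps
          power2_eq_square)
    finally show ?thesis by (simp add: RRv)
  qed
  then show LL: "L ** L + \<epsilon> *\<^sub>R L = S" by (simp add: matrix_eq)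
  show "pos_def L"
  proof (rule pos_def_if_eigenvalues_pos)
    show "transpose L = L"
      using R(1) tr_mat[of "\<epsilon>/2"] unfolding L_def R_def[unfolded M_def, symmetric]
      by (simp add: transpose_diff pos_semidef_def)
    fix v l assume v: "L *v v = l *\<^sub>R v" "v \<noteq> 0"
    have vv: "0 < v \<bullet> v" using v by simp
    have "S *v v = L *v (L *v v) + \<epsilon> *\<^sub>R (L *v v)"
      by (simp add: LL[symmetric] matrix_vector_mult_add_rdistrib scaleR_matrix_vector_assoc[symmetric] matrix_vector_mul_assoc)
    then have "v \<bullet> (S *v v) = (l * (l + \<epsilon>)) * (v \<bullet> v)"
      by (simp add: v matrix_vector_mult_scaleR inner_add_right algebra_simps)
    moreover have "0 < v \<bullet> (S *v v)" using S v by (simp add: pos_def_def)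
    ultimately have pos: "0 < l * (l + \<epsilon>)" using vv by (simp add: zero_less_mult_iff)
    have "R *v v = (l + \<epsilon> / 2) *\<^sub>R v" using v(1) Lv[of v] by (simp add: algebra_simps)
    moreover have "0 \<le> v \<bullet> (R *v v)" using R(1) by (simp add: pos_semidef_def)
    ultimately have "0 \<le> (l + \<epsilon> / 2) * (v \<bullet> v)" by simp
    then have "0 \<le> l + \<epsilon> / 2" using vv by (simp add: zero_le_mult_iff)
    with pos e show "0 < l" by (auto simp: zero_less_mult_iff)
  qed
qed

section \<open>Linear change of variables for Lebesgue measure\<close>

lemma prod_Basis_cart: "(\<Prod>b\<in>(Basis :: (real^'n) set). g b) = (\<Prod>i\<in>UNIV. g (axis i 1))"
proof -
  have "Basis = range (\<lambda>i. axis i 1 :: real^'n)" by (auto simp: Basis_vec_def)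
  moreover have "inj (\<lambda>i. axis i 1 :: real^'n)" by (auto simp: inj_on_def axis_eq_axis)
  ultimately show ?thesis by (metis (no_types, lifting) prod.reindex_cong)
qed

lemma borel_measurable_linear:
  fixes f :: "'a::euclidean_space \<Rightarrow> 'b::euclidean_space"
  assumes "linear f" shows "f \<in> borel_measurable borel"
  using assms by (intro borel_measurable_continuous_onI linear_continuous_on) (simp add: linear_conv_bounded_linear)

text \<open>A shear translates each line parallel to the axis \<open>m\<close> within itself, so Fubini's theorem reduces
  its invariance to translation invariance on the line.\<close>

lemma emeasure_lborel_shear:
  fixes A :: "(real^'n) set"
  assumes mn: "m \<noteq> n" and A[measurable]: "A \<in> sets borel"
  shows "emeasure lborel ((\<lambda>x. \<chi> i. if i = m then x$m + x$n else x$i) -` A) = emeasure lborel A"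
proof -
  interpret product_sigma_finite "\<lambda>_::real^'n. lborel :: real measure" ..
  let ?f = "\<lambda>x::real^'n. \<chi> i. if i = m then x$m + x$n else x$i"
  define E :: "(real^'n \<Rightarrow> real) \<Rightarrow> real^'n" where "E = (\<lambda>\<phi>. \<Sum>b\<in>Basis. \<phi> b *\<^sub>R b)"
  define I where "I = Basis - {axis m 1 :: real^'n}"
  have Bm: "Basis = insert (axis m 1) I" and I: "finite I" "axis m 1 \<notin> I"
    by (auto simp: I_def)
  have E_meas[measurable]: "E \<in> (\<Pi>\<^sub>M b\<in>insert (axis m 1) I. lborel) \<rightarrow>\<^sub>M borel"
    unfolding E_def Bm[symmetric] by measurable
  have lb: "lborel = distr (\<Pi>\<^sub>M b\<in>insert (axis m 1) I. lborel) borel E"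
    unfolding E_def Bm[symmetric] by (rule lborel_eq)
  have E_nth: "E \<phi> $ i = \<phi> (axis i 1)" for \<phi> i
  proof -
    have "E \<phi> $ i = E \<phi> \<bullet> axis i 1" by (simp add: inner_axis)
    also have "\<dots> = \<phi> (axis i 1)" unfolding E_def by (simp add: inner_sum_left_Basis)
    finally show ?thesis .
  qed
  have fE: "?f (E (\<phi>(axis m 1 := y))) = E (\<phi>(axis m 1 := \<phi> (axis n 1) + y))" for \<phi> y
    by (rule vec_eq_iff[THEN iffD2, rule_format]) (use mn in \<open>simp add: E_nth axis_eq_axis\<close>)
  have "continuous_on UNIV (\<lambda>x::real^'n. if i = m then x$m + x$n else x$i)" for i
    by (cases "i = m") (auto intro!: continuous_intros)
  then have f_meas[measurable]: "?f \<in> borel_measurable borel"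
    by (intro borel_measurable_continuous_onI continuous_on_vec_lambda) auto
  have fA[measurable]: "?f -` A \<in> sets borel"
    using measurable_sets[OF f_meas A] by simp
  have int: "emeasure lborel X = (\<integral>\<^sup>+\<phi>. \<integral>\<^sup>+y. indicator X (E (\<phi>(axis m 1 := y))) \<partial>lborel
      \<partial>(\<Pi>\<^sub>M b\<in>I. lborel))" if [measurable]: "X \<in> sets borel" for X
  proof -
    have "emeasure lborel X = (\<integral>\<^sup>+x. indicator X x \<partial>lborel)" by simp
    also have "\<dots> = (\<integral>\<^sup>+\<phi>. indicator X (E \<phi>) \<partial>(\<Pi>\<^sub>M b\<in>insert (axis m 1) I. lborel))"
      by (subst lb, subst nn_integral_distr) auto
    also have "\<dots> = (\<integral>\<^sup>+\<phi>. \<integral>\<^sup>+y. indicator X (E (\<phi>(axis m 1 := y))) \<partial>lborel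
      \<partial>(\<Pi>\<^sub>M b\<in>I. lborel))"
      by (rule product_nn_integral_insert[OF I]) measurable
    finally show ?thesis .
  qed
  have inner: "(\<integral>\<^sup>+y. indicator (?f -` A) (E (\<phi>(axis m 1 := y))) \<partial>lborel) =
      (\<integral>\<^sup>+y. indicator A (E (\<phi>(axis m 1 := y))) \<partial>lborel)" for \<phi>
  proof -
    have [measurable]: "(\<lambda>y. E (\<phi>(axis m 1 := y))) \<in> borel_measurable borel"
    proof (intro borel_measurable_continuous_onI)
      have "E (\<phi>(axis m 1 := y)) = (\<chi> i. if i = m then y else \<phi> (axis i 1))" for y
        by (rule vec_eq_iff[THEN iffD2, rule_format]) (simp add: E_nth axis_eq_axis)
      moreover have "continuous_on UNIV (\<lambda>y. if i = m then y else \<phi> (axis i 1))" for i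
        by (cases "i = m") auto
      ultimately show "continuous_on UNIV (\<lambda>y. E (\<phi>(axis m 1 := y)))"
        by (auto intro!: continuous_on_vec_lambda)
    qed
    have "(\<integral>\<^sup>+y. indicator A (E (\<phi>(axis m 1 := y))) \<partial>lborel) =
       (\<integral>\<^sup>+y. indicator A (E (\<phi>(axis m 1 := \<phi> (axis n 1) + y))) \<partial>lborel)"
      using nn_integral_real_affine[of "\<lambda>y. indicator A (E (\<phi>(axis m 1 := y)))" 1 "\<phi> (axis n 1)"]
      by simp
    also have "\<dots> = (\<integral>\<^sup>+y. indicator (?f -` A) (E (\<phi>(axis m 1 := y))) \<partial>lborel)"
      by (intro nn_integral_cong) (simp add: indicator_def fE[symmetric])
    finally show ?thesis ..
  qed
  show ?thesis
    by (simp add: int inner)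
qed

lemma emeasure_lborel_permute:
  fixes A :: "(real^'n) set"
  assumes p: "p permutes UNIV" and A[measurable]: "A \<in> sets borel"
  shows "emeasure lborel ((\<lambda>x. \<chi> i. x $ p i) -` A) = emeasure lborel A"
proof -
  let ?f = "\<lambda>x::real^'n. \<chi> i. x $ p i"
  have [measurable]: "?f \<in> borel_measurable borel"
    by (intro borel_measurable_continuous_onI continuous_on_vec_lambda) (auto intro!: continuous_intros)
  have "lborel = distr lborel borel ?f"
  proof (rule lborel_eqI)
    fix l u :: "real^'n" assume le: "\<And>b. b \<in> Basis \<Longrightarrow> l \<bullet> b \<le> u \<bullet> b"
    let ?g = "\<lambda>x::real^'n. \<chi> i. x $ inv p i"
    have le': "l $ i \<le> u $ i" for i
      using le[of "axis i 1"] by (simp add: inner_axis)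
    have "?f -` box l u = box (?g l) (?g u)"
      using permutes_inverses[OF p] by (auto simp: mem_box_cart) (metis+)
    then have "emeasure (distr lborel borel ?f) (box l u) = emeasure lborel (box (?g l) (?g u))"
      by (simp add: emeasure_distr)
    also have "\<dots> = ennreal (\<Prod>b\<in>Basis. (?g u - ?g l) \<bullet> b)"
      by (rule emeasure_lborel_box) (use le' in \<open>auto simp: Basis_vec_def inner_axis\<close>)
    also have "(\<Prod>b\<in>Basis. (?g u - ?g l) \<bullet> b) = (\<Prod>i\<in>UNIV. u $ inv p i - l $ inv p i)"
      by (simp add: prod_Basis_cart inner_axis)
    also have "\<dots> = (\<Prod>i\<in>UNIV. u $ i - l $ i)"
      using prod.permute[OF permutes_inv[OF p], of "\<lambda>i. u $ i - l $ i"] by (simp add: comp_def)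
    also have "\<dots> = (\<Prod>b\<in>Basis. (u - l) \<bullet> b)"
      by (simp add: prod_Basis_cart inner_axis)
    finally show "emeasure (distr lborel borel ?f) (box l u) = ennreal (\<Prod>b\<in>Basis. (u - l) \<bullet> b)" .
  qed simp
  then have "emeasure lborel A = emeasure (distr lborel borel ?f) A" by simp
  then show ?thesis by (simp add: emeasure_distr)
qed

lemma emeasure_lborel_stretch:
  fixes A :: "(real^'n) set"
  assumes c: "\<And>i. c i \<noteq> 0" and A[measurable]: "A \<in> sets borel"
  shows "emeasure lborel A = ennreal \<bar>\<Prod>i\<in>UNIV. c i\<bar> * emeasure lborel ((\<lambda>x. \<chi> i. c i * x $ i) -` A)"
proof -
  let ?f = "\<lambda>x::real^'n. \<chi> i. c i * x $ i"
  let ?c = "\<lambda>b. (\<chi> i. c i) \<bullet> b"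
  have f: "0 + (\<Sum>j\<in>Basis. (?c j * (x \<bullet> j)) *\<^sub>R j) = ?f x" for x
    by (rule euclidean_eqI) (simp add: inner_sum_left_Basis, auto simp: Basis_vec_def inner_axis)
  have f_meas[measurable]: "?f \<in> borel_measurable borel"
    by (intro borel_measurable_continuous_onI continuous_on_vec_lambda) (auto intro!: continuous_intros)
  have "lborel = density (distr lborel borel ?f) (\<lambda>_. \<Prod>j\<in>Basis. \<bar>?c j\<bar>)"
  proof -
    have "?c j \<noteq> 0" if "j \<in> Basis" for j
      using that c by (auto simp: Basis_vec_def inner_axis)
    from lborel_affine_euclidean[of ?c "0::real^'n", OF this] show ?thesis unfolding f .
  qed
  then have "emeasure lborel A = emeasure (density (distr lborel borel ?f) (\<lambda>_. \<Prod>j\<in>Basis. \<bar>?c j\<bar>)) A"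
    by simp
  also have "\<dots> = (\<Prod>j\<in>Basis. \<bar>?c j\<bar>) * emeasure lborel (?f -` A)"
    by (simp add: emeasure_density nn_integral_cmult emeasure_distr)
  finally show ?thesis by (simp add: prod_Basis_cart inner_axis abs_prod)
qed

text \<open>The formula is multiplicative under composition, so it suffices to check it for shears,
  transpositions of coordinates and coordinatewise scalings. The index type carries no order.\<close>

lemma emeasure_lborel_linear_vimage:
  fixes f :: "real^'n \<Rightarrow> real^'n"
  assumes lin: "linear f" and det: "det (matrix f) \<noteq> 0" and A: "A \<in> sets borel"
  shows "emeasure lborel A = ennreal \<bar>det (matrix f)\<bar> * emeasure lborel (f -` A)"
proof -
  define P :: "(real^'n \<Rightarrow> real^'n) \<Rightarrow> bool" where "P = (\<lambda>f. det (matrix f) \<noteq> 0 \<longrightarrow>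
      (\<forall>A\<in>sets borel. emeasure lborel A = ennreal \<bar>det (matrix f)\<bar> * emeasure lborel (f -` A)))"
  have "P f"
  proof (rule induct_linear_elementary[OF lin])
    fix f g :: "real^'n \<Rightarrow> real^'n"
    assume fg: "linear f" "linear g" "P f" "P g"
    have d: "det (matrix (f \<circ> g)) = det (matrix f) * det (matrix g)"
      using fg by (simp add: matrix_compose det_mul)
    show "P (f \<circ> g)"
      unfolding P_def
    proof (intro impI ballI)
      fix A :: "(real^'n) set" assume A: "A \<in> sets borel" and nz: "det (matrix (f \<circ> g)) \<noteq> 0"
      have "f -` A \<in> sets borel"
        using measurable_sets[OF borel_measurable_linear[OF fg(1)] A] by simp
      then show "emeasure lborel A = ennreal \<bar>det (matrix (f \<circ> g))\<bar> * emeasure lborel ((f \<circ> g) -` A)"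
        using fg(3,4) A nz unfolding P_def d
        by (simp add: vimage_comp[symmetric] abs_mult ennreal_mult mult.assoc)
    qed
  next
    fix f :: "real^'n \<Rightarrow> real^'n" and i
    assume f: "linear f" "\<And>x. f x $ i = 0"
    have "det (matrix f) = 0"
      using f by (intro det_zero_row(2)[of i]) (simp add: row_def matrix_def vec_eq_iff)
    then show "P f" by (simp add: P_def)
  next
    fix c :: "'n \<Rightarrow> real"
    have d: "det (matrix (\<lambda>x::real^'n. \<chi> i. c i * x $ i)) = (\<Prod>i\<in>UNIV. c i)"
      by (subst det_diagonal) (auto simp: matrix_def axis_def)
    show "P (\<lambda>x. \<chi> i. c i * x $ i)"
      unfolding P_def d by (auto intro!: emeasure_lborel_stretch)
  next
    fix m n :: 'n assume "m \<noteq> n"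
    let ?p = "Transposition.transpose m n"
    have p: "?p permutes UNIV" by (simp add: permutes_swap_id)
    have "matrix (\<lambda>x::real^'n. \<chi> i. x $ ?p i) = (\<chi> i. mat 1 $ ?p i)"
      by (simp add: matrix_def mat_def axis_def vec_eq_iff)
    then have "\<bar>det (matrix (\<lambda>x::real^'n. \<chi> i. x $ ?p i))\<bar> = 1"
      using det_permute_rows[OF p, of "mat 1 :: real^'n^'n"] by (simp add: sign_def)
    then show "P (\<lambda>x. \<chi> i. x $ ?p i)"
      unfolding P_def using emeasure_lborel_permute[OF p] by (metis ennreal_1 mult_1)
  next
    fix m n :: 'n assume mn: "m \<noteq> n"
    let ?f = "\<lambda>x::real^'n. \<chi> i. if i = m then x $ m + x $ n else x $ i"
    have "matrix ?f = (\<chi> k. if k = m then row m (mat 1) + 1 *s row n (mat 1) else row k (mat 1))"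
      by (auto simp: matrix_def mat_def axis_def vec_eq_iff row_def)
    then have "det (matrix ?f) = 1"
      using det_row_operation[OF mn, of "mat 1 :: real^'n^'n" 1] by simp
    then show "P ?f"
      unfolding P_def by (simp add: emeasure_lborel_shear[OF mn])
  qed
  then show ?thesis using det A by (auto simp: P_def)
qed

lemma nn_integral_lborel_linear:
  fixes C :: "real^'n^'n"
  assumes "invertible C" and [measurable]: "g \<in> borel_measurable borel"
  shows "(\<integral>\<^sup>+z. g z \<partial>lborel) = ennreal \<bar>det C\<bar> * (\<integral>\<^sup>+x. g (C *v x) \<partial>lborel)"
proof -
  have [measurable]: "(*v) C \<in> borel_measurable borel"
    by (rule borel_measurable_linear) (rule matrix_vector_mul_linear)
  have "lborel = density (distr lborel borel ((*v) C)) (\<lambda>_. \<bar>det C\<bar>)"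
  proof (rule measure_eqI)
    fix A :: "(real^'n) set" assume "A \<in> sets lborel"
    then show "emeasure lborel A = emeasure (density (distr lborel borel ((*v) C)) (\<lambda>_. \<bar>det C\<bar>)) A"
      using emeasure_lborel_linear_vimage[OF matrix_vector_mul_linear[of C], of A] assms(1)
      by (simp add: emeasure_density nn_integral_cmult emeasure_distr invertible_det_nz)
  qed simp
  then have "(\<integral>\<^sup>+z. g z \<partial>lborel) = (\<integral>\<^sup>+z. g z \<partial>density (distr lborel borel ((*v) C)) (\<lambda>_. \<bar>det C\<bar>))"
    by simp
  also have "\<dots> = ennreal \<bar>det C\<bar> * (\<integral>\<^sup>+x. g (C *v x) \<partial>lborel)"
    by (subst nn_integral_density) (auto simp: nn_integral_cmult nn_integral_distr)
  finally show ?thesis .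
qed

lemma nn_integral_lborel_translate:
  fixes c :: "'a::euclidean_space"
  assumes [measurable]: "g \<in> borel_measurable borel"
  shows "(\<integral>\<^sup>+z. g z \<partial>lborel) = (\<integral>\<^sup>+x. g (c + x) \<partial>lborel)"
  by (subst lborel_distr_plus[symmetric, of c], subst nn_integral_distr) auto

section \<open>Nondegenerate Gaussian measures\<close>

lemma matrix_inv_mat_1: "matrix_inv (mat 1 :: real^'n^'n) = mat 1"
  using matrix_inv_mult(1)[of "mat 1 :: real^'n^'n"] pos_def_invertible[OF pos_def_mat_1] by simp

lemma borel_measurable_matrix_vector [measurable]:
  fixes A :: "real^'n^'m"
  shows "(\<lambda>x. A *v x) \<in> borel_measurable borel"
  by (rule borel_measurable_linear) (rule matrix_vector_mul_linear)

lemma borel_measurable_mvn_density [measurable]: "mvn_density m S \<in> borel_measurable borel"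
proof -
  have "mvn_density m S = (\<lambda>z. exp (- ((z - m) \<bullet> (matrix_inv S *v (z - m))) / 2) / sqrt ((2 * pi) ^ CARD('a) * det S))"
    by (simp add: mvn_density_def fun_eq_iff)
  then show ?thesis
    by (simp add: measurable_compose[OF _ borel_measurable_matrix_vector])
qed

lemma mvn_density_pos: "pos_def S \<Longrightarrow> 0 < mvn_density m S z"
  using pos_def_det_pos[of S] by (simp add: mvn_density_def)

lemma sets_mvn [simp, measurable_cong]: "sets (mvn m S) = sets borel"
  by (simp add: mvn_def)

lemma space_mvn [simp]: "space (mvn m S) = UNIV"
  by (simp add: mvn_def)

lemma mvn_density_std:
  "mvn_density 0 (mat 1) (z::real^'n) = (\<Prod>b\<in>Basis. std_normal_density (z \<bullet> b))"
proof -
  have "(\<Prod>b\<in>Basis. std_normal_density (z \<bullet> b)) =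
      (\<Prod>i\<in>(UNIV::'n set). exp (- (z $ i)\<^sup>2 / 2)) / sqrt (2 * pi) ^ CARD('n)"
    by (simp add: prod_Basis_cart inner_axis std_normal_density_def prod_dividef)
  also have "(\<Prod>i\<in>(UNIV::'n set). exp (- (z $ i)\<^sup>2 / 2)) = exp (- (z \<bullet> z) / 2)"
    by (simp add: exp_sum[symmetric] inner_vec_def sum_negf[symmetric] sum_divide_distrib power2_eq_square)
  finally show ?thesis
    by (simp add: mvn_density_def matrix_inv_mat_1 real_sqrt_power[symmetric] power_mult_distrib)
qed

text \<open>The coordinates of a standard Gaussian vector are independent standard normal variables.\<close>

lemma nn_integral_std_mvn_prod:
  fixes f :: "real^'n \<Rightarrow> real \<Rightarrow> ennreal"
  assumes [measurable]: "\<And>b. b \<in> Basis \<Longrightarrow> f b \<in> borel_measurable borel"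
  shows "(\<integral>\<^sup>+z. (\<Prod>b\<in>Basis. f b (z \<bullet> b)) \<partial>mvn 0 (mat 1)) =
    (\<Prod>b\<in>Basis. \<integral>\<^sup>+x. ennreal (std_normal_density x) * f b x \<partial>lborel)"
proof -
  have "(\<integral>\<^sup>+z. (\<Prod>b\<in>Basis. f b (z \<bullet> b)) \<partial>mvn 0 (mat 1)) =
      (\<integral>\<^sup>+z. (\<Prod>b\<in>Basis. ennreal (std_normal_density (z \<bullet> b)) * f b (z \<bullet> b)) \<partial>lborel)"
    unfolding mvn_def
    by (subst nn_integral_density) (auto simp: mvn_density_std prod.distrib prod_ennreal)
  also have "\<dots> = (\<Prod>b\<in>Basis. \<integral>\<^sup>+x. ennreal (std_normal_density x) * f b x \<partial>lborel)"
    by (rule nn_integral_lborel_prod[where f = "\<lambda>b x. ennreal (std_normal_density x) * f b x"]) auto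
  finally show ?thesis .
qed

lemma nn_integral_std_normal: "(\<integral>\<^sup>+x. ennreal (std_normal_density x) \<partial>lborel) = 1"
proof -
  interpret prob_space "density lborel (\<lambda>x. ennreal (std_normal_density x))"
    by (rule prob_space_normal_density) simp
  show ?thesis using emeasure_space_1 by (simp add: emeasure_density)
qed

lemma prob_space_std_mvn: "prob_space (mvn 0 (mat 1 :: real^'n^'n))"
proof
  have "emeasure (mvn 0 (mat 1 :: real^'n^'n)) UNIV = 1"
    using nn_integral_std_mvn_prod[of "\<lambda>(_ :: real^'n) _. 1"] by (simp add: nn_integral_std_normal)
  then show "emeasure (mvn 0 (mat 1 :: real^'n^'n)) (space (mvn 0 (mat 1))) = 1" by simp
qed

lemma std_mvn_second_moment: "integrable (mvn 0 (mat 1 :: real^'n^'n)) (\<lambda>z. (norm z)\<^sup>2)"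
proof -
  have "integrable (mvn 0 (mat 1 :: real^'n^'n)) (\<lambda>z. (z \<bullet> c)\<^sup>2)" if c: "c \<in> Basis" for c
  proof (rule integrableI_nonneg)
    let ?f = "\<lambda>b x. if b = c then ennreal (x\<^sup>2) else 1"
    have fin: "(\<integral>\<^sup>+x. ennreal (std_normal_density x) * ?f b x \<partial>lborel) < \<infinity>" for b
    proof (cases "b = c")
      case True
      have "(\<integral>\<^sup>+x. ennreal (std_normal_density x * x\<^sup>2) \<partial>lborel) < \<infinity>"
        using integrable_std_normal_moment[of 2]
        by (subst nn_integral_eq_integral) (auto intro!: mult_nonneg_nonneg)
      then show ?thesis using True by (simp add: ennreal_mult)
    qed (simp add: nn_integral_std_normal)
    have "(\<integral>\<^sup>+z. ennreal ((z \<bullet> c)\<^sup>2) \<partial>mvn 0 (mat 1)) = (\<integral>\<^sup>+z. (\<Prod>b\<in>Basis. ?f b (z \<bullet> b)) \<partial>mvn 0 (mat 1))"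
      using c by (simp add: prod.delta')
    also have "\<dots> = (\<Prod>b\<in>Basis. \<integral>\<^sup>+x. ennreal (std_normal_density x) * ?f b x \<partial>lborel)"
      by (rule nn_integral_std_mvn_prod) simp
    also have "\<dots> < \<infinity>"
      using fin by (simp add: ennreal_prod_eq_top less_top[symmetric])
    finally show "(\<integral>\<^sup>+z. ennreal ((z \<bullet> c)\<^sup>2) \<partial>mvn 0 (mat 1)) < \<infinity>" .
  qed (auto simp: mvn_def)
  then have "integrable (mvn 0 (mat 1 :: real^'n^'n)) (\<lambda>z. \<Sum>b\<in>Basis. (z \<bullet> b)\<^sup>2)" by simp
  then show ?thesis by (simp only: euclidean_inner[symmetric] power2_eq_square flip: power2_norm_eq_inner)
qed

text \<open>Since \<open>|det C| = sqrt (det (C C\<^sup>T))\<close> and \<open>C x \<bullet> (C C\<^sup>T)\<inverse> C x = x \<bullet> x\<close>, the two densities differ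
  exactly by the Jacobian. Any invertible factor \<open>C\<close> of the covariance is allowed, not just its
  symmetric square root.\<close>

lemma mvn_eq_affine_image:
  fixes C :: "real^'n^'n"
  assumes inv: "invertible C"
  shows "mvn m (C ** transpose C) = distr (mvn 0 (mat 1)) borel (\<lambda>x. m + C *v x)"
proof (rule measure_eqI)
  let ?S = "C ** transpose C"
  have d: "det C \<noteq> 0" using inv by (simp add: invertible_det_nz)
  have key: "\<bar>det C\<bar> * mvn_density m ?S (m + C *v x) = mvn_density 0 (mat 1) x" for x
  proof -
    have "?S *v (matrix_inv ?S *v (C *v x)) = C *v x"
      by (rule matrix_inv_mult_vector(1)[OF pos_def_invertible[OF pos_def_mult_transpose[OF inv]]])
    then have "C *v (transpose C *v (matrix_inv ?S *v (C *v x))) = C *v x"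
      by (simp only: matrix_vector_mul_assoc[symmetric])
    then have "transpose C *v (matrix_inv ?S *v (C *v x)) = x"
      by (metis inv matrix_inv_mult_vector(2))
    then have q: "(C *v x) \<bullet> (matrix_inv ?S *v (C *v x)) = x \<bullet> x"
      by (simp only: transpose_inner)
    have "sqrt ((2 * pi) ^ CARD('n) * det ?S) = \<bar>det C\<bar> * sqrt ((2 * pi) ^ CARD('n))"
      by (simp add: det_mul real_sqrt_mult mult_ac)
    then show ?thesis
      using d by (simp add: mvn_density_def q matrix_inv_mat_1)
  qed
  fix A assume "A \<in> sets (mvn m ?S)"
  then have [measurable]: "A \<in> sets borel" by simp
  have [measurable]: "(\<lambda>x. m + C *v x) \<in> borel_measurable borel" by simp
  have "emeasure (mvn m ?S) A = (\<integral>\<^sup>+z. ennreal (mvn_density m ?S z) * indicator A z \<partial>lborel)"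
    by (simp add: mvn_def emeasure_density)
  also have "\<dots> = (\<integral>\<^sup>+z. ennreal (mvn_density m ?S (m + z)) * indicator A (m + z) \<partial>lborel)"
    by (rule nn_integral_lborel_translate) simp
  also have "\<dots> = ennreal \<bar>det C\<bar> *
      (\<integral>\<^sup>+x. ennreal (mvn_density m ?S (m + C *v x)) * indicator A (m + C *v x) \<partial>lborel)"
    by (rule nn_integral_lborel_linear[OF inv, of "\<lambda>z. ennreal (mvn_density m ?S (m + z)) * indicator A (m + z)"]) measurable
  also have "\<dots> = (\<integral>\<^sup>+x. ennreal (\<bar>det C\<bar> * mvn_density m ?S (m + C *v x)) * indicator A (m + C *v x) \<partial>lborel)"
    by (subst nn_integral_cmult[symmetric]) (auto simp: ennreal_mult' mult_ac)
  also have "\<dots> = (\<integral>\<^sup>+x. ennreal (mvn_density 0 (mat 1) x) * indicator A (m + C *v x) \<partial>lborel)"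
    by (simp only: key)
  also have "\<dots> = emeasure (distr (mvn 0 (mat 1)) borel (\<lambda>x. m + C *v x)) A"
  proof -
    have [measurable]: "(\<lambda>x. m + C *v x) -` A \<in> sets borel"
      using measurable_sets[of "\<lambda>x. m + C *v x" borel borel A] by simp
    show ?thesis
      by (simp add: emeasure_distr mvn_def emeasure_density)
        (auto intro!: nn_integral_cong simp: indicator_def)
  qed
  finally show "emeasure (mvn m ?S) A = emeasure (distr (mvn 0 (mat 1)) borel (\<lambda>x. m + C *v x)) A" .
qed simp

lemma prob_space_mvn:
  fixes S :: "real^'a^'a"
  assumes "pos_def S" shows "prob_space (mvn m S)"
proof -
  obtain C :: "real^'a^'a" where C: "invertible C" "S = C ** transpose C" by (rule pos_def_factor[OF assms])
  interpret prob_space "mvn 0 (mat 1 :: real^'a^'a)" by (rule prob_space_std_mvn)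
  show ?thesis unfolding C(2) mvn_eq_affine_image[OF C(1)] by (rule prob_space_distr) simp
qed

lemma mvn_second_moment:
  fixes S :: "real^'a^'a"
  assumes "pos_def S" shows "integrable (mvn m S) (\<lambda>z. (norm z)\<^sup>2)"
proof -
  obtain C :: "real^'a^'a" where C: "invertible C" "S = C ** transpose C" by (rule pos_def_factor[OF assms])
  interpret prob_space "mvn 0 (mat 1 :: real^'a^'a)" by (rule prob_space_std_mvn)
  obtain K where K: "\<And>x. norm (C *v x) \<le> norm x * K"
    using bounded_linear.bounded[OF matrix_vector_mul_bounded_linear[of C]] by auto
  have "integrable (mvn 0 (mat 1 :: real^'a^'a)) (\<lambda>x. (norm (m + C *v x))\<^sup>2)"
  proof (rule Bochner_Integration.integrable_bound)
    show "integrable (mvn 0 (mat 1 :: real^'a^'a)) (\<lambda>x. 2 * (norm m)\<^sup>2 + 2 * K\<^sup>2 * (norm x)\<^sup>2)"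
      using std_mvn_second_moment by (intro Bochner_Integration.integrable_add integrable_mult_right) auto
    have "(norm (m + C *v x))\<^sup>2 \<le> 2 * (norm m)\<^sup>2 + 2 * K\<^sup>2 * (norm x)\<^sup>2" for x
    proof -
      have "norm (m + C *v x) \<le> norm m + norm x * K"
        using norm_triangle_ineq[of m "C *v x"] K[of x] by linarith
      then have "(norm (m + C *v x))\<^sup>2 \<le> (norm m + norm x * K)\<^sup>2"
        by (rule power_mono) simp
      also have "\<dots> \<le> 2 * (norm m)\<^sup>2 + 2 * (norm x * K)\<^sup>2"
        using sum_squares_bound[of "norm m" "norm x * K"] by (simp add: power2_sum)
      finally show ?thesis by (simp add: power_mult_distrib mult_ac)
    qed
    then show "AE x in mvn 0 (mat 1). norm ((norm (m + C *v x))\<^sup>2) \<le> norm (2 * (norm m)\<^sup>2 + 2 * K\<^sup>2 * (norm x)\<^sup>2)"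
      by simp
  qed simp
  then show ?thesis unfolding C(2) mvn_eq_affine_image[OF C(1)] by (subst integrable_distr_eq) auto
qed

lemma (in finite_measure) integrable_norm_if_square:
  fixes f :: "'a \<Rightarrow> 'b::{banach, second_countable_topology}"
  assumes [measurable]: "f \<in> borel_measurable M" and "integrable M (\<lambda>x. (norm (f x))\<^sup>2)"
  shows "integrable M f"
proof (rule Bochner_Integration.integrable_bound)
  show "integrable M (\<lambda>x. 1 + (norm (f x))\<^sup>2)" using assms by simp
  have "norm (f x) \<le> 1 + (norm (f x))\<^sup>2" for x
  proof -
    have "2 * norm (f x) \<le> 1 + (norm (f x))\<^sup>2"
      using sum_squares_bound[of 1 "norm (f x)"] by simp
    then show ?thesis using norm_ge_zero[of "f x"] by linarith
  qed
  then show "AE x in M. norm (f x) \<le> norm (1 + (norm (f x))\<^sup>2)" by simp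
qed simp

lemma mvn_centered:
  fixes S :: "real^'n^'n"
  assumes "pos_def S"
  shows "integrable (mvn 0 S) (\<lambda>z. z)" "(\<integral>z. z \<partial>mvn 0 S) = 0"
proof -
  interpret prob_space "mvn 0 S" using assms by (rule prob_space_mvn)
  show int: "integrable (mvn 0 S) (\<lambda>z. z)"
    by (rule integrable_norm_if_square) (use mvn_second_moment[OF assms] in auto)
  obtain C :: "real^'n^'n" where C: "invertible C" "S = C ** transpose C" by (rule pos_def_factor[OF assms])
  \<comment> \<open>Both \<open>C\<close> and \<open>- C\<close> are factors of \<open>S\<close>, so the centred Gaussian is symmetric.\<close>
  have Cm: "invertible (- C)" using scalar_invertible[of "-1" C] C(1) by simp

  have neg: "(- C) *v x = - (C *v x)" for x
    by (simp add: matrix_vector_mult_def vec_eq_iff sum_negf)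
  have "- C ** transpose (- C) = S"
    by (simp add: C(2) matrix_matrix_mult_def transpose_def vec_eq_iff)
  then have "mvn 0 S = distr (mvn 0 (mat 1)) borel (\<lambda>x. - (C *v x))"
    using mvn_eq_affine_image[OF Cm, of 0] by (simp add: neg)
  also have "\<dots> = distr (distr (mvn 0 (mat 1)) borel (\<lambda>x. 0 + C *v x)) borel (\<lambda>x. - x)"
    by (subst distr_distr) (auto simp: comp_def)
  also have "\<dots> = distr (mvn 0 S) borel (\<lambda>x. - x)"
    unfolding C(2) mvn_eq_affine_image[OF C(1)] ..
  finally have "(\<integral>z. z \<partial>mvn 0 S) = (\<integral>z. z \<partial>distr (mvn 0 S) borel (\<lambda>x. - x))" by simp
  also have "\<dots> = - (\<integral>z. z \<partial>mvn 0 S)"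
    by (subst integral_distr) auto
  finally have "2 *\<^sub>R (\<integral>z. z \<partial>mvn 0 S) = 0" unfolding scaleR_2 by (simp only: eq_neg_iff_add_eq_0)
  then show "(\<integral>z. z \<partial>mvn 0 S) = 0" by (simp only: scaleR_eq_0_iff) simp
qed

lemma mvn_translate:
  fixes S :: "real^'n^'n"
  assumes "pos_def S"
  shows "mvn (a + b) S = distr (mvn b S) borel (\<lambda>z. a + z)"
proof -
  obtain C :: "real^'n^'n" where C: "invertible C" "S = C ** transpose C" by (rule pos_def_factor[OF assms])
  show ?thesis
    unfolding C(2) mvn_eq_affine_image[OF C(1)]
    by (subst distr_distr) (auto simp: comp_def add.assoc)
qed

section \<open>Regression decompositions of Gaussian vectors\<close>

lemma borel_measurable_vsplit [measurable]: "vsplit \<in> borel_measurable borel"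
proof (rule borel_measurable_linear)
  show "linear (vsplit :: real^('a + 'b) \<Rightarrow> _)"
    by (rule linearI) (auto simp: vsplit_def vec_eq_iff)
qed

lemma measurable_vsplit_pair [measurable]: "vsplit \<in> borel \<rightarrow>\<^sub>M borel \<Otimes>\<^sub>M borel"
  unfolding borel_prod by (rule borel_measurable_vsplit)

lemma lborel_vsplit: "distr lborel borel vsplit = (lborel :: ((real^'a) \<times> (real^'b)) measure)"
proof (rule lborel_eqI[symmetric])
  fix l u :: "(real^'a) \<times> (real^'b)"
  assume le: "\<And>b. b \<in> Basis \<Longrightarrow> l \<bullet> b \<le> u \<bullet> b"
  obtain la lb ua ub where lu: "l = (la, lb)" "u = (ua, ub)" by (metis surj_pair)
  have prodB: "(\<Prod>b\<in>Basis. (u - l) \<bullet> b) = (\<Prod>i\<in>UNIV. ua $ i - la $ i) * (\<Prod>i\<in>UNIV. ub $ i - lb $ i)"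
    unfolding Basis_prod_def lu
    by (subst prod.union_disjoint)
      (auto simp: prod.reindex inj_on_def prod_Basis_cart inner_axis)
  have le1: "la $ i \<le> ua $ i" for i using le[of "(axis i 1, 0)"] by (simp add: lu Basis_prod_def inner_axis)
  have le2: "lb $ i \<le> ub $ i" for i using le[of "(0, axis i 1)"] by (simp add: lu Basis_prod_def inner_axis)
  have vs: "vsplit -` box l u = box (vjoin la lb) (vjoin ua ub)"
  proof -

    have "x \<in> box l u \<longleftrightarrow> fst x \<in> box la ua \<and> snd x \<in> box lb ub" for x
      unfolding lu by (cases x) (auto simp: mem_box Basis_prod_def ball_Un)
    moreover have "z \<in> box (vjoin la lb) (vjoin ua ub) \<longleftrightarrow> fst (vsplit z) \<in> box la ua \<and> snd (vsplit z) \<in> box lb ub"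
      for z
    proof -
      obtain x y where z: "z = vjoin x y" by (rule vjoin_cases)
      show ?thesis
        unfolding z vsplit_vjoin by (simp add: mem_box_cart vjoin_def split_sum_all)
    qed
    ultimately show ?thesis by (intro set_eqI) (simp only: vimage_eq)
  qed
  have "emeasure (distr lborel borel vsplit) (box l u) = emeasure lborel (box (vjoin la lb) (vjoin ua ub))"
    by (simp add: emeasure_distr vs)
  also have "\<dots> = ennreal (\<Prod>b\<in>Basis. (vjoin ua ub - vjoin la lb) \<bullet> b)"
    using le1 le2
    by (intro emeasure_lborel_box) (auto simp: Basis_vec_def inner_axis vjoin_def split: sum.split)
  also have "(\<Prod>b\<in>Basis. (vjoin ua ub - vjoin la lb) \<bullet> b) = (\<Prod>b\<in>Basis. (u - l) \<bullet> b)"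
    unfolding prodB prod_Basis_cart
    by (simp add: inner_axis vjoin_def UNIV_Plus_UNIV[symmetric] prod.Plus del: UNIV_Plus_UNIV)
  finally show "emeasure (distr lborel borel vsplit) (box l u) = ennreal (\<Prod>b\<in>Basis. (u - l) \<bullet> b)" .
qed simp

lemma std_mvn_vsplit:
  "distr (mvn 0 (mat 1 :: real^('a+'b)^('a+'b))) borel vsplit =
     mvn 0 (mat 1 :: real^'a^'a) \<Otimes>\<^sub>M mvn 0 (mat 1 :: real^'b^'b)"
proof -
  have dens: "mvn_density 0 (mat 1) (z :: real^('a+'b)) =
      mvn_density 0 (mat 1) (fst (vsplit z)) * mvn_density 0 (mat 1) (snd (vsplit z))" for z
  proof -
    obtain x y where z: "z = vjoin x y" by (rule vjoin_cases)
    show ?thesis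
      by (simp add: z mvn_density_def matrix_inv_mat_1 inner_vjoin real_sqrt_mult power_add
          exp_add[symmetric] field_simps add_divide_distrib)
  qed
  have nn: "0 \<le> mvn_density 0 (mat 1 :: real^'c^'c) z" for z :: "real^'c"
    using mvn_density_pos[OF pos_def_mat_1] by (rule less_imp_le)
  have prod_dens: "mvn 0 (mat 1 :: real^'a^'a) \<Otimes>\<^sub>M mvn 0 (mat 1 :: real^'b^'b) =
     density (lborel \<Otimes>\<^sub>M lborel) (\<lambda>(x, y). ennreal (mvn_density 0 (mat 1) x) * ennreal (mvn_density 0 (mat 1) y))"
    unfolding mvn_def
  proof (rule pair_measure_density)
    show "sigma_finite_measure (density lborel (\<lambda>z. ennreal (mvn_density 0 (mat 1 :: real^'b^'b) z)))"
      using prob_space_std_mvn[where 'n = 'b] unfolding mvn_def by (rule prob_space_imp_sigma_finite)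
  qed (auto intro: sigma_finite_lborel)
  have [measurable]: "(\<lambda>(x :: real^'a, y :: real^'b). ennreal (mvn_density 0 (mat 1) x) *
      ennreal (mvn_density 0 (mat 1) y)) \<in> borel_measurable borel"
    by (subst borel_prod[symmetric]) measurable
  have "density (lborel \<Otimes>\<^sub>M lborel) (\<lambda>(x, y). ennreal (mvn_density 0 (mat 1) x) *
        ennreal (mvn_density 0 (mat 1) y)) = density (distr lborel borel vsplit)
      (\<lambda>(x :: real^'a, y :: real^'b). ennreal (mvn_density 0 (mat 1) x) * ennreal (mvn_density 0 (mat 1) y))"
    by (simp add: lborel_prod lborel_vsplit)
  also have "\<dots> = distr (mvn 0 (mat 1 :: real^('a+'b)^('a+'b))) borel vsplit"
    unfolding mvn_def
    by (subst density_distr) (auto simp: dens ennreal_mult nn case_prod_beta)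
  finally show ?thesis using prod_dens by simp
qed

text \<open>Every Gaussian pair with nondegenerate covariance has this form: the second vector is an affine
  function of the first one plus independent Gaussian noise, and the noise covariance \<open>K\<close> is the Schur
  complement.\<close>

lemma mvn_regression_on_fst:
  fixes A :: "real^'a^'a" and K :: "real^'b^'b" and M :: "real^'a^'b"
  assumes A: "pos_def A" and K: "pos_def K"
  shows "distr (mvn (vjoin a b) (block2 A (A ** transpose M) (M ** A) (M ** A ** transpose M + K))) borel vsplit
    = distr (mvn a A \<Otimes>\<^sub>M mvn 0 K) borel (\<lambda>(u, t). (u, b + M *v (u - a) + t))"
proof -
  obtain P :: "real^'a^'a" where P: "invertible P" "A = P ** transpose P" by (rule pos_def_factor[OF A])
  obtain Q :: "real^'b^'b" where Q: "invertible Q" "K = Q ** transpose Q" by (rule pos_def_factor[OF K])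
  define C where "C = block2 P 0 (M ** P) Q"
  have C: "invertible C" "C ** transpose C = block2 A (A ** transpose M) (M ** A) (M ** A ** transpose M + K)"
    using block2_lower_factor[OF P(1) Q(1), of M] by (simp_all add: C_def P(2) Q(2))
  interpret Q: prob_space "mvn 0 (Q ** transpose Q)" using prob_space_mvn[OF K] by (simp add: Q(2))
  have g: "(\<lambda>(u, t). (u, b + M *v (u - a) + t)) \<in> borel \<Otimes>\<^sub>M borel \<rightarrow>\<^sub>M borel"
    unfolding borel_prod[symmetric] by measurable
  have f: "(\<lambda>z. (a + P *v fst (vsplit z), Q *v snd (vsplit z))) \<in> mvn 0 (mat 1) \<rightarrow>\<^sub>M borel \<Otimes>\<^sub>M borel"
    by measurable
  have "mvn a A \<Otimes>\<^sub>M mvn 0 K = distr (mvn 0 (mat 1) \<Otimes>\<^sub>M mvn 0 (mat 1)) (borel \<Otimes>\<^sub>M borel)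
      (\<lambda>(x, y). (a + P *v x, 0 + Q *v y))"
    unfolding P(2) Q(2) using Q.sigma_finite_measure_axioms
    unfolding mvn_eq_affine_image[OF P(1)] mvn_eq_affine_image[OF Q(1)]
    by (intro pair_measure_distr) auto
  also have "\<dots> = distr (mvn 0 (mat 1)) (borel \<Otimes>\<^sub>M borel) (\<lambda>z. (a + P *v fst (vsplit z), Q *v snd (vsplit z)))"
  proof -
    have "(\<lambda>(x, y). (a + P *v x, 0 + Q *v y)) \<in> borel \<rightarrow>\<^sub>M borel \<Otimes>\<^sub>M borel"
      unfolding borel_prod[symmetric] by measurable
    from distr_distr[OF this, of vsplit "mvn 0 (mat 1)"] show ?thesis
      unfolding std_mvn_vsplit[symmetric] by (simp add: comp_def case_prod_beta)
  qed
  finally have "distr (mvn a A \<Otimes>\<^sub>M mvn 0 K) borel (\<lambda>(u, t). (u, b + M *v (u - a) + t)) =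
     distr (mvn 0 (mat 1)) borel (\<lambda>z. (a + P *v fst (vsplit z),
       b + M *v (P *v fst (vsplit z)) + Q *v snd (vsplit z)))"
    by (simp add: distr_distr[OF g f] comp_def)
  also have "\<dots> = distr (distr (mvn 0 (mat 1)) borel (\<lambda>z. vjoin a b + C *v z)) borel vsplit"
  proof (subst distr_distr)
    show "distr (mvn 0 (mat 1)) borel (\<lambda>z. (a + P *v fst (vsplit z), b + M *v (P *v fst (vsplit z)) + Q *v snd (vsplit z)))
       = distr (mvn 0 (mat 1)) borel (vsplit \<circ> (\<lambda>z. vjoin a b + C *v z))"
    proof (rule arg_cong[where f = "distr (mvn 0 (mat 1)) borel"], rule ext)
      fix z :: "real^('a + 'b)"
      obtain x y where z: "z = vjoin x y" by (rule vjoin_cases)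
      show "(a + P *v fst (vsplit z), b + M *v (P *v fst (vsplit z)) + Q *v snd (vsplit z)) =
          (vsplit \<circ> (\<lambda>z. vjoin a b + C *v z)) z"
        by (simp add: z C_def block2_mult_vjoin vjoin_add matrix_vector_mul_assoc[symmetric] add.assoc)
    qed
  qed auto
  also have "\<dots> = distr (mvn (vjoin a b) (C ** transpose C)) borel vsplit"
    unfolding mvn_eq_affine_image[OF C(1)] ..
  finally show ?thesis unfolding C(2) ..
qed

lemma mvn_regression_on_snd:
  fixes D :: "real^'b^'b" and K :: "real^'a^'a" and M :: "real^'b^'a"
  assumes D: "pos_def D" and K: "pos_def K"
  shows "distr (mvn (vjoin a b) (block2 (M ** D ** transpose M + K) (M ** D) (D ** transpose M) D)) borel vsplit
    = distr (mvn 0 K \<Otimes>\<^sub>M mvn b D) borel (\<lambda>(t, y). (a + M *v (y - b) + t, y))"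
proof -
  obtain P :: "real^'b^'b" where P: "invertible P" "D = P ** transpose P" by (rule pos_def_factor[OF D])
  obtain Q :: "real^'a^'a" where Q: "invertible Q" "K = Q ** transpose Q" by (rule pos_def_factor[OF K])
  define C where "C = block2 Q (M ** P) 0 P"
  have C: "invertible C" "C ** transpose C = block2 (M ** D ** transpose M + K) (M ** D) (D ** transpose M) D"
    using block2_upper_factor[OF P(1) Q(1), of M] by (simp_all add: C_def P(2) Q(2))
  interpret P: prob_space "mvn b (P ** transpose P)" using prob_space_mvn[OF D] by (simp add: P(2))
  have g: "(\<lambda>(t, y). (a + M *v (y - b) + t, y)) \<in> borel \<Otimes>\<^sub>M borel \<rightarrow>\<^sub>M borel"
    unfolding borel_prod[symmetric] by measurable
  have f: "(\<lambda>z. (Q *v fst (vsplit z), b + P *v snd (vsplit z))) \<in> mvn 0 (mat 1) \<rightarrow>\<^sub>M borel \<Otimes>\<^sub>M borel"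
    by measurable
  have "mvn 0 K \<Otimes>\<^sub>M mvn b D = distr (mvn 0 (mat 1) \<Otimes>\<^sub>M mvn 0 (mat 1)) (borel \<Otimes>\<^sub>M borel)
      (\<lambda>(x, y). (0 + Q *v x, b + P *v y))"
    unfolding P(2) Q(2) using P.sigma_finite_measure_axioms
    unfolding mvn_eq_affine_image[OF P(1)] mvn_eq_affine_image[OF Q(1)]
    by (intro pair_measure_distr) auto
  also have "\<dots> = distr (mvn 0 (mat 1)) (borel \<Otimes>\<^sub>M borel) (\<lambda>z. (Q *v fst (vsplit z), b + P *v snd (vsplit z)))"
  proof -
    have "(\<lambda>(x, y). (0 + Q *v x, b + P *v y)) \<in> borel \<rightarrow>\<^sub>M borel \<Otimes>\<^sub>M borel"
      unfolding borel_prod[symmetric] by measurable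
    from distr_distr[OF this, of vsplit "mvn 0 (mat 1)"] show ?thesis
      unfolding std_mvn_vsplit[symmetric] by (simp add: comp_def case_prod_beta)
  qed
  finally have "distr (mvn 0 K \<Otimes>\<^sub>M mvn b D) borel (\<lambda>(t, y). (a + M *v (y - b) + t, y)) =
     distr (mvn 0 (mat 1)) borel (\<lambda>z. (a + M *v (P *v snd (vsplit z)) + Q *v fst (vsplit z), b + P *v snd (vsplit z)))"
    by (simp add: distr_distr[OF g f] comp_def)
  also have "\<dots> = distr (distr (mvn 0 (mat 1)) borel (\<lambda>z. vjoin a b + C *v z)) borel vsplit"
  proof (subst distr_distr)
    show "distr (mvn 0 (mat 1)) borel (\<lambda>z. (a + M *v (P *v snd (vsplit z)) + Q *v fst (vsplit z), b + P *v snd (vsplit z)))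
       = distr (mvn 0 (mat 1)) borel (vsplit \<circ> (\<lambda>z. vjoin a b + C *v z))"
    proof (rule arg_cong[where f = "distr (mvn 0 (mat 1)) borel"], rule ext)
      fix z :: "real^('a + 'b)"
      obtain x y where z: "z = vjoin x y" by (rule vjoin_cases)
      show "(a + M *v (P *v snd (vsplit z)) + Q *v fst (vsplit z), b + P *v snd (vsplit z)) =
          (vsplit \<circ> (\<lambda>z. vjoin a b + C *v z)) z"
        by (simp add: z C_def block2_mult_vjoin vjoin_add matrix_vector_mul_assoc[symmetric] add_ac)
    qed
  qed auto
  also have "\<dots> = distr (mvn (vjoin a b) (C ** transpose C)) borel vsplit"
    unfolding mvn_eq_affine_image[OF C(1)] ..
  finally show ?thesis unfolding C(2) ..
qed

section \<open>Conditional laws\<close>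

text \<open>A conditional law is given by its values on rectangles; these determine the measure, which is
  therefore the mixture of the measures \<open>distr (\<kappa> u) _ (Pair u)\<close>.\<close>

lemma is_conditional_law_nn_integral:
  fixes \<pi> :: "('a::second_countable_topology \<times> 'b::second_countable_topology) measure"
  assumes \<kappa>: "is_conditional_law \<pi> \<kappa>" and \<pi>: "prob_space \<pi>" "sets \<pi> = sets borel"
    and F: "F \<in> borel_measurable borel"
  shows "(\<integral>\<^sup>+w. F w \<partial>\<pi>) = (\<integral>\<^sup>+u. \<integral>\<^sup>+z. F (u, z) \<partial>\<kappa> u \<partial>distr \<pi> borel fst)"
proof -
  interpret \<pi>: prob_space \<pi> by fact
  define \<mu> where "\<mu> = distr \<pi> borel fst"
  have \<kappa>_meas[measurable]: "\<kappa> \<in> borel \<rightarrow>\<^sub>M prob_algebra borel"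
    and rect: "\<And>A B. A \<in> sets borel \<Longrightarrow> B \<in> sets borel \<Longrightarrow>
        emeasure \<pi> (A \<times> B) = (\<integral>\<^sup>+u\<in>A. emeasure (\<kappa> u) B \<partial>\<mu>)"
    using \<kappa> by (auto simp: is_conditional_law_def \<mu>_def)
  have s\<kappa>: "sets (\<kappa> u) = sets borel" for u
    using measurable_space[OF \<kappa>_meas, of u] by (simp add: space_prob_algebra)
  have \<mu>_sets[measurable_cong]: "sets \<mu> = sets borel" by (simp add: \<mu>_def)
  define k where "k = (\<lambda>u. distr (\<kappa> u) (borel \<Otimes>\<^sub>M borel) (Pair u))"
  have k_prob: "k \<in> \<mu> \<rightarrow>\<^sub>M prob_algebra (borel \<Otimes>\<^sub>M borel)"
    unfolding k_def by (rule measurable_distr_prob_space2[where M = borel]) measurable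
  then have k[measurable]: "k \<in> \<mu> \<rightarrow>\<^sub>M subprob_algebra (borel \<Otimes>\<^sub>M borel)"
    by (rule measurable_prob_algebraD)
  have ne: "space \<mu> \<noteq> {}" by (simp add: \<mu>_def)
  have pi_eq: "\<pi> = \<mu> \<bind> k"
  proof (rule measure_eqI_generator_eq)
    let ?E = "{a \<times> b | a b. a \<in> sets borel \<and> b \<in> sets borel} :: ('a \<times> 'b) set set"
    show "Int_stable ?E" using Int_stable_pair_measure_generator[of borel borel] by simp
    show "?E \<subseteq> Pow UNIV" by auto
    have gen: "sets (borel \<Otimes>\<^sub>M borel :: ('a \<times> 'b) measure) = sigma_sets UNIV ?E"
      by (simp add: sets_pair_measure)
    have "sets \<pi> = sets (borel \<Otimes>\<^sub>M borel :: ('a \<times> 'b) measure)" unfolding borel_prod by (rule \<pi>(2))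
    then show "sets \<pi> = sigma_sets UNIV ?E" unfolding gen .
    show "sets (\<mu> \<bind> k) = sigma_sets UNIV ?E"
      using sets_bind[OF _ ne, of k "borel \<Otimes>\<^sub>M borel"] measurable_space[OF k_prob]
      by (simp add: gen space_prob_algebra)
    show "emeasure \<pi> X = emeasure (\<mu> \<bind> k) X" if "X \<in> ?E" for X
    proof -
      from that obtain A B where X: "X = A \<times> B" and AB[measurable]: "A \<in> sets borel" "B \<in> sets borel"
        by auto
      have "emeasure (\<mu> \<bind> k) X = (\<integral>\<^sup>+u. emeasure (k u) X \<partial>\<mu>)"
        by (rule emeasure_bind[OF ne k]) (simp add: X)
      also have "\<dots> = (\<integral>\<^sup>+u\<in>A. emeasure (\<kappa> u) B \<partial>\<mu>)"
      proof (rule nn_integral_cong)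
        fix u
        have "Pair u \<in> \<kappa> u \<rightarrow>\<^sub>M borel \<Otimes>\<^sub>M borel" by (simp add: measurable_cong_sets[OF s\<kappa> refl])
        then have "emeasure (k u) X = emeasure (\<kappa> u) (Pair u -` X \<inter> space (\<kappa> u))"
          unfolding k_def by (rule emeasure_distr) (simp add: X)
        also have "Pair u -` X \<inter> space (\<kappa> u) = (if u \<in> A then B else {})"
          using sets_eq_imp_space_eq[OF s\<kappa>] by (auto simp: X)
        finally show "emeasure (k u) X = emeasure (\<kappa> u) B * indicator A u" by auto
      qed
      also have "\<dots> = emeasure \<pi> X" unfolding X by (rule rect[symmetric]) auto
      finally show ?thesis ..
    qed
    show "range (\<lambda>_. UNIV) \<subseteq> ?E"
      by (auto intro!: exI[of _ UNIV] simp: UNIV_Times_UNIV[symmetric] simp del: UNIV_Times_UNIV)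
    show "(\<Union>i::nat. UNIV) = (UNIV :: ('a \<times> 'b) set)" by simp
    show "emeasure \<pi> UNIV \<noteq> \<infinity>" by simp
  qed
  have F'[measurable]: "F \<in> borel_measurable (borel \<Otimes>\<^sub>M borel)" using F by (simp add: borel_prod)
  have "(\<integral>\<^sup>+w. F w \<partial>\<pi>) = (\<integral>\<^sup>+u. \<integral>\<^sup>+w. F w \<partial>k u \<partial>\<mu>)"
    unfolding pi_eq by (rule nn_integral_bind[OF F' k])
  also have "\<dots> = (\<integral>\<^sup>+u. \<integral>\<^sup>+z. F (u, z) \<partial>\<kappa> u \<partial>\<mu>)"
  proof (rule nn_integral_cong)
    fix u
    have "Pair u \<in> \<kappa> u \<rightarrow>\<^sub>M borel \<Otimes>\<^sub>M borel" by (simp add: measurable_cong_sets[OF s\<kappa> refl])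
    then show "(\<integral>\<^sup>+w. F w \<partial>k u) = (\<integral>\<^sup>+z. F (u, z) \<partial>\<kappa> u)"
      unfolding k_def by (rule nn_integral_distr) simp
  qed
  finally show ?thesis unfolding \<mu>_def .
qed

lemma nn_integral_eq_uminus_if_integral_0:
  fixes f :: "'a \<Rightarrow> real"
  assumes "integrable M f" "(\<integral>x. f x \<partial>M) = 0"
  shows "(\<integral>\<^sup>+x. ennreal (f x) \<partial>M) = (\<integral>\<^sup>+x. ennreal (- f x) \<partial>M)"
  using assms unfolding real_integrable_def real_lebesgue_integral_def[OF assms(1)]
  by (metis eq_iff_diff_eq_0 ennreal_enn2real infinity_ennreal_def less_top)

text \<open>Conditionally on \<open>u\<close> the positive and the negative part of \<open>\<langle>g(u), x\<rangle>\<close> have the same integral, so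
  only integrability with respect to the joint law is needed.\<close>

lemma integral_inner_conditional_mean_0:
  fixes \<pi> :: "((real^'u) \<times> (real^'x) \<times> (real^'y)) measure"
  assumes \<kappa>: "is_conditional_law \<pi> \<kappa>" and \<pi>: "prob_space \<pi>" "sets \<pi> = sets borel"
    and mean: "AE u in distr \<pi> borel fst. integrable (\<kappa> u) fst \<and> (\<integral>z. fst z \<partial>\<kappa> u) = 0"
    and [measurable]: "g \<in> borel_measurable borel"
    and int: "integrable \<pi> (\<lambda>w. g (fst w) \<bullet> fst (snd w))"
  shows "(\<integral>w. g (fst w) \<bullet> fst (snd w) \<partial>\<pi>) = 0"
proof -
  have m[measurable]: "(\<lambda>w :: (real^'u) \<times> (real^'x) \<times> (real^'y). g (fst w) \<bullet> fst (snd w)) \<in> borel_measurable borel"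
    unfolding borel_prod[symmetric] by measurable
  have "(\<integral>\<^sup>+w. ennreal (g (fst w) \<bullet> fst (snd w)) \<partial>\<pi>) =
      (\<integral>\<^sup>+u. \<integral>\<^sup>+z. ennreal (g u \<bullet> fst z) \<partial>\<kappa> u \<partial>distr \<pi> borel fst)"
    by (subst is_conditional_law_nn_integral[OF \<kappa> \<pi>]) auto
  also have "\<dots> = (\<integral>\<^sup>+u. \<integral>\<^sup>+z. ennreal (- (g u \<bullet> fst z)) \<partial>\<kappa> u \<partial>distr \<pi> borel fst)"
  proof (rule nn_integral_cong_AE, use mean in eventually_elim)
    fix u assume u: "integrable (\<kappa> u) fst \<and> (\<integral>z. fst z \<partial>\<kappa> u) = 0"
    show "(\<integral>\<^sup>+z. ennreal (g u \<bullet> fst z) \<partial>\<kappa> u) = (\<integral>\<^sup>+z. ennreal (- (g u \<bullet> fst z)) \<partial>\<kappa> u)"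
      by (rule nn_integral_eq_uminus_if_integral_0) (use u in auto)
  qed
  also have "\<dots> = (\<integral>\<^sup>+w. ennreal (- (g (fst w) \<bullet> fst (snd w))) \<partial>\<pi>)"
    by (subst is_conditional_law_nn_integral[OF \<kappa> \<pi>]) auto
  finally show ?thesis using int by (simp add: real_lebesgue_integral_def)
qed

section \<open>The Gibbs variational principle\<close>

lemma log_base_exp_1: "log (exp 1) x = ln x"
  by (simp add: log_def)

lemma KL_divergence_density:
  fixes p :: "'a \<Rightarrow> real"
  assumes R: "prob_space R" and [measurable]: "p \<in> borel_measurable R" and pos: "\<And>x. 0 < p x"
    and int: "integrable (density R p) (\<lambda>x. ln (p x))"
  shows "absolutely_continuous R (density R p)"
    and "integrable (density R p) (entropy_density (exp 1) R (density R p))"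
    and "KL_divergence (exp 1) R (density R p) = (\<integral>x. ln (p x) \<partial>density R p)"
proof -
  interpret R: prob_space R by fact
  show "absolutely_continuous R (density R p)" by (rule absolutely_continuousI_density) simp
  have "AE x in R. p x = RN_deriv R (density R p) x"
    by (rule R.RN_deriv_unique) auto
  then have "AE x in density R p. entropy_density (exp 1) R (density R p) x = ln (p x)"
    by (subst AE_density, simp, eventually_elim)
      (auto simp: entropy_density_def log_base_exp_1 pos less_imp_le dest!: sym[of "ennreal _"])
  note eq = this
  have m: "entropy_density (exp 1) R (density R p) \<in> borel_measurable (density R p)"
    "(\<lambda>x. ln (p x)) \<in> borel_measurable (density R p)"
    using measurable_entropy_density[of "exp 1" R "density R p"] by simp_all
  show "integrable (density R p) (entropy_density (exp 1) R (density R p))"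
    using int by (subst integrable_cong_AE[OF m eq])
  show "KL_divergence (exp 1) R (density R p) = (\<integral>x. ln (p x) \<partial>density R p)"
    unfolding KL_divergence_def by (rule integral_cong_AE[OF m eq])
qed

text \<open>The difference of the two sides is the divergence of \<open>P\<close> from \<open>density R p\<close>.\<close>

lemma KL_divergence_ge_log_density:
  fixes p :: "'a \<Rightarrow> real"
  assumes R: "prob_space R" and p[measurable]: "p \<in> borel_measurable R" and pos: "\<And>x. 0 < p x"
    and Q: "prob_space (density R p)"
    and P: "prob_space P" and sets: "sets P = sets R" and ac: "absolutely_continuous R P"
    and ent: "integrable P (entropy_density (exp 1) R P)"
    and int: "integrable P (\<lambda>x. ln (p x))"
  shows "(\<integral>x. ln (p x) \<partial>P) \<le> KL_divergence (exp 1) R P"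
    and "KL_divergence (exp 1) R P = (\<integral>x. ln (p x) \<partial>P) \<Longrightarrow> P = density R p"
proof -
  interpret R: prob_space R by fact
  interpret P: prob_space P by fact
  interpret Q: prob_space "density R p" by fact
  interpret Q: information_space "density R p" "exp 1" by unfold_locales simp
  have "finite_measure P" by unfold_locales
  from R.real_RN_deriv[OF this ac sets] obtain D where D[measurable]: "D \<in> borel_measurable R"
    and RN: "AE x in R. RN_deriv R P x = ennreal (D x)" and Dpos: "AE x in P. 0 < D x" and D0: "\<And>x. 0 \<le> D x"
    by auto
  have "P = density R (RN_deriv R P)"
    using R.density_RN_deriv[OF ac sets] ..
  also have "\<dots> = density R D" by (rule density_cong) (use RN in auto)
  finally have PD: "P = density R D" .
  define E where "E x = D x / p x" for x
  have [measurable]: "E \<in> borel_measurable R" unfolding E_def by measurable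
  have QE: "density (density R p) E = P"
    unfolding PD E_def by (rule density_density_divide) (use pos D0 in \<open>auto simp: less_imp_le less_imp_neq[symmetric]\<close>)
  have lnE: "AE x in P. log (exp 1) (E x) = entropy_density (exp 1) R P x - ln (p x)"
    using absolutely_continuous_AE[OF sets ac RN] Dpos
    by eventually_elim (simp add: log_base_exp_1 entropy_density_def E_def ln_div pos D0 pos[THEN less_imp_neq, symmetric])
  have entm: "entropy_density (exp 1) R P \<in> borel_measurable R" by (rule measurable_entropy_density)
  then have meas: "entropy_density (exp 1) R P \<in> borel_measurable P" "(\<lambda>x. ln (p x)) \<in> borel_measurable P"
    "(\<lambda>x. log (exp 1) (E x)) \<in> borel_measurable P"
    by (simp_all add: measurable_cong_sets[OF sets refl])
  have intE: "integrable P (\<lambda>x. log (exp 1) (E x))"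
    by (subst integrable_cong_AE[OF _ _ lnE]) (use meas ent int in auto)
  have E0: "0 \<le> E x" for x using D0 pos by (simp add: E_def less_imp_le)
  have intQ: "integrable (density R p) (\<lambda>x. E x * log (exp 1) (E x))"
    using intE unfolding QE[symmetric] by (subst (asm) integrable_real_density) (auto simp: E0)
  have "KL_divergence (exp 1) (density R p) P = (\<integral>x. E x * log (exp 1) (E x) \<partial>density R p)"
    unfolding QE[symmetric] by (rule Q.KL_density) (auto simp: E0)
  also have "\<dots> = (\<integral>x. log (exp 1) (E x) \<partial>P)"
    unfolding QE[symmetric] by (rule integral_real_density[symmetric]) (auto simp: E0)
  also have "\<dots> = (\<integral>x. entropy_density (exp 1) R P x - ln (p x) \<partial>P)"
    by (rule integral_cong_AE) (use lnE meas in auto)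
  also have "\<dots> = KL_divergence (exp 1) R P - (\<integral>x. ln (p x) \<partial>P)"
    unfolding KL_divergence_def using ent int by (rule Bochner_Integration.integral_diff)
  finally have KL: "KL_divergence (exp 1) (density R p) P = KL_divergence (exp 1) R P - (\<integral>x. ln (p x) \<partial>P)" .
  have PE: "prob_space (density (density R p) E)" unfolding QE by fact
  have "0 \<le> KL_divergence (exp 1) (density R p) P"
    using Q.KL_nonneg[OF PE _ _ intQ] E0 unfolding QE by simp
  then show "(\<integral>x. ln (p x) \<partial>P) \<le> KL_divergence (exp 1) R P" unfolding KL by simp
  show "P = density R p" if "KL_divergence (exp 1) R P = (\<integral>x. ln (p x) \<partial>P)"
    using Q.KL_eq_0_iff_eq[OF PE _ _ intQ] E0 that KL unfolding QE by simp
qed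

section \<open>Verification of optimality by duality\<close>

lemma borel_measurable_fst_snd [measurable]:
  "fst \<in> borel_measurable (borel :: ('a::second_countable_topology \<times> 'b::second_countable_topology) measure)"
  "snd \<in> borel_measurable (borel :: ('a::second_countable_topology \<times> 'b::second_countable_topology) measure)"
  unfolding borel_prod[symmetric] by measurable

lemma borel_measurable_at_fst_snd:
  fixes F :: "'a::second_countable_topology \<Rightarrow> 'c::topological_space"
    and G :: "'b::second_countable_topology \<Rightarrow> 'c"
  shows "F \<in> borel_measurable borel \<Longrightarrow> (\<lambda>w :: 'a \<times> 'b. F (fst w)) \<in> borel_measurable borel"
    and "G \<in> borel_measurable borel \<Longrightarrow> (\<lambda>w :: 'a \<times> 'b. G (snd w)) \<in> borel_measurable borel"
  by (rule measurable_compose[OF borel_measurable_fst_snd(1)], assumption)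
    (rule measurable_compose[OF borel_measurable_fst_snd(2)], assumption)

lemma case_prod_triple:
  "(\<lambda>(u, x, y). F u x y) = (\<lambda>w. F (fst w) (fst (snd w)) (snd (snd w)))"
  by (simp add: fun_eq_iff)

text \<open>Sufficiency of the first-order conditions: a feasible coupling whose log-density with respect to
  \<open>\<mu> \<otimes> \<nu>\<close> is \<open>(f + \<langle>g, x\<rangle> + h - c) / \<epsilon>\<close> is the unique optimal coupling, and \<open>(f, g, h)\<close> are dual
  potentials. Second moments of the marginals and linearity of \<open>g\<close> make \<open>\<langle>g(u), x\<rangle>\<close> integrable under
  every coupling. The bound on the conditional first moments does the same under the given coupling
  for the arbitrary integrable functions that compete with \<open>g\<close> in the dual problem.\<close>

lemma evqr_verification:
  fixes \<mu> :: "(real^'y) measure" and \<nu> :: "((real^'x) \<times> (real^'y)) measure"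
    and f :: "real^'y \<Rightarrow> real" and g :: "real^'y \<Rightarrow> real^'x" and h :: "(real^'x) \<times> (real^'y) \<Rightarrow> real"
  assumes \<epsilon>: "0 < \<epsilon>"
    and \<mu>: "prob_space \<mu>" "sets \<mu> = sets borel" and \<nu>: "prob_space \<nu>" "sets \<nu> = sets borel"
    and mom_u: "integrable \<mu> (\<lambda>u. (norm u)\<^sup>2)" and mom_z: "integrable \<nu> (\<lambda>z. (norm z)\<^sup>2)"
    and f: "integrable \<mu> f" and h: "integrable \<nu> h"
    and g: "linear g"
    and \<pi>s_def: "\<pi>s = density (\<mu> \<Otimes>\<^sub>M \<nu>) (\<lambda>(u, x, y). ennreal (exp ((f u + g u \<bullet> x + h (x, y) - cost u y) / \<epsilon>)))"
    and \<pi>s: "\<pi>s \<in> couplings \<mu> \<nu>"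
    and \<kappa>: "is_conditional_law \<pi>s \<kappa>"
    and mean: "\<And>u. integrable (\<kappa> u) fst" "\<And>u. (\<integral>z. fst z \<partial>\<kappa> u) = 0"
    and bound: "\<And>u. (\<integral>\<^sup>+z. ennreal (norm (fst z)) \<partial>\<kappa> u) \<le> ennreal C"
  shows "is_optimal_coupling \<epsilon> \<mu> \<nu> \<pi> \<longleftrightarrow> \<pi> = \<pi>s"
    and "are_dual_potentials \<epsilon> \<mu> \<nu> f g h"
proof -
  interpret \<mu>: prob_space \<mu> by fact
  interpret \<nu>: prob_space \<nu> by fact
  interpret pair_prob_space \<mu> \<nu> ..
  define R where "R = \<mu> \<Otimes>\<^sub>M \<nu>"
  interpret R: prob_space R unfolding R_def by unfold_locales
  have R_sets: "sets R = sets borel"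
  proof -
    have "sets R = sets (borel \<Otimes>\<^sub>M borel)" unfolding R_def by (rule sets_pair_measure_cong[OF \<mu>(2) \<nu>(2)])
    then show ?thesis unfolding borel_prod .
  qed
  have [measurable]: "f \<in> borel_measurable borel" "h \<in> borel_measurable borel"
    using borel_measurable_integrable[OF f] borel_measurable_integrable[OF h]
    by (simp_all add: measurable_cong_sets[OF \<mu>(2) refl] measurable_cong_sets[OF \<nu>(2) refl])
  have g_meas[measurable]: "g \<in> borel_measurable borel" using g by (rule borel_measurable_linear)
  define b where "b w = (f (fst w) + g (fst w) \<bullet> fst (snd w) + h (snd w) - cost (fst w) (snd (snd w))) / \<epsilon>"
    for w :: "(real^'y) \<times> (real^'x) \<times> (real^'y)"
  define p where "p w = exp (b w)" for w
  have \<pi>s_eq: "\<pi>s = density R p"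
    unfolding \<pi>s_def R_def p_def b_def
    by (rule arg_cong[where f = "density (\<mu> \<Otimes>\<^sub>M \<nu>)"]) (simp add: fun_eq_iff)
  have cost_meas[measurable]: "(\<lambda>w. cost (fst w) (snd (snd w))) \<in> borel_measurable (borel :: ((real^'y) \<times> (real^'x) \<times> (real^'y)) measure)"
    unfolding cost_def borel_prod[symmetric] by measurable
  have b_meas[measurable]: "b \<in> borel_measurable borel"
  proof -
    have "(\<lambda>w. f (fst w) + g (fst w) \<bullet> fst (snd w) + h (snd w)) \<in>
        borel_measurable (borel :: ((real^'y) \<times> (real^'x) \<times> (real^'y)) measure)"
      by (intro borel_measurable_add borel_measurable_inner borel_measurable_at_fst_snd(1)[of f]
        borel_measurable_at_fst_snd(1)[of g] borel_measurable_at_fst_snd(2)[of h]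
        borel_measurable_at_fst_snd(2)[of fst] borel_measurable_fst_snd) fact+
    then show ?thesis unfolding b_def[abs_def] by measurable
  qed
  then have p_meas[measurable]: "p \<in> borel_measurable borel" unfolding p_def[abs_def] by measurable
  have p_R: "p \<in> borel_measurable R" by (simp add: measurable_cong_sets[OF R_sets refl])
  have p_pos: "0 < p w" for w by (simp add: p_def)
  have ln_p: "ln (p w) = b w" for w by (simp add: p_def)

  have coup_sets: "sets \<pi> = sets borel" if "\<pi> \<in> couplings \<mu> \<nu>" for \<pi>
    using that by (simp add: couplings_def)
  have meas_coup: "F \<in> borel_measurable \<pi>" if "\<pi> \<in> couplings \<mu> \<nu>" "F \<in> borel_measurable borel"
    for \<pi> and F :: "(real^'y) \<times> (real^'x) \<times> (real^'y) \<Rightarrow> real"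
    using that(2) by (simp add: measurable_cong_sets[OF coup_sets[OF that(1)] refl])
  have coup_meas: "fst \<in> borel_measurable \<pi>" "snd \<in> borel_measurable \<pi>" if "\<pi> \<in> couplings \<mu> \<nu>"
    for \<pi> :: "((real^'y) \<times> (real^'x) \<times> (real^'y)) measure"
    by (simp_all add: measurable_cong_sets[OF coup_sets[OF that] refl])
  have coup_distr: "distr \<pi> borel fst = \<mu>" "distr \<pi> borel snd = \<nu>" if "\<pi> \<in> couplings \<mu> \<nu>" for \<pi>
    using that by (auto simp: couplings_def)
  have coup_prob: "prob_space \<pi>" if "\<pi> \<in> couplings \<mu> \<nu>" for \<pi>
    using prob_space_distrD[OF coup_meas(1)[OF that]] coup_distr[OF that] \<mu>(1) by simp
  \<comment> \<open>Integrals of functions of one marginal only do not depend on the coupling.\<close>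
  have int_fst: "integrable \<pi> (\<lambda>w. F (fst w))" "(\<integral>w. F (fst w) \<partial>\<pi>) = (\<integral>u. F u \<partial>\<mu>)"
    if c: "\<pi> \<in> couplings \<mu> \<nu>" and F: "integrable \<mu> F" for \<pi> and F :: "real^'y \<Rightarrow> real"
  proof -
    have "F \<in> borel_measurable borel"
      using borel_measurable_integrable[OF F] by (simp add: measurable_cong_sets[OF \<mu>(2) refl])
    note Fm = this
    show "integrable \<pi> (\<lambda>w. F (fst w))"
      using F integrable_distr_eq[OF coup_meas(1)[OF c] Fm] by (simp only: coup_distr(1)[OF c])
    show "(\<integral>w. F (fst w) \<partial>\<pi>) = (\<integral>u. F u \<partial>\<mu>)"
      using integral_distr[OF coup_meas(1)[OF c] Fm] by (simp only: coup_distr(1)[OF c])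
  qed
  have int_snd: "integrable \<pi> (\<lambda>w. F (snd w))" "(\<integral>w. F (snd w) \<partial>\<pi>) = (\<integral>z. F z \<partial>\<nu>)"
    if c: "\<pi> \<in> couplings \<mu> \<nu>" and F: "integrable \<nu> F" for \<pi> and F :: "(real^'x) \<times> (real^'y) \<Rightarrow> real"
  proof -
    have "F \<in> borel_measurable borel"
      using borel_measurable_integrable[OF F] by (simp add: measurable_cong_sets[OF \<nu>(2) refl])
    note Fm = this
    show "integrable \<pi> (\<lambda>w. F (snd w))"
      using F integrable_distr_eq[OF coup_meas(2)[OF c] Fm] by (simp only: coup_distr(2)[OF c])
    show "(\<integral>w. F (snd w) \<partial>\<pi>) = (\<integral>z. F z \<partial>\<nu>)"
      using integral_distr[OF coup_meas(2)[OF c] Fm] by (simp only: coup_distr(2)[OF c])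
  qed
  obtain L where L: "\<And>u. norm (g u) \<le> norm u * L" and L0: "0 < L"
    using bounded_linear.pos_bounded[OF g[unfolded linear_conv_bounded_linear]] by auto
  have dom: "integrable \<pi> (\<lambda>w. (norm (fst w))\<^sup>2 + (norm (snd w))\<^sup>2)" if "\<pi> \<in> couplings \<mu> \<nu>" for \<pi>
    using int_fst(1)[OF that mom_u] int_snd(1)[OF that mom_z] by simp
  have int_gx: "integrable \<pi> (\<lambda>w. g (fst w) \<bullet> fst (snd w))" if c: "\<pi> \<in> couplings \<mu> \<nu>" for \<pi>
  proof (rule Bochner_Integration.integrable_bound)
    show "integrable \<pi> (\<lambda>w. L * ((norm (fst w))\<^sup>2 + (norm (snd w))\<^sup>2))" using dom[OF c] by simp
    have "(\<lambda>w. g (fst w) \<bullet> fst (snd w)) \<in> borel_measurable (borel :: ((real^'y) \<times> (real^'x) \<times> (real^'y)) measure)"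
      unfolding borel_prod[symmetric] by measurable
    then show "(\<lambda>w. g (fst w) \<bullet> fst (snd w)) \<in> borel_measurable \<pi>" by (rule meas_coup[OF c])
    have "\<bar>g u \<bullet> fst z\<bar> \<le> L * ((norm u)\<^sup>2 + (norm z)\<^sup>2)" for u and z :: "(real^'x) \<times> (real^'y)"
    proof -
      have "\<bar>g u \<bullet> fst z\<bar> \<le> norm (g u) * norm (fst z)" by (rule Cauchy_Schwarz_ineq2)
      also have "\<dots> \<le> (norm u * L) * norm z"
        using L L0 norm_fst_le[of "fst z" "snd z"] by (intro mult_mono) auto
      also have "\<dots> = L * (norm u * norm z)" by simp
      also have "\<dots> \<le> L * ((norm u)\<^sup>2 + (norm z)\<^sup>2)"
      proof (rule mult_left_mono)
        have "0 \<le> norm u * norm z" by simp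
        then show "norm u * norm z \<le> (norm u)\<^sup>2 + (norm z)\<^sup>2"
          using sum_squares_bound[of "norm u" "norm z"] by linarith
      qed (use L0 in simp)
      finally show ?thesis .
    qed
    then show "AE w in \<pi>. norm (g (fst w) \<bullet> fst (snd w)) \<le> norm (L * ((norm (fst w))\<^sup>2 + (norm (snd w))\<^sup>2))"
      by (auto intro!: AE_I2 order_trans[OF _ abs_ge_self])
  qed
  have cost0: "0 \<le> cost u y" for u y :: "real^'y" by (simp add: cost_def)
  have int_cost: "integrable \<pi> (\<lambda>w. cost (fst w) (snd (snd w)))" if c: "\<pi> \<in> couplings \<mu> \<nu>" for \<pi>
  proof (rule Bochner_Integration.integrable_bound[OF dom[OF c]])
    show "(\<lambda>w. cost (fst w) (snd (snd w))) \<in> borel_measurable \<pi>" by (rule meas_coup[OF c cost_meas])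
    have "cost u (snd z) \<le> (norm u)\<^sup>2 + (norm z)\<^sup>2" for u and z :: "(real^'x) \<times> (real^'y)"
    proof -
      have "norm (u - snd z) \<le> norm u + norm z"
        using norm_triangle_ineq4[of u "snd z"] norm_snd_le[of "snd z" "fst z"] by simp
      then have "(norm (u - snd z))\<^sup>2 \<le> (norm u + norm z)\<^sup>2" by (rule power_mono) simp
      also have "\<dots> \<le> 2 * ((norm u)\<^sup>2 + (norm z)\<^sup>2)"
        using sum_squares_bound[of "norm u" "norm z"] by (simp add: power2_sum)
      finally show ?thesis by (simp add: cost_def)
    qed
    then show "AE w in \<pi>. norm (cost (fst w) (snd (snd w))) \<le> norm ((norm (fst w))\<^sup>2 + (norm (snd w))\<^sup>2)"
      by (auto intro!: AE_I2 simp: cost0)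
  qed
  define D0 where "D0 = (\<integral>u. f u \<partial>\<mu>) + (\<integral>z. h z \<partial>\<nu>)"
  have int_b: "integrable \<pi> b" if c: "\<pi> \<in> couplings \<mu> \<nu>" for \<pi>
    unfolding b_def[abs_def]
    using int_fst(1)[OF c f] int_snd(1)[OF c h] int_gx[OF c] int_cost[OF c] by simp
  \<comment> \<open>On the feasible set, the cost plus \<open>\<epsilon>\<close> times the expected log-density is the constant \<open>D0\<close>.\<close>
  have lin_b: "(\<integral>w. cost (fst w) (snd (snd w)) \<partial>\<pi>) + \<epsilon> * (\<integral>w. b w \<partial>\<pi>) = D0"
    if F: "\<pi> \<in> evqr_feasible \<mu> \<nu>" for \<pi>
  proof -
    have c: "\<pi> \<in> couplings \<mu> \<nu>" using F by (simp add: evqr_feasible_def)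
    obtain \<kappa>' where \<kappa>': "is_conditional_law \<pi> \<kappa>'"
      "AE u in \<mu>. integrable (\<kappa>' u) fst \<and> (\<integral>z. fst z \<partial>\<kappa>' u) = 0"
      using F by (auto simp: evqr_feasible_def)
    have "AE u in distr \<pi> borel fst. integrable (\<kappa>' u) fst \<and> (\<integral>z. fst z \<partial>\<kappa>' u) = 0"
      unfolding coup_distr(1)[OF c] by (rule \<kappa>'(2))
    then have "(\<integral>w. g (fst w) \<bullet> fst (snd w) \<partial>\<pi>) = 0"
      by (rule integral_inner_conditional_mean_0[OF \<kappa>'(1) coup_prob[OF c] coup_sets[OF c] _ g_meas int_gx[OF c]])
    moreover have "\<epsilon> * (\<integral>w. b w \<partial>\<pi>) = (\<integral>w. f (fst w) + g (fst w) \<bullet> fst (snd w) + h (snd w) - cost (fst w) (snd (snd w)) \<partial>\<pi>)"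
      using \<epsilon> by (simp add: b_def[abs_def])
    ultimately show ?thesis
      using int_fst[OF c f] int_snd[OF c h] int_gx[OF c] int_cost[OF c] by (simp add: D0_def)
  qed
  have obj: "evqr_objective \<epsilon> \<mu> \<nu> \<pi> = ereal (\<integral>w. cost (fst w) (snd (snd w)) \<partial>\<pi>) + ereal \<epsilon> * KL \<pi> R"
    if c: "\<pi> \<in> couplings \<mu> \<nu>" for \<pi>
  proof -
    have "(\<integral>\<^sup>+w. ennreal (cost (fst w) (snd (snd w))) \<partial>\<pi>) = ennreal (\<integral>w. cost (fst w) (snd (snd w)) \<partial>\<pi>)"
      by (rule nn_integral_eq_integral[OF int_cost[OF c]]) (simp add: cost0)
    moreover have "0 \<le> (\<integral>w. cost (fst w) (snd (snd w)) \<partial>\<pi>)" by (simp add: cost0)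
    ultimately show ?thesis
      by (simp add: evqr_objective_def R_def case_prod_triple enn2ereal_ennreal)
  qed
  have \<pi>s_prob: "prob_space (density R p)" using coup_prob[OF \<pi>s] by (simp add: \<pi>s_eq)
  have feas: "\<pi>s \<in> evqr_feasible \<mu> \<nu>"
    using \<pi>s \<kappa> mean by (auto simp: evqr_feasible_def)
  have opt_value: "evqr_objective \<epsilon> \<mu> \<nu> \<pi>s = ereal D0"
  proof -
    note KLs = KL_divergence_density[OF R.prob_space_axioms p_R p_pos, folded \<pi>s_eq, unfolded ln_p, OF int_b[OF \<pi>s]]
    have "KL \<pi>s R = ereal (\<integral>w. b w \<partial>\<pi>s)"
      using KLs by (simp add: KL_def)
    then show ?thesis using lin_b[OF feas] by (simp add: obj[OF \<pi>s])
  qed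
  have lower: "ereal D0 \<le> evqr_objective \<epsilon> \<mu> \<nu> \<pi> \<and> (evqr_objective \<epsilon> \<mu> \<nu> \<pi> = ereal D0 \<longrightarrow> \<pi> = \<pi>s)"
    if F: "\<pi> \<in> evqr_feasible \<mu> \<nu>" for \<pi>
  proof -
    have c: "\<pi> \<in> couplings \<mu> \<nu>" using F by (simp add: evqr_feasible_def)
    show ?thesis
    proof (cases "absolutely_continuous R \<pi> \<and> integrable \<pi> (entropy_density (exp 1) R \<pi>)")
      case False
      then have "KL \<pi> R = \<infinity>" unfolding KL_def by (rule if_not_P)
      then show ?thesis using \<epsilon> by (simp add: obj[OF c])
    next
      case True
      have s: "sets \<pi> = sets R" using coup_sets[OF c] R_sets by simp
      note gibbs = KL_divergence_ge_log_density[OF R.prob_space_axioms p_R p_pos \<pi>s_prob coup_prob[OF c] s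
          True[THEN conjunct1] True[THEN conjunct2], folded \<pi>s_eq, unfolded ln_p, OF int_b[OF c]]
      have o: "evqr_objective \<epsilon> \<mu> \<nu> \<pi> =
          ereal ((\<integral>w. cost (fst w) (snd (snd w)) \<partial>\<pi>) + \<epsilon> * KL_divergence (exp 1) R \<pi>)"
        using True by (simp add: obj[OF c] KL_def)
      have "\<epsilon> * (\<integral>w. b w \<partial>\<pi>) \<le> \<epsilon> * KL_divergence (exp 1) R \<pi>"
        using gibbs(1) \<epsilon> by (simp add: mult_left_mono)
      moreover have "\<pi> = \<pi>s" if "\<epsilon> * (\<integral>w. b w \<partial>\<pi>) = \<epsilon> * KL_divergence (exp 1) R \<pi>"
        using gibbs(2) \<epsilon> that by simp
      ultimately show ?thesis using lin_b[OF F] unfolding o by auto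
    qed
  qed
  show "is_optimal_coupling \<epsilon> \<mu> \<nu> \<pi> \<longleftrightarrow> \<pi> = \<pi>s"
  proof
    assume "\<pi> = \<pi>s"
    then show "is_optimal_coupling \<epsilon> \<mu> \<nu> \<pi>"
      unfolding is_optimal_coupling_def using feas lower opt_value by metis
  next
    assume opt: "is_optimal_coupling \<epsilon> \<mu> \<nu> \<pi>"
    then have F: "\<pi> \<in> evqr_feasible \<mu> \<nu>" and "evqr_objective \<epsilon> \<mu> \<nu> \<pi> \<le> ereal D0"
      using feas opt_value by (auto simp: is_optimal_coupling_def)
    with lower[OF F] show "\<pi> = \<pi>s" by auto
  qed

  have g_int: "integrable \<mu> g"
  proof (rule \<mu>.integrable_norm_if_square)
    show g\<mu>: "g \<in> borel_measurable \<mu>"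
      using g_meas by (simp only: measurable_cong_sets[OF \<mu>(2) refl])
    show "integrable \<mu> (\<lambda>u. (norm (g u))\<^sup>2)"
    proof (rule Bochner_Integration.integrable_bound)
      show "integrable \<mu> (\<lambda>u. L\<^sup>2 * (norm u)\<^sup>2)" using mom_u by simp
      show "(\<lambda>u. (norm (g u))\<^sup>2) \<in> borel_measurable \<mu>" using g\<mu> by measurable
      have "(norm (g u))\<^sup>2 \<le> L\<^sup>2 * (norm u)\<^sup>2" for u
        using power_mono[OF L[of u], of 2] by (simp add: power_mult_distrib mult.commute)
      then show "AE u in \<mu>. norm ((norm (g u))\<^sup>2) \<le> norm (L\<^sup>2 * (norm u)\<^sup>2)" by simp
    qed
  qed
  have gx_s: "integrable \<pi>s (\<lambda>w. k (fst w) \<bullet> fst (snd w))" "(\<integral>w. k (fst w) \<bullet> fst (snd w) \<partial>\<pi>s) = 0"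
    if k: "integrable \<mu> k" for k :: "real^'y \<Rightarrow> real^'x"
  proof -
    have [measurable]: "k \<in> borel_measurable borel"
      using borel_measurable_integrable[OF k] by (simp add: measurable_cong_sets[OF \<mu>(2) refl])
    have m: "(\<lambda>w. k (fst w) \<bullet> fst (snd w)) \<in> borel_measurable (borel :: ((real^'y) \<times> (real^'x) \<times> (real^'y)) measure)"
      unfolding borel_prod[symmetric] by measurable
    show int: "integrable \<pi>s (\<lambda>w. k (fst w) \<bullet> fst (snd w))"
    proof (rule integrableI_bounded)
      show "(\<lambda>w. k (fst w) \<bullet> fst (snd w)) \<in> borel_measurable \<pi>s" by (rule meas_coup[OF \<pi>s m])
      have s\<kappa>: "sets (\<kappa> u) = sets borel" for u
        using \<kappa> measurable_space[of \<kappa> borel "prob_algebra borel" u]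
        by (simp add: space_prob_algebra is_conditional_law_def)
      have "(\<integral>\<^sup>+w. ennreal (norm (k (fst w) \<bullet> fst (snd w))) \<partial>\<pi>s) =
          (\<integral>\<^sup>+u. \<integral>\<^sup>+z. ennreal (norm (k u \<bullet> fst z)) \<partial>\<kappa> u \<partial>\<mu>)"
        using is_conditional_law_nn_integral[OF \<kappa> coup_prob[OF \<pi>s] coup_sets[OF \<pi>s],
            of "\<lambda>w. ennreal (norm (k (fst w) \<bullet> fst (snd w)))"] m
        by (simp add: coup_distr[OF \<pi>s])
      also have "\<dots> \<le> (\<integral>\<^sup>+u. ennreal (norm (k u)) * ennreal C \<partial>\<mu>)"
      proof (rule nn_integral_mono)
        fix u
        have "(\<integral>\<^sup>+z. ennreal (norm (k u \<bullet> fst z)) \<partial>\<kappa> u) \<le>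
            (\<integral>\<^sup>+z. ennreal (norm (k u)) * ennreal (norm (fst z)) \<partial>\<kappa> u)"
          by (intro nn_integral_mono)
            (simp add: ennreal_mult[symmetric] Cauchy_Schwarz_ineq2 del: ennreal_mult)
        also have "\<dots> = ennreal (norm (k u)) * (\<integral>\<^sup>+z. ennreal (norm (fst z)) \<partial>\<kappa> u)"
          by (rule nn_integral_cmult) (simp add: measurable_cong_sets[OF s\<kappa> refl])
        also have "\<dots> \<le> ennreal (norm (k u)) * ennreal C"
          by (intro mult_left_mono bound) simp
        finally show "(\<integral>\<^sup>+z. ennreal (norm (k u \<bullet> fst z)) \<partial>\<kappa> u) \<le> ennreal (norm (k u)) * ennreal C" .
      qed
      also have "\<dots> = (\<integral>\<^sup>+u. ennreal (norm (k u)) \<partial>\<mu>) * ennreal C"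
        by (rule nn_integral_multc) (simp add: measurable_cong_sets[OF \<mu>(2) refl])
      also have "\<dots> < \<infinity>"
        using k by (simp add: integrable_iff_bounded ennreal_mult_less_top)
      finally show "(\<integral>\<^sup>+w. ennreal (norm (k (fst w) \<bullet> fst (snd w))) \<partial>\<pi>s) < \<infinity>" .
    qed
    show "(\<integral>w. k (fst w) \<bullet> fst (snd w) \<partial>\<pi>s) = 0"
      by (rule integral_inner_conditional_mean_0[OF \<kappa> coup_prob[OF \<pi>s] coup_sets[OF \<pi>s] _ _ int])
        (auto simp: mean)
  qed
  have dual_value: "dual_objective \<epsilon> \<mu> \<nu> f g h = ereal D0"
  proof -
    have "(\<integral>\<^sup>+(u, x, y). ennreal (exp ((1 / \<epsilon>) * (f u + g u \<bullet> x + h (x, y) - cost u y))) \<partial>(\<mu> \<Otimes>\<^sub>M \<nu>)) =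
        emeasure \<pi>s (space \<pi>s)"
    proof -
      have "emeasure \<pi>s (space \<pi>s) = (\<integral>\<^sup>+w. ennreal (p w) * indicator (space R) w \<partial>R)"
        unfolding \<pi>s_eq by (subst emeasure_density) (use p_R in auto)
      also have "\<dots> = (\<integral>\<^sup>+w. ennreal (p w) \<partial>R)" by (rule nn_integral_cong) simp
      finally show ?thesis by (simp add: R_def p_def b_def case_prod_triple)
    qed
    also have "\<dots> = 1" using prob_space.emeasure_space_1[OF coup_prob[OF \<pi>s]] .
    finally show ?thesis by (simp add: dual_objective_def D0_def one_ennreal.rep_eq one_ereal_def)
  qed
  \<comment> \<open>Weak duality, from \<open>e\<^sup>a \<ge> e\<^sup>b (1 + a - b)\<close> integrated against \<open>\<mu> \<otimes> \<nu>\<close>; the costs in \<open>a\<close> and \<open>b\<close>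
    cancel.\<close>
  have dual_le: "dual_objective \<epsilon> \<mu> \<nu> f' g' h' \<le> ereal D0"
    if adm: "integrable \<mu> f'" "integrable \<mu> g'" "integrable \<nu> h'" for f' g' h'
  proof -
    have m[measurable]: "f' \<in> borel_measurable borel" "g' \<in> borel_measurable borel" "h' \<in> borel_measurable borel"
      using adm[THEN borel_measurable_integrable]
      by (simp_all add: measurable_cong_sets[OF \<mu>(2) refl] measurable_cong_sets[OF \<nu>(2) refl])
    define a where "a w = (1 / \<epsilon>) * (f' (fst w) + g' (fst w) \<bullet> fst (snd w) + h' (snd w) - cost (fst w) (snd (snd w)))"
      for w :: "(real^'y) \<times> (real^'x) \<times> (real^'y)"
    have a_meas[measurable]: "a \<in> borel_measurable borel"
    proof -
      have "(\<lambda>w. f' (fst w) + g' (fst w) \<bullet> fst (snd w) + h' (snd w)) \<in>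
          borel_measurable (borel :: ((real^'y) \<times> (real^'x) \<times> (real^'y)) measure)"
        by (intro borel_measurable_add borel_measurable_inner borel_measurable_at_fst_snd(1)[of f']
          borel_measurable_at_fst_snd(1)[of g'] borel_measurable_at_fst_snd(2)[of h']
          borel_measurable_at_fst_snd(2)[of fst] borel_measurable_fst_snd) fact+
      then show ?thesis unfolding a_def[abs_def] by measurable
    qed
    define I where "I = (\<integral>\<^sup>+w. ennreal (exp (a w)) \<partial>R)"
    have dual: "dual_objective \<epsilon> \<mu> \<nu> f' g' h' =
        ereal (\<integral>u. f' u \<partial>\<mu>) + ereal (\<integral>z. h' z \<partial>\<nu>) - ereal \<epsilon> * enn2ereal I + ereal \<epsilon>"
      by (simp add: dual_objective_def I_def a_def R_def case_prod_triple)
    show ?thesis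
    proof (cases "I = \<infinity>")
      case True
      then show ?thesis unfolding dual using \<epsilon> by simp
    next
      case False
      have expm: "(\<lambda>w. exp (a w)) \<in> borel_measurable R" by (simp add: measurable_cong_sets[OF R_sets refl])
      have intE: "integrable R (\<lambda>w. exp (a w))"
        by (rule integrableI_nonneg) (use expm False in \<open>auto simp: I_def less_top\<close>)
      then have I: "I = ennreal (\<integral>w. exp (a w) \<partial>R)"
        unfolding I_def by (rule nn_integral_eq_integral) simp
      have ab: "a w - b w = (1 / \<epsilon>) * ((f' (fst w) - f (fst w)) + (g' (fst w) - g (fst w)) \<bullet> fst (snd w)
          + (h' (snd w) - h (snd w)))" for w
        by (simp add: a_def b_def inner_diff_left diff_divide_distrib add_divide_distrib)
      have fd: "integrable \<mu> (\<lambda>u. f' u - f u)" "integrable \<nu> (\<lambda>z. h' z - h z)" "integrable \<mu> (\<lambda>u. g' u - g u)"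
        using adm f h g_int by auto
      note parts = int_fst[OF \<pi>s fd(1)] int_snd[OF \<pi>s fd(2)] gx_s[OF fd(3)]
      have int_ab: "integrable \<pi>s (\<lambda>w. a w - b w)" unfolding ab using parts by simp
      have "\<epsilon> * (\<integral>w. a w - b w \<partial>\<pi>s) = (\<integral>u. f' u \<partial>\<mu>) + (\<integral>z. h' z \<partial>\<nu>) - D0"
        unfolding ab using parts \<epsilon> adm f h by (simp add: D0_def)
      moreover have "1 + (\<integral>w. a w - b w \<partial>\<pi>s) \<le> (\<integral>w. exp (a w) \<partial>R)"
      proof -
        interpret PS: prob_space \<pi>s by (rule coup_prob[OF \<pi>s])
        have i1: "integrable \<pi>s (\<lambda>w. 1 + (a w - b w))" using int_ab by simp
        have abm: "(\<lambda>w. 1 + (a w - b w)) \<in> borel_measurable R"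
          by (simp add: measurable_cong_sets[OF R_sets refl])
        have "1 + (\<integral>w. a w - b w \<partial>\<pi>s) = (\<integral>w. 1 + (a w - b w) \<partial>\<pi>s)"
          using int_ab by (simp add: PS.prob_space)
        also have "\<dots> = (\<integral>w. p w * (1 + (a w - b w)) \<partial>R)"
          unfolding \<pi>s_eq by (rule integral_real_density) (use p_R abm p_pos in \<open>auto simp: less_imp_le\<close>)
        also have "\<dots> \<le> (\<integral>w. exp (a w) \<partial>R)"
        proof (rule integral_mono[OF _ intE])
          show "integrable R (\<lambda>w. p w * (1 + (a w - b w)))"
            using i1 unfolding \<pi>s_eq
            by (subst (asm) integrable_real_density) (use p_R abm p_pos in \<open>auto simp: less_imp_le\<close>)
          show "p w * (1 + (a w - b w)) \<le> exp (a w)" for w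
          proof -
            have "p w * (1 + (a w - b w)) \<le> p w * exp (a w - b w)"
              by (intro mult_left_mono exp_ge_add_one_self less_imp_le p_pos)
            also have "\<dots> = exp (a w)" by (simp add: p_def exp_add[symmetric])
            finally show ?thesis .
          qed
        qed
        finally show ?thesis .
      qed
      ultimately have "(\<integral>u. f' u \<partial>\<mu>) + (\<integral>z. h' z \<partial>\<nu>) - \<epsilon> * (\<integral>w. exp (a w) \<partial>R) + \<epsilon> \<le> D0"
        using mult_left_mono[of "1 + (\<integral>w. a w - b w \<partial>\<pi>s)" "\<integral>w. exp (a w) \<partial>R" \<epsilon>] \<epsilon>
        by (simp add: algebra_simps)
      then show ?thesis unfolding dual I by (simp add: enn2ereal_ennreal)
    qed
  qed
  show "are_dual_potentials \<epsilon> \<mu> \<nu> f g h"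
    unfolding are_dual_potentials_def
  proof
    show adm: "(f, g, h) \<in> dual_admissible \<mu> \<nu>"
      using f h g_int by (simp add: dual_admissible_def)
    have "(SUP (f', g', h')\<in>dual_admissible \<mu> \<nu>. dual_objective \<epsilon> \<mu> \<nu> f' g' h') = ereal D0"
    proof (rule antisym)
      show "(SUP (f', g', h')\<in>dual_admissible \<mu> \<nu>. dual_objective \<epsilon> \<mu> \<nu> f' g' h') \<le> ereal D0"
        by (rule SUP_least) (auto simp: dual_admissible_def dual_le)
      show "ereal D0 \<le> (SUP (f', g', h')\<in>dual_admissible \<mu> \<nu>. dual_objective \<epsilon> \<mu> \<nu> f' g' h')"
        using SUP_upper[OF adm, of "\<lambda>(f', g', h'). dual_objective \<epsilon> \<mu> \<nu> f' g' h'"]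
        by (simp add: dual_value)
    qed
    then show "dual_objective \<epsilon> \<mu> \<nu> f g h =
       (SUP (f', g', h')\<in>dual_admissible \<mu> \<nu>. dual_objective \<epsilon> \<mu> \<nu> f' g' h')"
      by (simp add: dual_value)
  qed
qed

section \<open>Exponential tilting of a Gaussian\<close>

text \<open>The quadratic terms match because \<open>(\<epsilon> \<Lambda>)\<inverse> = S\<inverse> + \<epsilon>\<inverse> \<Lambda> S\<inverse>\<close>, which is the equation for \<open>\<Lambda>\<close>
  multiplied by inverses. The normalising constants match because \<open>det (\<epsilon> \<Lambda> S\<inverse>) = det (\<epsilon> \<Lambda>) / det S\<close>.\<close>

lemma mvn_tilt:
  fixes S \<Lambda> :: "real^'n^'n"
  assumes \<epsilon>: "0 < \<epsilon>" and S: "pos_def S" and \<Lambda>: "pos_def \<Lambda>" and eq: "\<Lambda> ** \<Lambda> + \<epsilon> *\<^sub>R \<Lambda> = S"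
  shows "mvn (\<Lambda> *v u) (\<epsilon> *\<^sub>R \<Lambda>) = density (mvn 0 S) (\<lambda>w. ennreal (exp
    ((- (1 / 2) * (u \<bullet> (\<Lambda> *v u)) + u \<bullet> w - (1 / 2) * (w \<bullet> ((\<Lambda> ** matrix_inv S) *v w))
       - \<epsilon> / 2 * ln (det (\<epsilon> *\<^sub>R (\<Lambda> ** matrix_inv S)))) / \<epsilon>)))"
proof -
  have K: "pos_def (\<epsilon> *\<^sub>R \<Lambda>)" using pos_def_scaleR[OF \<Lambda> \<epsilon>] .
  define i where "i = matrix_inv (\<epsilon> *\<^sub>R \<Lambda>)"
  define \<Omega> where "\<Omega> = matrix_inv S"
  note invK = matrix_inv_mult_vector[OF pos_def_invertible[OF K], folded i_def]
  note invS = matrix_inv_mult_vector[OF pos_def_invertible[OF S], folded \<Omega>_def]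
  have scale: "(\<epsilon> *\<^sub>R \<Lambda>) *v x = \<epsilon> *\<^sub>R (\<Lambda> *v x)" for x
    by (simp add: scaleR_matrix_vector_assoc)
  have sym: "x \<bullet> (\<Lambda> *v y) = (\<Lambda> *v x) \<bullet> y" for x y
    using \<Lambda> by (intro symmetric_matrix_inner) (simp add: pos_def_def)
  have i\<Lambda>: "i *v (\<Lambda> *v x) = (1 / \<epsilon>) *\<^sub>R x" for x
  proof -
    have "i *v (\<Lambda> *v x) = (1 / \<epsilon>) *\<^sub>R (i *v ((\<epsilon> *\<^sub>R \<Lambda>) *v x))"
      using \<epsilon> by (simp add: scale matrix_vector_mult_scaleR)
    then show ?thesis by (simp add: invK)
  qed
  have \<Lambda>i: "\<Lambda> *v (i *v x) = (1 / \<epsilon>) *\<^sub>R x" for x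
  proof -
    have "(1 / \<epsilon>) *\<^sub>R x = (1 / \<epsilon>) *\<^sub>R (\<epsilon> *\<^sub>R (\<Lambda> *v (i *v x)))"
      using invK(1)[of x] by (simp only: scale)
    then show ?thesis using \<epsilon> by simp
  qed
  have iw: "i *v w = \<Omega> *v w + (1 / \<epsilon>) *\<^sub>R (\<Lambda> *v (\<Omega> *v w))" for w
  proof -
    have "w = S *v (\<Omega> *v w)" by (simp add: invS)
    also have "\<dots> = \<Lambda> *v (\<Lambda> *v (\<Omega> *v w)) + \<epsilon> *\<^sub>R (\<Lambda> *v (\<Omega> *v w))"
      by (simp only: eq[symmetric] matrix_vector_mult_add_rdistrib matrix_vector_mul_assoc[symmetric]
          scaleR_matrix_vector_assoc[symmetric])
    finally have "i *v w = i *v (\<Lambda> *v (\<Lambda> *v (\<Omega> *v w)) + \<epsilon> *\<^sub>R (\<Lambda> *v (\<Omega> *v w)))" by (rule arg_cong)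
    then show ?thesis
      using \<epsilon> by (simp add: matrix_vector_right_distrib matrix_vector_mult_scaleR i\<Lambda> add.commute)
  qed
  have quad: "(w - \<Lambda> *v u) \<bullet> (i *v (w - \<Lambda> *v u)) =
      w \<bullet> (\<Omega> *v w) + (1 / \<epsilon>) * (w \<bullet> ((\<Lambda> ** \<Omega>) *v w) - 2 * (u \<bullet> w) + u \<bullet> (\<Lambda> *v u))" for w
  proof -
    have "(w - \<Lambda> *v u) \<bullet> (i *v (w - \<Lambda> *v u)) =
        w \<bullet> (i *v w) - (1 / \<epsilon>) * (u \<bullet> w) - u \<bullet> (\<Lambda> *v (i *v w)) + (1 / \<epsilon>) * (u \<bullet> (\<Lambda> *v u))"
    proof -
      have "i *v (w - \<Lambda> *v u) = i *v w - (1 / \<epsilon>) *\<^sub>R u"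
        by (simp add: matrix_vector_mult_diff_distrib i\<Lambda>)
      moreover have "(w - a) \<bullet> (x - (1 / \<epsilon>) *\<^sub>R u) = w \<bullet> x - (1 / \<epsilon>) * (u \<bullet> w) - a \<bullet> x + (1 / \<epsilon>) * (u \<bullet> a)"
        for a x
        by (simp add: inner_diff_left inner_diff_right inner_commute diff_divide_distrib)
      ultimately show ?thesis by (simp only: sym)
    qed
    moreover have "u \<bullet> (\<Lambda> *v (i *v w)) = (1 / \<epsilon>) * (u \<bullet> w)"
      by (simp add: \<Lambda>i)
    moreover have "w \<bullet> (i *v w) = w \<bullet> (\<Omega> *v w) + (1 / \<epsilon>) * (w \<bullet> ((\<Lambda> ** \<Omega>) *v w))"
      by (simp add: iw inner_add_right matrix_vector_mul_assoc)
    ultimately show ?thesis by (simp add: diff_divide_distrib add_divide_distrib)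
  qed
  define d1 d2 where "d1 = det (\<epsilon> *\<^sub>R \<Lambda>)" and "d2 = det S"
  have d: "0 < d1" "0 < d2" using pos_def_det_pos K S by (auto simp: d1_def d2_def)
  have "det S * det \<Omega> = 1"
    using matrix_inv_mult(1)[OF pos_def_invertible[OF S]] by (metis \<Omega>_def det_I det_mul)
  then have d\<Omega>: "det (\<epsilon> *\<^sub>R (\<Lambda> ** \<Omega>)) = d1 / d2"
  proof -
    have "\<epsilon> *\<^sub>R (\<Lambda> ** \<Omega>) = (\<epsilon> *\<^sub>R \<Lambda>) ** \<Omega>"
      by (simp add: matrix_eq matrix_vector_mul_assoc[symmetric] scaleR_matrix_vector_assoc[symmetric])
    then have "det (\<epsilon> *\<^sub>R (\<Lambda> ** \<Omega>)) = d1 * det \<Omega>" by (simp add: det_mul d1_def)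
    also have "det \<Omega> = 1 / d2" using \<open>det S * det \<Omega> = 1\<close> d by (simp add: d2_def field_simps)
    finally show ?thesis by simp
  qed
  have e: "exp (- (ln (d1 / d2) / 2)) = sqrt d2 / sqrt d1"
    using d by (simp add: ln_sqrt[symmetric] exp_minus real_sqrt_divide)
  have key: "mvn_density (\<Lambda> *v u) (\<epsilon> *\<^sub>R \<Lambda>) w = mvn_density 0 S w * exp
    ((- (1 / 2) * (u \<bullet> (\<Lambda> *v u)) + u \<bullet> w - (1 / 2) * (w \<bullet> ((\<Lambda> ** \<Omega>) *v w))
       - \<epsilon> / 2 * ln (det (\<epsilon> *\<^sub>R (\<Lambda> ** \<Omega>)))) / \<epsilon>)" for w
  proof -
    have "(- (1 / 2) * (u \<bullet> (\<Lambda> *v u)) + u \<bullet> w - (1 / 2) * (w \<bullet> ((\<Lambda> ** \<Omega>) *v w))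
       - \<epsilon> / 2 * ln (det (\<epsilon> *\<^sub>R (\<Lambda> ** \<Omega>)))) / \<epsilon> =
       - ((w - \<Lambda> *v u) \<bullet> (i *v (w - \<Lambda> *v u))) / 2 + (w \<bullet> (\<Omega> *v w)) / 2 + - (ln (d1 / d2) / 2)"
      unfolding quad d\<Omega> using \<epsilon> by (simp add: field_simps)
    then have "exp ((- (1 / 2) * (u \<bullet> (\<Lambda> *v u)) + u \<bullet> w - (1 / 2) * (w \<bullet> ((\<Lambda> ** \<Omega>) *v w))
       - \<epsilon> / 2 * ln (det (\<epsilon> *\<^sub>R (\<Lambda> ** \<Omega>)))) / \<epsilon>) =
       exp (- ((w - \<Lambda> *v u) \<bullet> (i *v (w - \<Lambda> *v u))) / 2) * exp ((w \<bullet> (\<Omega> *v w)) / 2) * (sqrt d2 / sqrt d1)"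
      by (simp only: exp_add e)
    moreover have "exp (- (w \<bullet> (\<Omega> *v w)) / 2) * exp ((w \<bullet> (\<Omega> *v w)) / 2) = 1"
      by (simp add: exp_add[symmetric])
    moreover have "E1 / sqrt (T * d1) = E3 / sqrt (T * d2) * (E1 * E2 * (sqrt d2 / sqrt d1))"
      if "E3 * E2 = 1" for E1 E2 E3 T :: real
    proof -
      have "E3 / sqrt (T * d2) * (E1 * E2 * (sqrt d2 / sqrt d1)) = (E3 * E2) * (E1 / sqrt (T * d1))"
        using d by (simp add: real_sqrt_mult)
      then show ?thesis using that by simp
    qed
    ultimately show ?thesis
      unfolding mvn_density_def i_def[symmetric] \<Omega>_def[symmetric] d1_def[symmetric] d2_def[symmetric] diff_zero
      by metis
  qed
  have nn: "0 \<le> mvn_density 0 S w" for w using mvn_density_pos[OF S] by (rule less_imp_le)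
  show ?thesis
    unfolding mvn_def \<Omega>_def[symmetric]
    by (subst density_density_eq) (auto simp: key ennreal_mult nn)
qed

lemma integrable_quadratic_form:
  fixes W :: "'a \<Rightarrow> real^'n"
  assumes [measurable]: "W \<in> borel_measurable M" and int: "integrable M (\<lambda>z. (norm (W z))\<^sup>2)"
  shows "integrable M (\<lambda>z. W z \<bullet> (A *v W z))"
proof -
  obtain K where K: "\<And>x. norm (A *v x) \<le> norm x * K"
    using bounded_linear.bounded[OF matrix_vector_mul_bounded_linear[of A]] by auto
  have dom: "integrable M (\<lambda>z. K * (norm (W z))\<^sup>2)" using int by simp
  have "\<bar>x \<bullet> (A *v x)\<bar> \<le> K * (norm x)\<^sup>2" for x
  proof -
    have "\<bar>x \<bullet> (A *v x)\<bar> \<le> norm x * norm (A *v x)" by (rule Cauchy_Schwarz_ineq2)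
    also have "\<dots> \<le> norm x * (norm x * K)" by (intro mult_left_mono K) simp
    finally show ?thesis by (simp add: power2_eq_square mult_ac)
  qed
  then have "AE z in M. norm (W z \<bullet> (A *v W z)) \<le> norm (K * (norm (W z))\<^sup>2)"
    by (auto intro!: AE_I2 order_trans[OF _ abs_ge_self])
  moreover have "(\<lambda>z. W z \<bullet> (A *v W z)) \<in> borel_measurable M" by measurable
  ultimately show ?thesis using Bochner_Integration.integrable_bound[OF dom] by blast
qed

section \<open>Product measures and kernels with densities\<close>

lemma distr_pair_fst:
  assumes "prob_space N" "sigma_finite_measure M" shows "distr (M \<Otimes>\<^sub>M N) M fst = M"
proof (rule measure_eqI)
  interpret N: prob_space N by fact
  fix A assume A: "A \<in> sets (distr (M \<Otimes>\<^sub>M N) M fst)"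
  then have "emeasure (distr (M \<Otimes>\<^sub>M N) M fst) A = emeasure (M \<Otimes>\<^sub>M N) (fst -` A \<inter> space (M \<Otimes>\<^sub>M N))"
    by (auto simp: emeasure_distr)
  also have "fst -` A \<inter> space (M \<Otimes>\<^sub>M N) = A \<times> space N"
    using A sets.sets_into_space[of A M] by (auto simp: space_pair_measure)
  also have "emeasure (M \<Otimes>\<^sub>M N) \<dots> = emeasure M A"
    using A by (simp add: N.emeasure_pair_measure_Times N.emeasure_space_1)
  finally show "emeasure (distr (M \<Otimes>\<^sub>M N) M fst) A = emeasure M A" .
qed simp

lemma distr_pair_snd:
  assumes "prob_space M" "sigma_finite_measure N" shows "distr (M \<Otimes>\<^sub>M N) N snd = N"
proof (rule measure_eqI)
  interpret M: prob_space M by fact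
  interpret N: sigma_finite_measure N by fact
  fix A assume A: "A \<in> sets (distr (M \<Otimes>\<^sub>M N) N snd)"
  then have "emeasure (distr (M \<Otimes>\<^sub>M N) N snd) A = emeasure (M \<Otimes>\<^sub>M N) (snd -` A \<inter> space (M \<Otimes>\<^sub>M N))"
    by (auto simp: emeasure_distr)
  also have "snd -` A \<inter> space (M \<Otimes>\<^sub>M N) = space M \<times> A"
    using A sets.sets_into_space[of A N] by (auto simp: space_pair_measure)
  also have "emeasure (M \<Otimes>\<^sub>M N) \<dots> = emeasure N A"
    using A by (simp add: N.emeasure_pair_measure_Times M.emeasure_space_1)
  finally show "emeasure (distr (M \<Otimes>\<^sub>M N) N snd) A = emeasure N A" .
qed simp

text \<open>The pair of \<open>u \<sim> \<mu>\<close> and \<open>F u t\<close>, with independent noise \<open>t \<sim> N\<close>, has the laws of \<open>F u t\<close> as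
  conditional laws. If these have densities with respect to one measure \<open>\<nu>\<close>, the joint law has the
  same density with respect to \<open>\<mu> \<otimes> \<nu>\<close>.\<close>

lemma pair_distr_eq_density:
  fixes F :: "'a::second_countable_topology \<Rightarrow> 't \<Rightarrow> 'b::second_countable_topology"
  assumes \<mu>: "prob_space \<mu>" "sets \<mu> = sets borel" and N: "prob_space N" and \<nu>: "prob_space \<nu>" "sets \<nu> = sets borel"
    and F[measurable]: "(\<lambda>(u, t). F u t) \<in> borel \<Otimes>\<^sub>M N \<rightarrow>\<^sub>M borel"
    and P[measurable]: "P \<in> borel_measurable (borel \<Otimes>\<^sub>M borel)"
    and \<kappa>: "\<And>u. distr N borel (F u) = density \<nu> (\<lambda>z. P (u, z))"
  shows "distr (\<mu> \<Otimes>\<^sub>M N) borel (\<lambda>(u, t). (u, F u t)) = density (\<mu> \<Otimes>\<^sub>M \<nu>) P"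
    and "is_conditional_law (distr (\<mu> \<Otimes>\<^sub>M N) borel (\<lambda>(u, t). (u, F u t))) (\<lambda>u. distr N borel (F u))"
    and "distr (distr (\<mu> \<Otimes>\<^sub>M N) borel (\<lambda>(u, t). (u, F u t))) borel fst = \<mu>"
proof -
  interpret \<mu>: prob_space \<mu> by fact
  interpret N: prob_space N by fact
  interpret \<nu>: prob_space \<nu> by fact
  note [measurable_cong] = \<mu>(2) \<nu>(2)
  let ?\<pi> = "distr (\<mu> \<Otimes>\<^sub>M N) borel (\<lambda>(u, t). (u, F u t))"
  have G: "(\<lambda>(u, t). (u, F u t)) \<in> \<mu> \<Otimes>\<^sub>M N \<rightarrow>\<^sub>M borel"
    unfolding borel_prod[symmetric] by measurable
  have em: "emeasure ?\<pi> A = (\<integral>\<^sup>+u. \<integral>\<^sup>+z. indicator A (u, z) \<partial>distr N borel (F u) \<partial>\<mu>)"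
    if A: "A \<in> sets borel" for A
  proof -
    have [measurable]: "A \<in> sets (borel \<Otimes>\<^sub>M borel)" using A unfolding borel_prod .
    have "emeasure ?\<pi> A = (\<integral>\<^sup>+w. indicator A w \<partial>?\<pi>)" using A by simp
    also have "\<dots> = (\<integral>\<^sup>+w. indicator A (fst w, F (fst w) (snd w)) \<partial>(\<mu> \<Otimes>\<^sub>M N))"
      by (subst nn_integral_distr[OF G]) (use A in \<open>auto simp: case_prod_beta\<close>)
    also have "\<dots> = (\<integral>\<^sup>+u. \<integral>\<^sup>+t. indicator A (u, F u t) \<partial>N \<partial>\<mu>)"
      by (subst N.nn_integral_fst[symmetric]) auto
    also have "\<dots> = (\<integral>\<^sup>+u. \<integral>\<^sup>+z. indicator A (u, z) \<partial>distr N borel (F u) \<partial>\<mu>)"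
      by (intro nn_integral_cong, subst nn_integral_distr) auto
    finally show ?thesis .
  qed
  show fst: "distr ?\<pi> borel fst = \<mu>"
  proof -
    have "distr ?\<pi> borel fst = distr (\<mu> \<Otimes>\<^sub>M N) \<mu> fst"
      by (subst distr_distr[OF borel_measurable_fst_snd(1) G]) (auto intro!: distr_cong simp: \<mu>(2))
    then show ?thesis by (simp add: distr_pair_fst N.prob_space_axioms \<mu>.sigma_finite_measure_axioms)
  qed
  show "?\<pi> = density (\<mu> \<Otimes>\<^sub>M \<nu>) P"
  proof (rule measure_eqI)
    have "sets (\<mu> \<Otimes>\<^sub>M \<nu>) = sets (borel \<Otimes>\<^sub>M borel)" by (rule sets_pair_measure_cong[OF \<mu>(2) \<nu>(2)])
    then show "sets ?\<pi> = sets (density (\<mu> \<Otimes>\<^sub>M \<nu>) P)" unfolding borel_prod by simp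
    fix A assume "A \<in> sets ?\<pi>"
    then have A: "A \<in> sets borel" by simp
    then have [measurable]: "A \<in> sets (borel \<Otimes>\<^sub>M borel)" unfolding borel_prod .
    have "emeasure (density (\<mu> \<Otimes>\<^sub>M \<nu>) P) A = (\<integral>\<^sup>+w. P w * indicator A w \<partial>(\<mu> \<Otimes>\<^sub>M \<nu>))"
      by (rule emeasure_density) measurable
    also have "\<dots> = (\<integral>\<^sup>+u. \<integral>\<^sup>+z. P (u, z) * indicator A (u, z) \<partial>\<nu> \<partial>\<mu>)"
      by (subst \<nu>.nn_integral_fst[symmetric]) auto
    also have "\<dots> = (\<integral>\<^sup>+u. \<integral>\<^sup>+z. indicator A (u, z) \<partial>distr N borel (F u) \<partial>\<mu>)"
      unfolding \<kappa> by (intro nn_integral_cong, subst nn_integral_density) auto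
    also have "\<dots> = emeasure ?\<pi> A" by (rule em[OF A, symmetric])
    finally show "emeasure ?\<pi> A = emeasure (density (\<mu> \<Otimes>\<^sub>M \<nu>) P) A" ..
  qed
  show "is_conditional_law ?\<pi> (\<lambda>u. distr N borel (F u))"
    unfolding is_conditional_law_def fst
  proof (intro conjI ballI)
    show "(\<lambda>u. distr N borel (F u)) \<in> borel \<rightarrow>\<^sub>M prob_algebra borel"
      by (rule measurable_distr_prob_space2[where M = N])
        (auto simp: space_prob_algebra N.prob_space_axioms)
    fix A :: "'a set" and B :: "'b set" assume AB[measurable]: "A \<in> sets borel" "B \<in> sets borel"
    have "A \<times> B \<in> sets (borel \<Otimes>\<^sub>M borel)" by simp
    then have "A \<times> B \<in> sets borel" unfolding borel_prod .
    then have "emeasure ?\<pi> (A \<times> B) = (\<integral>\<^sup>+u. \<integral>\<^sup>+z. indicator (A \<times> B) (u, z) \<partial>distr N borel (F u) \<partial>\<mu>)"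
      by (rule em)
    also have "\<dots> = (\<integral>\<^sup>+u\<in>A. emeasure (distr N borel (F u)) B \<partial>\<mu>)"
    proof (rule nn_integral_cong)
      fix u
      have "(\<integral>\<^sup>+z. indicator (A \<times> B) (u, z) \<partial>distr N borel (F u)) =
          (\<integral>\<^sup>+z. indicator A u * indicator B z \<partial>distr N borel (F u))"
        by (simp add: indicator_times)
      also have "\<dots> = indicator A u * emeasure (distr N borel (F u)) B"
        by (subst nn_integral_cmult) auto
      finally show "(\<integral>\<^sup>+z. indicator (A \<times> B) (u, z) \<partial>distr N borel (F u)) =
          emeasure (distr N borel (F u)) B * indicator A u" by (simp add: mult.commute)
    qed
    finally show "emeasure ?\<pi> (A \<times> B) = (\<integral>\<^sup>+u\<in>A. emeasure (distr N borel (F u)) B \<partial>\<mu>)" .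
  qed
qed

lemma mvn_pair_translate:
  fixes A :: "real^'a^'a" and K :: "real^'b^'b"
  assumes A: "pos_def A" and K: "pos_def K"
  shows "mvn a A \<Otimes>\<^sub>M mvn b K = distr (mvn a A \<Otimes>\<^sub>M mvn 0 K) (borel \<Otimes>\<^sub>M borel) (\<lambda>(x, t). (x, b + t))"
proof -
  have *: "distr (mvn 0 K) borel ((+) b) = mvn b K" using mvn_translate[OF K, of b 0] by simp
  have "distr (mvn a A) borel (\<lambda>x. x) \<Otimes>\<^sub>M distr (mvn 0 K) borel ((+) b) =
      distr (mvn a A \<Otimes>\<^sub>M mvn 0 K) (borel \<Otimes>\<^sub>M borel) (\<lambda>(x, t). (x, b + t))"
    by (intro pair_measure_distr)
      (auto simp: * intro: prob_space_imp_sigma_finite prob_space_mvn[OF K])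
  then show ?thesis by (simp add: * distr_id2)
qed

lemma pair_density_snd:
  assumes "prob_space M" "prob_space N" and [measurable]: "q \<in> borel_measurable N"
    and "prob_space (density N q)"
  shows "M \<Otimes>\<^sub>M density N q = density (M \<Otimes>\<^sub>M N) (\<lambda>(x, w). q w)"
proof -
  interpret N: prob_space N by fact
  have "density M (\<lambda>_. 1) \<Otimes>\<^sub>M density N q = density (M \<Otimes>\<^sub>M N) (\<lambda>(x, w). 1 * q w)"
    by (rule pair_measure_density)
      (use assms in \<open>auto intro: prob_space_imp_sigma_finite\<close>)
  then show ?thesis by (simp add: density_1)
qed

section \<open>The Gaussian entropic vector quantile regression problem\<close>

theorem theorem3p1:
  fixes \<epsilon> :: real
    and \<mu> :: "(real^'y) measure"
    and \<nu> :: "((real^'x) \<times> (real^'y)) measure"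
    and m\<^sub>Y :: "real^'y"
    and \<Sigma>XX :: "real^'x^'x" and \<Sigma>XY :: "real^'y^'x"
    and \<Sigma>YX :: "real^'x^'y" and \<Sigma>YY :: "real^'y^'y"
    and \<Sigma> :: "real^('x + 'y)^('x + 'y)"
    and \<Lambda> \<Omega>YY \<Psi> :: "real^'y^'y" and G :: "real^'y^'x"
    and m :: "real^('y + ('x + 'y))"
    and \<Gamma> :: "real^('y + ('x + 'y))^('y + ('x + 'y))"
  assumes "0 < \<epsilon>"
    and "\<mu> = mvn 0 (mat 1)"
    and "\<Sigma> = block2 \<Sigma>XX \<Sigma>XY
                   \<Sigma>YX \<Sigma>YY"
    and "pos_semidef \<Sigma>" and "invertible \<Sigma>"
    and "\<nu> = distr (mvn (vjoin 0 m\<^sub>Y) \<Sigma>) borel vsplit"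
    and "m\<^sub>Y = (\<integral>z. snd z \<partial>\<nu>)"
    and "\<Lambda> = psd_sqrt (\<Sigma>YY - \<Sigma>YX ** matrix_inv \<Sigma>XX ** \<Sigma>XY + (\<epsilon>\<^sup>2 / 4) *\<^sub>R mat 1)
             - (\<epsilon> / 2) *\<^sub>R mat 1"
    and "m = vjoin 0 (vjoin 0 m\<^sub>Y)"
    and "\<Gamma> = block3 (mat 1) 0   \<Lambda>
                    0       \<Sigma>XX \<Sigma>XY
                    \<Lambda>       \<Sigma>YX \<Sigma>YY"
    and "G = - (matrix_inv \<Sigma>XX ** \<Sigma>XY)"
    and "\<Omega>YY = matrix_inv (\<Sigma>YY - \<Sigma>YX ** matrix_inv \<Sigma>XX ** \<Sigma>XY)"
    and "\<Psi> = \<Lambda> ** \<Omega>YY"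
  shows "pos_def \<Lambda> \<and> pos_def \<Gamma> \<and>
         (\<forall>\<pi>. is_optimal_coupling \<epsilon> \<mu> \<nu> \<pi> \<longleftrightarrow> \<pi> = distr (mvn m \<Gamma>) borel vsplit3) \<and>
         are_dual_potentials \<epsilon> \<mu> \<nu>
           (\<lambda>u. - (1 / 2) * (u \<bullet> ((\<Lambda> - mat 1) *v u)) - m\<^sub>Y \<bullet> u
                - \<epsilon> / 2 * ln (det (\<epsilon> *\<^sub>R (\<Lambda> ** \<Omega>YY))))
           (\<lambda>u. G *v u)
           (\<lambda>(x, y). - (1 / 2) * ((transpose G *v x + y - m\<^sub>Y)
                                   \<bullet> (\<Psi> *v (transpose G *v x + y - m\<^sub>Y)))
                     + (1 / 2) * (norm y)\<^sup>2)"
proof -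
  note \<epsilon> = assms(1) and \<mu>_def = assms(2) and \<Sigma>_def = assms(3) and \<nu>_def = assms(6) and \<Lambda>_def = assms(8)
    and m_def = assms(9) and \<Gamma>_def = assms(10) and G_def = assms(11) and \<Omega>_def = assms(12) and \<Psi>_def = assms(13)
  have \<Sigma>: "pos_def (block2 \<Sigma>XX \<Sigma>XY \<Sigma>YX \<Sigma>YY)"
    using pos_semidef_invertible_imp_pos_def[OF assms(4,5)] by (simp add: \<Sigma>_def)
  note tr = pos_def_block2D[OF \<Sigma>]
  have XX: "pos_def \<Sigma>XX" and YX: "\<Sigma>YX = transpose \<Sigma>XY" using tr by auto
  have symX: "transpose (matrix_inv \<Sigma>XX) = matrix_inv \<Sigma>XX"
    using pos_def_matrix_inv[OF XX] by (simp add: pos_def_def)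
  note invX = matrix_inv_mult[OF pos_def_invertible[OF XX]]
  define S where "S = \<Sigma>YY - \<Sigma>YX ** matrix_inv \<Sigma>XX ** \<Sigma>XY"
  have S: "pos_def S" using pos_def_schur_complement_snd[of \<Sigma>XX \<Sigma>XY \<Sigma>YY] \<Sigma> by (simp add: S_def YX)
  have \<Lambda>: "pos_def \<Lambda>" and \<Lambda>S: "\<Lambda> ** \<Lambda> + \<epsilon> *\<^sub>R \<Lambda> = S"
    using shifted_psd_sqrt_quadratic[OF S \<epsilon>] by (simp_all add: \<Lambda>_def S_def)
  have \<Lambda>sym: "transpose \<Lambda> = \<Lambda>" using \<Lambda> by (simp add: pos_def_def)
  have K: "pos_def (\<epsilon> *\<^sub>R \<Lambda>)" using pos_def_scaleR[OF \<Lambda> \<epsilon>] .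
  \<comment> \<open>\<open>M = - G\<^sup>T\<close> is the coefficient of the regression of \<open>Y\<close> on \<open>X\<close>.\<close>
  define M where "M = \<Sigma>YX ** matrix_inv \<Sigma>XX"
  have MT: "transpose M = matrix_inv \<Sigma>XX ** \<Sigma>XY"
    by (simp add: M_def matrix_transpose_mul YX symX)
  have XMT: "\<Sigma>XX ** transpose M = \<Sigma>XY" by (simp add: MT matrix_mul_assoc invX)
  have MX: "M ** \<Sigma>XX = \<Sigma>YX" by (simp add: M_def matrix_mul_assoc[symmetric] invX)
  have MG: "M *v x = - (transpose G *v x)" for x
  proof -
    have "transpose G = - transpose (transpose M)"
      unfolding G_def MT by (simp add: transpose_def vec_eq_iff)
    then show ?thesis by (simp add: matrix_vector_mult_def vec_eq_iff sum_negf)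
  qed
  \<comment> \<open>\<open>\<Sigma>'\<close> is the conditional covariance of \<open>(X, Y)\<close> given \<open>U\<close>; its Schur complement is \<open>\<epsilon> \<Lambda>\<close>.\<close>
  define \<Sigma>' where "\<Sigma>' = block2 \<Sigma>XX \<Sigma>XY \<Sigma>YX (\<Sigma>YY - \<Lambda> ** \<Lambda>)"
  have MXM: "M ** \<Sigma>XX ** transpose M = \<Sigma>YX ** matrix_inv \<Sigma>XX ** \<Sigma>XY"
    by (simp add: MX MT matrix_mul_assoc)
  have \<Sigma>_blocks: "block2 \<Sigma>XX \<Sigma>XY \<Sigma>YX \<Sigma>YY =
      block2 \<Sigma>XX (\<Sigma>XX ** transpose M) (M ** \<Sigma>XX) (M ** \<Sigma>XX ** transpose M + S)"
    unfolding XMT MXM unfolding MX by (simp add: S_def)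
  have \<Sigma>'_blocks: "\<Sigma>' = block2 \<Sigma>XX (\<Sigma>XX ** transpose M) (M ** \<Sigma>XX) (M ** \<Sigma>XX ** transpose M + \<epsilon> *\<^sub>R \<Lambda>)"
  proof -
    have "\<Sigma>YY - \<Lambda> ** \<Lambda> = \<Sigma>YX ** matrix_inv \<Sigma>XX ** \<Sigma>XY + \<epsilon> *\<^sub>R \<Lambda>"
      using \<Lambda>S by (simp add: S_def algebra_simps)
    then show ?thesis unfolding XMT MXM unfolding MX by (simp add: \<Sigma>'_def)
  qed
  have \<Sigma>': "pos_def \<Sigma>'" unfolding \<Sigma>'_blocks by (rule pos_def_block2I[OF XX K])
  \<comment> \<open>\<open>N\<close> is the coefficient of the regression of \<open>(X, Y)\<close> on \<open>U\<close>, with blocks \<open>0\<close> and \<open>\<Lambda>\<close>.\<close>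
  define N where "N = transpose (beside (0 :: real^'x^'y) \<Lambda>)"
  have Nv: "N *v u = vjoin 0 (\<Lambda> *v u)" for u
  proof -
    have "transpose (0 :: real^'x^'y) = 0" by (simp add: transpose_def vec_eq_iff)
    then show ?thesis unfolding N_def transpose_beside_mult \<Lambda>sym by (simp only: matrix_vector_mult_0)
  qed
  have NTv: "transpose N *v vjoin x y = \<Lambda> *v y" for x y
    by (simp add: N_def beside_mult_vjoin)
  have \<Gamma>_block2: "\<Gamma> = block2 (mat 1) (transpose N) N \<Sigma>"
    unfolding \<Gamma>_def \<Sigma>_def N_def transpose_transpose
    by (rule block3_eq_block2) (simp add: transpose_def vec_eq_iff, simp only: \<Lambda>sym)
  have \<Sigma>N: "\<Sigma> = N ** mat 1 ** transpose N + \<Sigma>'"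
    unfolding matrix_eq
  proof
    fix z :: "real^('x + 'y)"
    obtain x y where z: "z = vjoin x y" by (rule vjoin_cases)
    show "\<Sigma> *v z = (N ** mat 1 ** transpose N + \<Sigma>') *v z"
      unfolding z \<Sigma>_def \<Sigma>'_def
      by (simp add: matrix_vector_mult_add_rdistrib matrix_vector_mul_assoc[symmetric] NTv Nv block2_mult_vjoin
          vjoin_add matrix_vector_mult_diff_rdistrib del: transpose_matrix_vector)
  qed
  have \<Gamma>_blocks: "\<Gamma> = block2 (mat 1) (mat 1 ** transpose N) (N ** mat 1) (N ** mat 1 ** transpose N + \<Sigma>')"
    unfolding \<Gamma>_block2 using \<Sigma>N by simp
  have \<Gamma>: "pos_def \<Gamma>" unfolding \<Gamma>_blocks by (rule pos_def_block2I[OF pos_def_mat_1 \<Sigma>'])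
  have \<mu>_prob: "prob_space \<mu>" and \<mu>_sets: "sets \<mu> = sets borel"
    unfolding \<mu>_def using prob_space_mvn[OF pos_def_mat_1] by auto
  have \<Sigma>pd: "pos_def \<Sigma>" using \<Sigma> by (simp add: \<Sigma>_def)
  have \<nu>_sets: "sets \<nu> = sets borel" by (simp add: \<nu>_def)
  have \<nu>_prob: "prob_space \<nu>" unfolding \<nu>_def
    by (rule prob_space.prob_space_distr[OF prob_space_mvn[OF \<Sigma>pd]]) simp
  interpret \<mu>: prob_space \<mu> by (rule \<mu>_prob)
  interpret \<nu>: prob_space \<nu> by (rule \<nu>_prob)

  \<comment> \<open>\<open>T\<close> recovers \<open>(x, y)\<close> from \<open>x\<close> and the residual \<open>w\<close>. In these coordinates \<open>\<nu>\<close> and all the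
    conditional laws \<open>\<kappa> u\<close> are products with the same first factor.\<close>
  define T :: "(real^'x) \<times> (real^'y) \<Rightarrow> (real^'x) \<times> (real^'y)" where
    "T = (\<lambda>(x, w). (x, m\<^sub>Y + M *v x + w))"
  have T_meas[measurable]: "T \<in> borel \<Otimes>\<^sub>M borel \<rightarrow>\<^sub>M borel"
    unfolding T_def borel_prod[symmetric] by measurable
  have \<nu>_T: "\<nu> = distr (mvn 0 \<Sigma>XX \<Otimes>\<^sub>M mvn 0 S) borel T"
    unfolding \<nu>_def \<Sigma>_def \<Sigma>_blocks mvn_regression_on_fst[OF XX S] T_def by simp
  define F where "F = (\<lambda>u t. vsplit (vjoin 0 m\<^sub>Y + N *v u + t))"
  define \<kappa> where "\<kappa> u = distr (mvn 0 \<Sigma>') borel (F u)" for u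
  have \<kappa>_T: "\<kappa> u = distr (mvn 0 \<Sigma>XX \<Otimes>\<^sub>M mvn (\<Lambda> *v u) (\<epsilon> *\<^sub>R \<Lambda>)) borel T" for u
  proof -
    have "\<kappa> u = distr (mvn (vjoin 0 m\<^sub>Y + N *v u) \<Sigma>') borel vsplit"
      using mvn_translate[OF \<Sigma>', of "vjoin 0 m\<^sub>Y + N *v u" 0]
      by (simp add: \<kappa>_def F_def distr_distr comp_def)
    also have "vjoin 0 m\<^sub>Y + N *v u = vjoin 0 (m\<^sub>Y + \<Lambda> *v u)" by (simp add: Nv vjoin_add)
    also have "distr (mvn (vjoin 0 (m\<^sub>Y + \<Lambda> *v u)) \<Sigma>') borel vsplit =
        distr (mvn 0 \<Sigma>XX \<Otimes>\<^sub>M mvn 0 (\<epsilon> *\<^sub>R \<Lambda>)) borel (\<lambda>(x, t). (x, m\<^sub>Y + \<Lambda> *v u + M *v x + t))"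
      unfolding \<Sigma>'_blocks mvn_regression_on_fst[OF XX K] by simp
    also have "\<dots> = distr (distr (mvn 0 \<Sigma>XX \<Otimes>\<^sub>M mvn 0 (\<epsilon> *\<^sub>R \<Lambda>)) (borel \<Otimes>\<^sub>M borel) (\<lambda>(x, t). (x, \<Lambda> *v u + t))) borel T"
    proof -
      have g: "(\<lambda>(x, t). (x, \<Lambda> *v u + t)) \<in> mvn 0 \<Sigma>XX \<Otimes>\<^sub>M mvn 0 (\<epsilon> *\<^sub>R \<Lambda>) \<rightarrow>\<^sub>M borel \<Otimes>\<^sub>M borel"
        by measurable
      show ?thesis
        unfolding distr_distr[OF T_meas g]
        by (rule arg_cong[where f = "distr _ borel"]) (simp add: fun_eq_iff T_def add_ac)
    qed
    also have "\<dots> = distr (mvn 0 \<Sigma>XX \<Otimes>\<^sub>M mvn (\<Lambda> *v u) (\<epsilon> *\<^sub>R \<Lambda>)) borel T"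
      unfolding mvn_pair_translate[OF XX K, of 0 "\<Lambda> *v u"] ..
    finally show ?thesis .
  qed
  have \<kappa>_fst: "distr (\<kappa> u) borel fst = mvn 0 \<Sigma>XX" for u
  proof -
    have "distr (\<kappa> u) borel fst = distr (mvn 0 \<Sigma>XX \<Otimes>\<^sub>M mvn (\<Lambda> *v u) (\<epsilon> *\<^sub>R \<Lambda>)) (mvn 0 \<Sigma>XX) fst"
      unfolding \<kappa>_T by (subst distr_distr) (auto simp: comp_def T_def case_prod_beta intro!: distr_cong)
    also have "\<dots> = mvn 0 \<Sigma>XX"
      by (intro distr_pair_fst prob_space_mvn K prob_space_imp_sigma_finite XX)
    finally show ?thesis .
  qed
  have \<kappa>_sets: "sets (\<kappa> u) = sets borel" for u by (simp add: \<kappa>_def)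
  have fst_\<kappa>: "fst \<in> borel_measurable (\<kappa> u)" for u
    by (simp add: measurable_cong_sets[OF \<kappa>_sets refl])
  have mean: "integrable (\<kappa> u) fst" "(\<integral>z. fst z \<partial>\<kappa> u) = 0" for u
  proof -
    have id: "(\<lambda>x :: real^'x. x) \<in> borel_measurable borel" by simp
    show "integrable (\<kappa> u) fst"
      using integrable_distr_eq[OF fst_\<kappa> id, of u] mvn_centered(1)[OF XX] unfolding \<kappa>_fst by simp
    show "(\<integral>z. fst z \<partial>\<kappa> u) = 0"
      using integral_distr[OF fst_\<kappa> id, of u] mvn_centered(2)[OF XX] unfolding \<kappa>_fst by simp
  qed
  define C where "C = (\<integral>x. norm x \<partial>mvn 0 \<Sigma>XX)"
  have bound: "(\<integral>\<^sup>+z. ennreal (norm (fst z)) \<partial>\<kappa> u) \<le> ennreal C" for u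
  proof -
    have "(\<integral>\<^sup>+z. ennreal (norm (fst z)) \<partial>\<kappa> u) = (\<integral>\<^sup>+x. ennreal (norm x) \<partial>distr (\<kappa> u) borel fst)"
      by (rule nn_integral_distr[OF fst_\<kappa>, symmetric]) simp
    also have "\<dots> = ennreal C"
      unfolding \<kappa>_fst C_def by (rule nn_integral_eq_integral) (use mvn_centered(1)[OF XX] in auto)
    finally show ?thesis by simp
  qed

  define c where "c = \<epsilon> / 2 * ln (det (\<epsilon> *\<^sub>R (\<Lambda> ** \<Omega>YY)))"
  have \<Omega>S: "\<Omega>YY = matrix_inv S" by (simp add: \<Omega>_def S_def)
  define q where "q u w = (- (1 / 2) * (u \<bullet> (\<Lambda> *v u)) + u \<bullet> w - (1 / 2) * (w \<bullet> (\<Psi> *v w)) - c) / \<epsilon>" for u w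
  have tilt: "mvn (\<Lambda> *v u) (\<epsilon> *\<^sub>R \<Lambda>) = density (mvn 0 S) (\<lambda>w. ennreal (exp (q u w)))" for u
    using mvn_tilt[OF \<epsilon> S \<Lambda> \<Lambda>S, of u] by (simp add: q_def c_def \<Omega>S \<Psi>_def)
  \<comment> \<open>\<open>W\<close> is the residual as a function of \<open>(x, y)\<close>.\<close>
  define W where "W z = transpose G *v fst z + snd z - m\<^sub>Y" for z :: "(real^'x) \<times> (real^'y)"
  have W_T: "W (T xw) = snd xw" for xw
    using MG[of "fst xw"] by (simp add: W_def T_def case_prod_beta del: transpose_matrix_vector)
  have W_meas[measurable]: "W \<in> borel_measurable borel"
    unfolding W_def[abs_def] borel_prod[symmetric] by (simp del: transpose_matrix_vector)
  define P where "P = (\<lambda>w. ennreal (exp (q (fst w) (W (snd w)))))"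
  have P_meas[measurable]: "P \<in> borel_measurable (borel \<Otimes>\<^sub>M borel)"
    unfolding P_def q_def by measurable
  have \<kappa>_P: "\<kappa> u = density \<nu> (\<lambda>z. P (u, z))" for u
  proof -
    have "mvn 0 \<Sigma>XX \<Otimes>\<^sub>M mvn (\<Lambda> *v u) (\<epsilon> *\<^sub>R \<Lambda>) = density (mvn 0 \<Sigma>XX \<Otimes>\<^sub>M mvn 0 S) (\<lambda>(x, w). ennreal (exp (q u w)))"
      unfolding tilt
    proof (rule pair_density_snd)
      show "prob_space (density (mvn 0 S) (\<lambda>w. ennreal (exp (q u w))))"
        unfolding tilt[symmetric] by (rule prob_space_mvn[OF K])
      show "(\<lambda>w. ennreal (exp (q u w))) \<in> borel_measurable (mvn 0 S)"
        unfolding q_def by measurable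
    qed (auto intro: prob_space_mvn XX S)
    also have "\<dots> = density (mvn 0 \<Sigma>XX \<Otimes>\<^sub>M mvn 0 S) (\<lambda>xw. P (u, T xw))"
      by (rule arg_cong[where f = "density _"]) (simp add: fun_eq_iff P_def W_T)
    finally have "\<kappa> u = distr (density (mvn 0 \<Sigma>XX \<Otimes>\<^sub>M mvn 0 S) (\<lambda>xw. P (u, T xw))) borel T"
      unfolding \<kappa>_T by simp
    also have "\<dots> = density (distr (mvn 0 \<Sigma>XX \<Otimes>\<^sub>M mvn 0 S) borel T) (\<lambda>z. P (u, z))"
      by (rule density_distr[symmetric]) measurable
    finally show ?thesis unfolding \<nu>_T .
  qed

  define \<pi>s where "\<pi>s = distr (mvn m \<Gamma>) borel vsplit3"
  have vs3: "vsplit3 = (\<lambda>(u, z). (u, vsplit z)) \<circ> (vsplit :: real^('y + ('x + 'y)) \<Rightarrow> _)"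
    by (simp add: fun_eq_iff vsplit3_def case_prod_beta)
  have lift_meas[measurable]: "(\<lambda>(u :: real^'y, z :: real^('x + 'y)). (u, vsplit z)) \<in> borel_measurable borel"
    unfolding borel_prod[symmetric] by measurable
  have F_meas: "(\<lambda>(u, t). F u t) \<in> borel \<Otimes>\<^sub>M mvn 0 \<Sigma>' \<rightarrow>\<^sub>M borel"
    unfolding F_def borel_prod[symmetric] by measurable
  have \<pi>s_vsplit: "\<pi>s = distr (distr (mvn m \<Gamma>) borel vsplit) borel (\<lambda>(u, z). (u, vsplit z))"
    unfolding \<pi>s_def vs3 by (rule distr_distr[symmetric]) auto
  have \<pi>s_F: "\<pi>s = distr (\<mu> \<Otimes>\<^sub>M mvn 0 \<Sigma>') borel (\<lambda>(u, t). (u, F u t))"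
  proof -
    have "\<pi>s = distr (distr (mvn 0 (mat 1) \<Otimes>\<^sub>M mvn 0 \<Sigma>') borel (\<lambda>(u, t). (u, vjoin 0 m\<^sub>Y + N *v (u - 0) + t)))
        borel (\<lambda>(u, z). (u, vsplit z))"
      unfolding \<pi>s_vsplit m_def \<Gamma>_blocks mvn_regression_on_fst[OF pos_def_mat_1 \<Sigma>'] ..
    also have "\<dots> = distr (\<mu> \<Otimes>\<^sub>M mvn 0 \<Sigma>') borel (\<lambda>(u, t). (u, F u t))"
    proof -
      have g: "(\<lambda>(u, t). (u, vjoin 0 m\<^sub>Y + N *v (u - 0) + t)) \<in> mvn 0 (mat 1) \<Otimes>\<^sub>M mvn 0 \<Sigma>' \<rightarrow>\<^sub>M borel"
        unfolding borel_prod[symmetric] by measurable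
      show ?thesis
        unfolding distr_distr[OF lift_meas g] \<mu>_def
        by (rule arg_cong[where f = "distr _ borel"]) (simp add: fun_eq_iff F_def)
    qed
    finally show ?thesis .
  qed
  note kernel = pair_distr_eq_density[OF \<mu>_prob \<mu>_sets prob_space_mvn[OF \<Sigma>'] \<nu>_prob \<nu>_sets F_meas P_meas \<kappa>_P[unfolded \<kappa>_def],
      folded \<pi>s_F \<kappa>_def]
  have \<pi>s_snd: "distr \<pi>s borel snd = \<nu>"
  proof -
    \<comment> \<open>The second marginal is read off from the regression of \<open>U\<close> on \<open>(X, Y)\<close>.\<close>
    define M' where "M' = transpose N ** matrix_inv \<Sigma>"
    note invS = matrix_inv_mult[OF pos_def_invertible[OF \<Sigma>pd]]
    have symS: "transpose (matrix_inv \<Sigma>) = matrix_inv \<Sigma>" 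
      using pos_def_matrix_inv[OF \<Sigma>pd] by (simp add: pos_def_def)
    define K' where "K' = mat 1 - transpose N ** matrix_inv \<Sigma> ** N"
    have K': "pos_def K'"
      using pos_def_schur_complement_fst[of "mat 1" "transpose N" \<Sigma>] \<Gamma> by (simp add: \<Gamma>_block2 K'_def)
    have M'S: "M' ** \<Sigma> = transpose N" by (simp add: M'_def matrix_mul_assoc[symmetric] invS)
    have M'T: "transpose M' = matrix_inv \<Sigma> ** N" by (simp add: M'_def matrix_transpose_mul symS)
    have SM': "\<Sigma> ** transpose M' = N" by (simp add: M'T matrix_mul_assoc invS)
    have "\<Gamma> = block2 (M' ** \<Sigma> ** transpose M' + K') (M' ** \<Sigma>) (\<Sigma> ** transpose M') \<Sigma>"
      unfolding \<Gamma>_block2 SM' unfolding M'S by (simp add: M'T K'_def matrix_mul_assoc)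
    then have "distr (mvn m \<Gamma>) borel vsplit = distr (mvn 0 K' \<Otimes>\<^sub>M mvn (vjoin 0 m\<^sub>Y) \<Sigma>) borel
        (\<lambda>(t, y). (0 + M' *v (y - vjoin 0 m\<^sub>Y) + t, y))"
      unfolding m_def by (simp only: mvn_regression_on_snd[OF \<Sigma>pd K'])
    then have "distr \<pi>s borel snd = distr (distr (distr (mvn 0 K' \<Otimes>\<^sub>M mvn (vjoin 0 m\<^sub>Y) \<Sigma>) borel
        (\<lambda>(t, y). (0 + M' *v (y - vjoin 0 m\<^sub>Y) + t, y))) borel (\<lambda>(u, z). (u, vsplit z))) borel snd"
      unfolding \<pi>s_vsplit by simp
    also have "\<dots> = distr (distr (mvn 0 K' \<Otimes>\<^sub>M mvn (vjoin 0 m\<^sub>Y) \<Sigma>) (mvn (vjoin 0 m\<^sub>Y) \<Sigma>) snd) borel vsplit"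
    proof -
      have g: "(\<lambda>(t, y). (0 + M' *v (y - vjoin 0 m\<^sub>Y) + t, y)) \<in> mvn 0 K' \<Otimes>\<^sub>M mvn (vjoin 0 m\<^sub>Y) \<Sigma> \<rightarrow>\<^sub>M borel"
        unfolding borel_prod[symmetric] by measurable
      show ?thesis
        by (simp add: distr_distr[OF borel_measurable_fst_snd(2) lift_meas] distr_distr[OF _ g]
            distr_distr measurable_comp[OF lift_meas] comp_def case_prod_beta)
    qed
    also have "\<dots> = \<nu>"
      unfolding \<nu>_def
      by (subst distr_pair_snd) (auto intro: prob_space_mvn K' \<Sigma>pd prob_space_imp_sigma_finite)
    finally show ?thesis .
  qed
  have coup: "\<pi>s \<in> couplings \<mu> \<nu>"
    unfolding couplings_def using kernel(3) \<pi>s_snd by (simp add: \<pi>s_def)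

  define f where "f u = - (1 / 2) * (u \<bullet> ((\<Lambda> - mat 1) *v u)) - m\<^sub>Y \<bullet> u - c" for u
  define h where "h z = - (1 / 2) * (W z \<bullet> (\<Psi> *v W z)) + (1 / 2) * (norm (snd z))\<^sup>2" for z
  have mom_u: "integrable \<mu> (\<lambda>u. (norm u)\<^sup>2)" unfolding \<mu>_def by (rule mvn_second_moment[OF pos_def_mat_1])
  have mom_z: "integrable \<nu> (\<lambda>z. (norm z)\<^sup>2)"
  proof -
    have "(norm (vsplit t))\<^sup>2 = (norm t)\<^sup>2" for t :: "real^('x + 'y)"
    proof -
      obtain x y where t: "t = vjoin x y" by (rule vjoin_cases)
      show ?thesis by (simp add: t power2_norm_eq_inner inner_vjoin)
    qed
    then show ?thesis
      unfolding \<nu>_def by (subst integrable_distr_eq) (simp_all add: mvn_second_moment[OF \<Sigma>pd])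
  qed
  have f_int: "integrable \<mu> f"
  proof -
    have "integrable \<mu> (\<lambda>u. u \<bullet> ((\<Lambda> - mat 1) *v u))"
      by (rule integrable_quadratic_form[OF _ mom_u]) (simp add: \<mu>_def)
    moreover have "integrable \<mu> (\<lambda>u. u)"
      unfolding \<mu>_def by (rule mvn_centered(1)[OF pos_def_mat_1])
    ultimately show ?thesis unfolding f_def[abs_def] by simp
  qed
  have h_int: "integrable \<nu> h"
  proof -
    have "integrable \<nu> (\<lambda>z. (norm (W z))\<^sup>2)"
    proof -
      have "integrable (mvn 0 \<Sigma>XX \<Otimes>\<^sub>M mvn 0 S) (\<lambda>xw. (norm (snd xw))\<^sup>2)"
      proof -
        have "distr (mvn 0 \<Sigma>XX \<Otimes>\<^sub>M mvn 0 S) (mvn 0 S) snd = mvn 0 S"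
          by (intro distr_pair_snd prob_space_mvn XX S prob_space_imp_sigma_finite)
        then have "integrable (distr (mvn 0 \<Sigma>XX \<Otimes>\<^sub>M mvn 0 S) (mvn 0 S) snd) (\<lambda>w. (norm w)\<^sup>2)"
          using mvn_second_moment[OF S, of 0] by simp
        then show ?thesis by (subst (asm) integrable_distr_eq) auto
      qed
      then show ?thesis unfolding \<nu>_T by (subst integrable_distr_eq) (auto simp: W_T)
    qed
    then have "integrable \<nu> (\<lambda>z. W z \<bullet> (\<Psi> *v W z))"
      by (rule integrable_quadratic_form[rotated]) (simp add: measurable_cong_sets[OF \<nu>_sets refl])
    moreover have "integrable \<nu> (\<lambda>z. (norm (snd z))\<^sup>2)"
    proof (rule Bochner_Integration.integrable_bound[OF mom_z])
      show "(\<lambda>z. (norm (snd z))\<^sup>2) \<in> borel_measurable \<nu>"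
        by (simp add: measurable_cong_sets[OF \<nu>_sets refl])
      have "(norm (snd z))\<^sup>2 \<le> (norm z)\<^sup>2" for z :: "(real^'x) \<times> (real^'y)"
        using norm_snd_le[of "snd z" "fst z"] by (intro power_mono) auto
      then show "AE z in \<nu>. norm ((norm (snd z))\<^sup>2) \<le> norm ((norm z)\<^sup>2)" by simp
    qed
    ultimately show ?thesis unfolding h_def[abs_def] by simp
  qed
  have exponent: "f u + (G *v u) \<bullet> x + h (x, y) - cost u y = \<epsilon> * q u (W (x, y))" for u x y
  proof -
    have "(G *v u) \<bullet> x = u \<bullet> (transpose G *v x)" by (rule transpose_inner)
    then have "(G *v u) \<bullet> x = u \<bullet> W (x, y) - u \<bullet> y + m\<^sub>Y \<bullet> u"
      by (simp add: W_def inner_add_right inner_diff_right inner_commute del: transpose_matrix_vector)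
    moreover have "cost u y = (1 / 2) * (u \<bullet> u) - u \<bullet> y + (1 / 2) * (norm y)\<^sup>2"
      by (simp add: cost_def power2_norm_eq_inner inner_diff_left inner_diff_right inner_commute field_simps)
    moreover have "u \<bullet> ((\<Lambda> - mat 1) *v u) = u \<bullet> (\<Lambda> *v u) - u \<bullet> u"
      by (simp add: matrix_vector_mult_diff_rdistrib inner_diff_right)
    moreover have "\<epsilon> * q u (W (x, y)) = - (1 / 2) * (u \<bullet> (\<Lambda> *v u)) + u \<bullet> W (x, y)
        - (1 / 2) * (W (x, y) \<bullet> (\<Psi> *v W (x, y))) - c"
      using \<epsilon> by (simp add: q_def)
    ultimately show ?thesis
      by (simp add: f_def h_def algebra_simps)
  qed
  have \<pi>s_dens: "\<pi>s = density (\<mu> \<Otimes>\<^sub>M \<nu>) (\<lambda>(u, x, y). ennreal (exp ((f u + (G *v u) \<bullet> x + h (x, y) - cost u y) / \<epsilon>)))"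
    unfolding kernel(1) exponent
    by (rule arg_cong[where f = "density _"]) (use \<epsilon> in \<open>simp add: fun_eq_iff P_def\<close>)
  note verify = evqr_verification[OF \<epsilon> \<mu>_prob \<mu>_sets \<nu>_prob \<nu>_sets mom_u mom_z f_int h_int
      matrix_vector_mul_linear[of G] \<pi>s_dens coup kernel(2) mean bound]
  have f_eq: "f = (\<lambda>u. - (1 / 2) * (u \<bullet> ((\<Lambda> - mat 1) *v u)) - m\<^sub>Y \<bullet> u
                - \<epsilon> / 2 * ln (det (\<epsilon> *\<^sub>R (\<Lambda> ** \<Omega>YY))))"
    by (simp add: fun_eq_iff f_def c_def)
  have h_eq: "h = (\<lambda>(x, y). - (1 / 2) * ((transpose G *v x + y - m\<^sub>Y)
                                   \<bullet> (\<Psi> *v (transpose G *v x + y - m\<^sub>Y)))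
                     + (1 / 2) * (norm y)\<^sup>2)"
    by (simp add: fun_eq_iff h_def W_def)
  show ?thesis
    using \<Lambda> \<Gamma> verify(1) verify(2)[unfolded f_eq h_eq] unfolding \<pi>s_def by blast
qed

end
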